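(* Let $(m_k)_{k\in\mathbb N}$ be a strictly increasing sequence in $\mathbb N$ and let $\lambda\in[0,1]$. Then the set of all $T\in\mathrm{Aut}([0,1],\mathcal B,\mu)$ for which there exists a strictly increasing sequence $(k_\ell)_{\ell\in\mathbb N}$ in $\mathbb N$ such that for all $A,B\in\mathcal B$, $$\lim_{\ell\to\infty}\mu(A\cap T^{-m_{k_\ell}}B)=(1-\lambda)\mu(A\cap B)+\lambda\mu(A)\mu(B),$$ is a dense $G_\delta$ subset of $\mathrm{Aut}([0,1],\mathcal B,\mu)$.
   Context: $\mathbb N=\{1,2,\dots\}$. $\mathcal B$ is the Borel $\sigma$-algebra of $[0,1]$ and $\mu$ is Lebesgue measure. $\mathrm{Aut}([0,1],\mathcal B,\mu)$ is the set of invertible $\mu$-preserving transformations $T:[0,1]\to[0,1]$ (as usual identified when they agree $\mu$-a.e.), endowed with the weak topology: $T_n\to T$ if and only if $\|T_nf-Tf\|_{L^2}\to0$ for each $f\in L^2(\mu)$, where $Tf=f\circ T$. This topology is completely metrizable. *)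

theory Defs
  imports "HOL-Analysis.Analysis"
begin

definition unit_lebesgue :: "real measure" where
  "unit_lebesgue = restrict_space lborel {0..1}"

text \<open>Representatives: bijections of the underlying space, measurable in both directions and
  preserving the measure. Values outside \<^term>\<open>space M\<close> are irrelevant.\<close>

definition mp_automorphisms :: "'a measure \<Rightarrow> ('a \<Rightarrow> 'a) set" where
  "mp_automorphisms M =
    {T \<in> M \<rightarrow>\<^sub>M M. bij_betw T (space M) (space M)
        \<and> the_inv_into (space M) T \<in> M \<rightarrow>\<^sub>M M
        \<and> distr M M T = M}"

definition ae_eq_rel :: "'a measure \<Rightarrow> (('a \<Rightarrow> 'a) \<times> ('a \<Rightarrow> 'a)) set" where
  "ae_eq_rel M =
    {(S, T). S \<in> mp_automorphisms M \<and> T \<in> mp_automorphisms M \<and> (AE x in M. S x = T x)}"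

definition aut_class :: "'a measure \<Rightarrow> ('a \<Rightarrow> 'a) \<Rightarrow> ('a \<Rightarrow> 'a) set" where
  "aut_class M T = ae_eq_rel M `` {T}"

definition Aut :: "'a measure \<Rightarrow> ('a \<Rightarrow> 'a) set set" where
  "Aut M = mp_automorphisms M // ae_eq_rel M"

definition L2 :: "'a measure \<Rightarrow> ('a \<Rightarrow> real) set" where
  "L2 M = {f \<in> borel_measurable M. integrable M (\<lambda>x. (f x)\<^sup>2)}"

text \<open>The \<open>L\<^sup>2\<close>-norm of \<open>f \<circ> S - f \<circ> T\<close>.\<close>

definition koopman_dist :: "'a measure \<Rightarrow> ('a \<Rightarrow> real) \<Rightarrow> ('a \<Rightarrow> 'a) \<Rightarrow> ('a \<Rightarrow> 'a) \<Rightarrow> real" where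
  "koopman_dist M f S T = sqrt (\<integral>x. (f (S x) - f (T x))\<^sup>2 \<partial>M)"

text \<open>The initial topology of the pseudometrics \<^term>\<open>koopman_dist M f\<close>; its convergent sequences
  are characterised in \<open>limitin_weak_topology\<close> below.\<close>

definition weak_topology :: "'a measure \<Rightarrow> ('a \<Rightarrow> 'a) set topology" where
  "weak_topology M = topology_generated_by
    {aut_class M ` {S \<in> mp_automorphisms M. koopman_dist M f S T < e} | f T e.
        f \<in> L2 M \<and> T \<in> mp_automorphisms M \<and> 0 < e}"

text \<open>This property depends only on \<^term>\<open>aut_class M T\<close>.\<close>

definition mixing_along_subseq :: "'a measure \<Rightarrow> (nat \<Rightarrow> nat) \<Rightarrow> real \<Rightarrow> ('a \<Rightarrow> 'a) \<Rightarrow> bool" where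
  "mixing_along_subseq M m l T \<longleftrightarrow>
    (\<exists>k :: nat \<Rightarrow> nat. strict_mono k \<and>
      (\<forall>A \<in> sets M. \<forall>B \<in> sets M.
        (\<lambda>i. measure M (A \<inter> ((T ^^ m (k i)) -` B \<inter> space M)))
          \<longlonglongrightarrow> (1 - l) * measure M (A \<inter> B) + l * (measure M A * measure M B)))"

lemma equiv_ae_eq_rel: "equiv (mp_automorphisms M) (ae_eq_rel M)"
proof (rule equivI)
  show "ae_eq_rel M \<subseteq> mp_automorphisms M \<times> mp_automorphisms M" by (auto simp: ae_eq_rel_def)
  show "refl_on (mp_automorphisms M) (ae_eq_rel M)" by (auto simp: refl_on_def ae_eq_rel_def)
  show "sym (ae_eq_rel M)" by (auto simp: sym_def ae_eq_rel_def eq_commute)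
  show "trans (ae_eq_rel M)"
  proof (rule transI)
    fix R S T assume "(R, S) \<in> ae_eq_rel M" "(S, T) \<in> ae_eq_rel M"
    then have "R \<in> mp_automorphisms M" "T \<in> mp_automorphisms M"
      and "AE x in M. R x = S x" "AE x in M. S x = T x" by (auto simp: ae_eq_rel_def)
    moreover from this(3,4) have "AE x in M. R x = T x" by eventually_elim simp
    ultimately show "(R, T) \<in> ae_eq_rel M" by (simp add: ae_eq_rel_def)
  qed
qed

lemma aut_class_eq_iff:
  assumes "S \<in> mp_automorphisms M" "T \<in> mp_automorphisms M"
  shows "aut_class M S = aut_class M T \<longleftrightarrow> (AE x in M. S x = T x)"
  unfolding aut_class_def
  using eq_equiv_class_iff[OF equiv_ae_eq_rel assms] assms by (auto simp: ae_eq_rel_def)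

lemma Aut_eq: "Aut M = aut_class M ` mp_automorphisms M"
  by (auto simp: Aut_def quotient_def aut_class_def)

lemma topspace_weak_topology [simp]: "topspace (weak_topology M) = Aut M"
proof -
  have *: "aut_class M ` mp_automorphisms M
     = aut_class M ` {S \<in> mp_automorphisms M. koopman_dist M (\<lambda>_. 0) S T < 1}" for T
    by (auto simp: koopman_dist_def)
  show ?thesis
    unfolding weak_topology_def topology_generated_by_topspace Aut_eq
  proof (intro equalityI subsetI)
    fix x assume x: "x \<in> aut_class M ` mp_automorphisms M"
    then obtain T where T: "T \<in> mp_automorphisms M" by auto
    have "(\<lambda>_. 0) \<in> L2 M" by (auto simp: L2_def)
    with T x show "x \<in> \<Union> {aut_class M ` {S \<in> mp_automorphisms M. koopman_dist M f S T < e} |f T e.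
         f \<in> L2 M \<and> T \<in> mp_automorphisms M \<and> 0 < e}"
      using T *[of T] zero_less_one by (intro UnionI[OF _ x] CollectI) blast
  qed auto
qed

lemma L2_norm_triangle:
  assumes u: "u \<in> L2 M" and v: "v \<in> L2 M"
  shows "sqrt (\<integral>x. (u x + v x)\<^sup>2 \<partial>M) \<le> sqrt (\<integral>x. (u x)\<^sup>2 \<partial>M) + sqrt (\<integral>x. (v x)\<^sup>2 \<partial>M)"
    and "(\<lambda>x. u x + v x) \<in> L2 M"
proof -
  have [measurable]: "u \<in> borel_measurable M" "v \<in> borel_measurable M"
    and iu: "integrable M (\<lambda>x. (u x)\<^sup>2)" and iv: "integrable M (\<lambda>x. (v x)\<^sup>2)"
    using u v by (auto simp: L2_def)
  have "integrable M (\<lambda>x. 2 * ((u x)\<^sup>2 + (v x)\<^sup>2))" using iu iv by auto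
  moreover have "norm ((u x + v x)\<^sup>2) \<le> norm (2 * ((u x)\<^sup>2 + (v x)\<^sup>2))" for x
    using zero_le_power2[of "u x - v x"] zero_le_power2[of "u x + v x"]
    unfolding power2_sum power2_diff real_norm_def by (smt (verit))
  ultimately have i: "integrable M (\<lambda>x. (u x + v x)\<^sup>2)"
    by (intro Bochner_Integration.integrable_bound[where g="\<lambda>x. (u x + v x)\<^sup>2"]) auto
  then show "(\<lambda>x. u x + v x) \<in> L2 M" by (auto simp: L2_def)
  define a b where "a = sqrt (\<integral>x. (u x)\<^sup>2 \<partial>M)" and "b = sqrt (\<integral>x. (v x)\<^sup>2 \<partial>M)"
  have a: "a \<ge> 0" "(\<integral>x. (u x)\<^sup>2 \<partial>M) = a\<^sup>2" and b: "b \<ge> 0" "(\<integral>x. (v x)\<^sup>2 \<partial>M) = b\<^sup>2"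
    by (auto simp: a_def b_def)
  have "sqrt (\<integral>x. (u x + v x)\<^sup>2 \<partial>M) \<le> a + b"
  proof (rule field_le_epsilon)
    fix e :: real assume e: "e > 0"
    define p q where "p = a + e/2" and "q = b + e/2"
    have pq: "p > 0" "q > 0" "a \<le> p" "b \<le> q" using a b e by (auto simp: p_def q_def)
    have pt: "(s + t)\<^sup>2 \<le> (p + q) * (s\<^sup>2 / p + t\<^sup>2 / q)" for s t :: real
    proof -
      have "(p + q) * (s\<^sup>2 / p + t\<^sup>2 / q) - (s + t)\<^sup>2 = (q * s - p * t)\<^sup>2 / (p * q)"
        using pq by (simp add: field_simps power2_eq_square)
      moreover have "\<dots> \<ge> 0" using pq by simp
      ultimately show ?thesis by linarith
    qed
    have "(\<integral>x. (u x + v x)\<^sup>2 \<partial>M) \<le> (\<integral>x. (p + q) * ((u x)\<^sup>2 / p + (v x)\<^sup>2 / q) \<partial>M)"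
      using i iu iv pt by (intro integral_mono) auto
    also have "\<dots> = (p + q) * (a\<^sup>2 / p + b\<^sup>2 / q)"
      using iu iv a b by simp
    also have "\<dots> \<le> (p + q) * (p + q)"
    proof (intro mult_left_mono add_mono)
      show "a\<^sup>2 / p \<le> p" "b\<^sup>2 / q \<le> q"
        using pq a(1) b(1) by (simp_all add: divide_le_eq power2_eq_square mult_mono)
    qed (use pq in auto)
    finally show "sqrt (\<integral>x. (u x + v x)\<^sup>2 \<partial>M) \<le> a + b + e"
      using pq by (intro real_le_lsqrt) (auto simp: power2_eq_square p_def q_def algebra_simps)
  qed
  then show "sqrt (\<integral>x. (u x + v x)\<^sup>2 \<partial>M) \<le> sqrt (\<integral>x. (u x)\<^sup>2 \<partial>M) + sqrt (\<integral>x. (v x)\<^sup>2 \<partial>M)"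
    by (simp add: a_def b_def)
qed

lemma L2_comp:
  assumes f: "f \<in> L2 M" and T: "T \<in> mp_automorphisms M"
  shows "(\<lambda>x. f (T x)) \<in> L2 M"
proof -
  have [measurable]: "f \<in> borel_measurable M" "T \<in> M \<rightarrow>\<^sub>M M" and d: "distr M M T = M"
    using f T by (auto simp: L2_def mp_automorphisms_def)
  have "integrable (distr M M T) (\<lambda>x. (f x)\<^sup>2)" using f d by (simp add: L2_def)
  then show ?thesis by (simp add: L2_def integrable_distr_eq)
qed

lemma L2_diff:
  assumes f: "f \<in> L2 M" and "S \<in> mp_automorphisms M" "T \<in> mp_automorphisms M"
  shows "(\<lambda>x. f (S x) - f (T x)) \<in> L2 M"
proof -
  have "(\<lambda>x. - f (T x)) \<in> L2 M" using L2_comp[OF f assms(3)] by (simp add: L2_def)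
  from L2_norm_triangle(2)[OF L2_comp[OF f assms(2)] this] show ?thesis by simp
qed

lemma koopman_dist_triangle:
  assumes "f \<in> L2 M" "R \<in> mp_automorphisms M" "S \<in> mp_automorphisms M" "T \<in> mp_automorphisms M"
  shows "koopman_dist M f R T \<le> koopman_dist M f R S + koopman_dist M f S T"
  using L2_norm_triangle(1)[OF L2_diff[OF assms(1,2,3)] L2_diff[OF assms(1,3,4)]]
  by (simp add: koopman_dist_def)

lemma koopman_dist_cong:
  assumes "f \<in> L2 M" "R \<in> mp_automorphisms M" "S \<in> mp_automorphisms M" "T \<in> mp_automorphisms M"
    and "AE x in M. R x = S x"
  shows "koopman_dist M f R T = koopman_dist M f S T"
proof -
  have [measurable]: "f \<in> borel_measurable M" "R \<in> M \<rightarrow>\<^sub>M M" "S \<in> M \<rightarrow>\<^sub>M M" "T \<in> M \<rightarrow>\<^sub>M M"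
    using assms by (auto simp: L2_def mp_automorphisms_def)
  show ?thesis unfolding koopman_dist_def
    using assms(5) by (intro arg_cong[where f=sqrt] integral_cong_AE) auto
qed

lemma aut_class_in_ball_iff:
  assumes "f \<in> L2 M" "S \<in> mp_automorphisms M" "T \<in> mp_automorphisms M"
  shows "aut_class M S \<in> aut_class M ` {S \<in> mp_automorphisms M. koopman_dist M f S T < e}
     \<longleftrightarrow> koopman_dist M f S T < e"
proof
  assume "aut_class M S \<in> aut_class M ` {S \<in> mp_automorphisms M. koopman_dist M f S T < e}"
  then obtain R where R: "R \<in> mp_automorphisms M" "koopman_dist M f R T < e"
    and "aut_class M S = aut_class M R" by blast
  then have "AE x in M. S x = R x" using aut_class_eq_iff[OF assms(2) R(1)] by simp
  from koopman_dist_cong[OF assms(1,2) R(1) assms(3) this] R(2)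
  show "koopman_dist M f S T < e" by simp
qed (use assms in blast)

lemma limitin_topology_generated_by:
  "limitin (topology_generated_by \<S>) g l F \<longleftrightarrow>
     l \<in> \<Union>\<S> \<and> (\<forall>U\<in>\<S>. l \<in> U \<longrightarrow> eventually (\<lambda>x. g x \<in> U) F)" (is "?L \<longleftrightarrow> ?R")
proof
  assume ?L then show ?R
    unfolding limitin_def topology_generated_by_topspace
    using topology_generated_by_Basis by blast
next
  assume R: ?R
  have "l \<in> U \<longrightarrow> eventually (\<lambda>x. g x \<in> U) F" if "generate_topology_on \<S> U" for U
    using that
  proof induction
    case (UN K)
    show ?case
    proof
      assume "l \<in> \<Union>K"
      then obtain k where k: "k \<in> K" "l \<in> k" by auto
      with UN have "eventually (\<lambda>x. g x \<in> k) F" by auto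
      then show "eventually (\<lambda>x. g x \<in> \<Union>K) F" by (rule eventually_mono) (use k in auto)
    qed
  qed (use R in \<open>auto simp: eventually_conj_iff\<close>)
  then show ?L
    unfolding limitin_def topology_generated_by_topspace openin_topology_generated_by_iff
    using R by blast
qed

theorem limitin_weak_topology:
  assumes Tn: "\<And>n. T n \<in> mp_automorphisms M" and T: "T' \<in> mp_automorphisms M"
  shows "limitin (weak_topology M) (\<lambda>n. aut_class M (T n)) (aut_class M T') sequentially \<longleftrightarrow>
     (\<forall>f \<in> L2 M. (\<lambda>n. koopman_dist M f (T n) T') \<longlonglongrightarrow> 0)" (is "?L \<longleftrightarrow> ?R")
proof
  have nn: "koopman_dist M f S U \<ge> 0" for f S U by (simp add: koopman_dist_def)
  have z: "koopman_dist M f S S = 0" for f S by (simp add: koopman_dist_def)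
  {
    assume L: ?L
    show ?R
    proof (intro ballI tendstoI)
      fix f :: "'a \<Rightarrow> real" and e :: real assume f: "f \<in> L2 M" and e: "e > 0"
      let ?U = "aut_class M ` {S \<in> mp_automorphisms M. koopman_dist M f S T' < e}"
      have "aut_class M T' \<in> ?U" using T e z by auto
      moreover have "openin (weak_topology M) ?U"
        unfolding weak_topology_def by (rule topology_generated_by_Basis) (use f T e in blast)
      ultimately have "eventually (\<lambda>n. aut_class M (T n) \<in> ?U) sequentially"
        using L by (auto simp: limitin_def)
      then show "eventually (\<lambda>n. dist (koopman_dist M f (T n) T') 0 < e) sequentially"
        unfolding aut_class_in_ball_iff[OF f Tn T] using nn by (simp add: dist_real_def)
    qed
  }
  assume R: ?R
  have "aut_class M T' \<in> topspace (weak_topology M)"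
    using T by (simp add: Aut_eq)
  note * = this[unfolded weak_topology_def topology_generated_by_topspace]
  show ?L
    unfolding weak_topology_def limitin_topology_generated_by
  proof (intro conjI ballI impI, rule *)
    fix U assume "U \<in> {aut_class M ` {S \<in> mp_automorphisms M. koopman_dist M f S T < e} |f T e.
         f \<in> L2 M \<and> T \<in> mp_automorphisms M \<and> 0 < e}" and l: "aut_class M T' \<in> U"
    then obtain f S e where f: "f \<in> L2 M" and S: "S \<in> mp_automorphisms M" and e: "e > 0"
      and U: "U = aut_class M ` {R \<in> mp_automorphisms M. koopman_dist M f R S < e}" by blast
    have "e - koopman_dist M f T' S > 0"
      using l unfolding U aut_class_in_ball_iff[OF f T S] by simp
    then have "eventually (\<lambda>n. koopman_dist M f (T n) T' < e - koopman_dist M f T' S) sequentially"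
      using R f by (intro order_tendstoD(2)) auto
    then show "eventually (\<lambda>n. aut_class M (T n) \<in> U) sequentially"
      unfolding U aut_class_in_ball_iff[OF f Tn S]
      by (rule eventually_mono) (use koopman_dist_triangle[OF f Tn T S] in \<open>smt (verit)\<close>)
  qed
qed

end

theory Submission
  imports Defs "HOL-Probability.Levy"
begin

text \<open>
  Let \<open>G\<close> be the set in question. Convergence of the correlations
  \<open>\<mu>(A \<inter> T\<^sup>-\<^sup>n B)\<close> along a sequence of times only has to be tested on the intervals
  \<open>{x \<in> {0..1}. x \<le> r}\<close> with rational \<open>r\<close>, so \<open>G\<close> is the intersection of the sets \<open>W N\<close> of those \<open>T\<close> for which some
  \<open>k \<ge> N\<close> brings the correlations of the first \<open>N + 1\<close> such intervals at time \<open>m k\<close> within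
  \<open>1 / (N + 1)\<close> of the prescribed limit (\<open>mixing_along_subseq_iff\<close>). Correlations at a fixed time
  are weakly continuous, so every \<open>W N\<close> is open, and \<open>G\<close> is a \<open>G\<^sub>\<delta>\<close>.

  Density of \<open>G\<close> follows from density of each \<open>W N\<close> by the argument of Baire, carried out for the
  distance \<open>\<integral>\<bar>S - T\<bar> + \<integral>\<bar>S\<^sup>-\<^sup>1 - T\<^sup>-\<^sup>1\<bar>\<close> (\<open>Baire_weak_topology\<close>). Weakly open sets are open for it,
  because \<open>f \<circ> S\<close> is close to \<open>f \<circ> T\<close> in \<open>L\<^sup>2\<close> when \<open>S\<close> is close to \<open>T\<close>, uniformly over all
  measure-preserving maps; and it is complete. A limit is at first an automorphism up to null sets
  only; it is turned into a true bijection by \<open>automorphism_mod0_realization\<close>.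

  The heart of the matter is the density of \<open>W N\<close>, that is, \<open>partial_mixing_approximation\<close>. Fix an
  automorphism \<open>T\<^sub>0\<close> and a height \<open>n\<close>. On the space of all \<open>(i, x, y, c)\<close> with \<open>i < n\<close>, with
  \<open>x, y\<close> in the unit interval and with \<open>c\<close> a coin that shows heads with probability \<open>l\<close>, let \<open>R\<close>
  raise \<open>i\<close> by one; from the top level \<open>R\<close> returns to the level \<open>0\<close> and, if the coin shows heads,
  exchanges \<open>x\<close> and \<open>y\<close>. The map \<open>\<Phi>(i, x, y, c) = T\<^sub>0\<^sup>i x\<close> preserves the measures and satisfies
  \<open>\<Phi> \<circ> R = T\<^sub>0 \<circ> \<Phi>\<close> below the top level, that is, off a set of measure \<open>1 / n\<close>. On the other hand
  \<open>R\<^sup>n\<close> is the identity on tails and the exchange of the independent points \<open>x\<close> and \<open>y\<close> on heads.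
  Hence the sets \<open>\<Phi>\<^sup>-\<^sup>1 A\<close> and \<open>\<Phi>\<^sup>-\<^sup>1 B\<close> have, at time \<open>n\<close>, correlation exactly
  \<open>(1 - l) \<mu>(A \<inter> B) + l \<mu>(A) \<mu>(B)\<close>. Since only finitely many sets \<open>A\<close> matter, it suffices to copy
  a finite partition of this space, with the permutation that \<open>R\<close> induces on its cells, into the unit
  interval in such a way that \<open>\<Phi>\<^sup>-\<^sup>1 A\<close> goes to \<open>A\<close>. This is done by \<open>refine_labelling\<close>, which cuts
  sets into pieces of given measures, and \<open>automorphism_permuting_cells\<close>. Taking \<open>n = m k\<close> with \<open>k\<close>
  large makes the resulting automorphism close to \<open>T\<^sub>0\<close> and puts it into \<open>W N\<close>.
\<close>

section \<open>The unit interval and its automorphisms\<close>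

abbreviation \<U> :: "real measure" where "\<U> \<equiv> unit_lebesgue"

lemma space_unit [simp]: "space \<U> = {0..1}"
  by (simp add: unit_lebesgue_def space_restrict_space)

lemma sets_unit_iff: "A \<in> sets \<U> \<longleftrightarrow> A \<in> sets borel \<and> A \<subseteq> {0..1}"
  by (auto simp: unit_lebesgue_def sets_restrict_space_iff)

lemma emeasure_unit: "A \<in> sets \<U> \<Longrightarrow> emeasure \<U> A = emeasure lborel A"
  unfolding sets_unit_iff by (simp add: unit_lebesgue_def emeasure_restrict_space)

interpretation unit: prob_space \<U>
proof
  have "{0..1} \<in> sets \<U>" by (simp add: sets_unit_iff)
  from emeasure_unit[OF this] show "emeasure \<U> (space \<U>) = 1" by simp
qed

lemma borel_measurable_unit: "f \<in> borel_measurable borel \<Longrightarrow> f \<in> borel_measurable \<U>"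
  by (simp add: unit_lebesgue_def measurable_restrict_space1)

lemma measurable_unitI:
  assumes "f \<in> borel_measurable \<U>" "\<And>x. x \<in> {0..1} \<Longrightarrow> f x \<in> {0..1}"
  shows "f \<in> \<U> \<rightarrow>\<^sub>M \<U>"
proof -
  have "f \<in> \<U> \<rightarrow>\<^sub>M lborel" using assms(1) by simp
  then show ?thesis
    using assms(2) by (subst (2) unit_lebesgue_def) (auto intro!: measurable_restrict_space2)
qed

lemma borel_measurable_of_unit [measurable_dest]:
  assumes "f \<in> \<U> \<rightarrow>\<^sub>M \<U>" shows "f \<in> borel_measurable \<U>"
  by (rule measurable_compose[OF assms, of "\<lambda>x. x", simplified]) (rule borel_measurable_unit, simp)

lemma pred_eq_unit [measurable (raw)]:
  assumes "f \<in> M \<rightarrow>\<^sub>M \<U>" "g \<in> M \<rightarrow>\<^sub>M \<U>"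
  shows "Measurable.pred M (\<lambda>x. f x = g x)"
proof -
  have "(\<lambda>x. x) \<in> borel_measurable \<U>" by (rule borel_measurable_unit) simp
  with assms have "f \<in> borel_measurable M" "g \<in> borel_measurable M"
    using measurable_compose by blast+
  then show ?thesis by measurable
qed

abbreviation inv01 :: "(real \<Rightarrow> real) \<Rightarrow> real \<Rightarrow> real" where
  "inv01 T \<equiv> the_inv_into {0..1} T"

lemma mp_automorphismD:
  assumes "T \<in> mp_automorphisms \<U>"
  shows "T \<in> \<U> \<rightarrow>\<^sub>M \<U>" "inv01 T \<in> \<U> \<rightarrow>\<^sub>M \<U>" "distr \<U> \<U> T = \<U>" "distr \<U> \<U> (inv01 T) = \<U>"
    "bij_betw T {0..1} {0..1}"
    "\<And>x. x \<in> {0..1} \<Longrightarrow> T x \<in> {0..1}" "\<And>x. x \<in> {0..1} \<Longrightarrow> inv01 T x \<in> {0..1}"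
    "\<And>x. x \<in> {0..1} \<Longrightarrow> inv01 T (T x) = x" "\<And>x. x \<in> {0..1} \<Longrightarrow> T (inv01 T x) = x"
proof -
  show 1: "T \<in> \<U> \<rightarrow>\<^sub>M \<U>" "inv01 T \<in> \<U> \<rightarrow>\<^sub>M \<U>" "distr \<U> \<U> T = \<U>" "bij_betw T {0..1} {0..1}"
    using assms by (auto simp: mp_automorphisms_def)
  show 2: "\<And>x. x \<in> {0..1} \<Longrightarrow> T x \<in> {0..1}" using 1(4) by (auto simp: bij_betw_def)
  show 3: "\<And>x. x \<in> {0..1} \<Longrightarrow> inv01 T (T x) = x"
    using 1(4) by (auto simp: bij_betw_def the_inv_into_f_f)
  show "\<And>x. x \<in> {0..1} \<Longrightarrow> T (inv01 T x) = x"
    using 1(4) by (auto simp: bij_betw_def f_the_inv_into_f)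
  show "\<And>x. x \<in> {0..1} \<Longrightarrow> inv01 T x \<in> {0..1}"
    using 1(4) bij_betw_the_inv_into[of T "{0..1}" "{0..1}"] by (auto simp: bij_betw_def)
  have "distr \<U> \<U> (inv01 T) = distr (distr \<U> \<U> T) \<U> (inv01 T)" using 1 by simp
  also have "\<dots> = distr \<U> \<U> (\<lambda>x. inv01 T (T x))"
    using 1 by (subst distr_distr) (auto simp: o_def)
  also have "\<dots> = distr \<U> \<U> (\<lambda>x. x)" using 3 by (intro distr_cong) auto
  finally show "distr \<U> \<U> (inv01 T) = \<U>" by (simp add: distr_id)
qed

lemma mp_automorphismI:
  assumes "T \<in> \<U> \<rightarrow>\<^sub>M \<U>" "S \<in> \<U> \<rightarrow>\<^sub>M \<U>" "distr \<U> \<U> T = \<U>"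
    and ST: "\<And>x. x \<in> {0..1} \<Longrightarrow> S (T x) = x" and TS: "\<And>x. x \<in> {0..1} \<Longrightarrow> T (S x) = x"
  shows "T \<in> mp_automorphisms \<U>" "\<And>x. x \<in> {0..1} \<Longrightarrow> inv01 T x = S x"
proof -
  have T: "T x \<in> {0..1}" and S: "S x \<in> {0..1}" if "x \<in> {0..1}" for x
    using measurable_space[OF assms(1), of x] measurable_space[OF assms(2), of x] that by auto
  have bij: "bij_betw T {0..1} {0..1}"
    by (rule bij_betw_byWitness[where f'=S]) (use T S ST TS in auto)
  show inv: "inv01 T x = S x" if "x \<in> {0..1}" for x
    using the_inv_into_f_f[of T "{0..1}" "S x"] bij S[OF that] TS[OF that] by (auto simp: bij_betw_def)
  have "inv01 T \<in> \<U> \<rightarrow>\<^sub>M \<U>"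
    using assms(2) inv by (subst measurable_cong[where g=S]) auto
  then show "T \<in> mp_automorphisms \<U>"
    using assms bij by (auto simp: mp_automorphisms_def)
qed

lemma mp_automorphism_inv:
  assumes "T \<in> mp_automorphisms \<U>"
  shows "inv01 T \<in> mp_automorphisms \<U>" "\<And>x. x \<in> {0..1} \<Longrightarrow> inv01 (inv01 T) x = T x"
  using mp_automorphismI[of "inv01 T" T] mp_automorphismD[OF assms] by auto

lemma mp_automorphism_comp:
  assumes "S \<in> mp_automorphisms \<U>" "T \<in> mp_automorphisms \<U>"
  shows "S \<circ> T \<in> mp_automorphisms \<U>"
proof (rule mp_automorphismI(1)[where S="inv01 T \<circ> inv01 S"])
  note S = mp_automorphismD[OF assms(1)] and T = mp_automorphismD[OF assms(2)]
  show "S \<circ> T \<in> \<U> \<rightarrow>\<^sub>M \<U>" "inv01 T \<circ> inv01 S \<in> \<U> \<rightarrow>\<^sub>M \<U>"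
    using S(1,2) T(1,2) by (auto intro: measurable_comp)
  show "distr \<U> \<U> (S \<circ> T) = \<U>"
    using distr_distr[OF S(1) T(1)] S(3) T(3) by simp
qed (use mp_automorphismD[OF assms(1)] mp_automorphismD[OF assms(2)] in auto)

lemma mp_automorphism_funpow:
  assumes "T \<in> mp_automorphisms \<U>" shows "T ^^ n \<in> mp_automorphisms \<U>"
proof (induction n)
  case 0
  show ?case by (rule mp_automorphismI(1)[where S="\<lambda>x. x"]) (auto simp: distr_id id_def)
next
  case (Suc n)
  then show ?case using mp_automorphism_comp[OF assms Suc] by (simp only: funpow.simps)
qed

lemma AE_measure_preserving:
  assumes "T \<in> M \<rightarrow>\<^sub>M M" "distr M M T = M" "AE x in M. P x"
  shows "AE x in M. P (T x)"
  by (rule AE_distrD[OF assms(1), unfolded assms(2), OF assms(3)])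

lemma integral_measure_preserving:
  fixes f :: "'a \<Rightarrow> real"
  assumes "T \<in> M \<rightarrow>\<^sub>M M" "distr M M T = M" "f \<in> borel_measurable M"
  shows "(\<integral>x. f (T x) \<partial>M) = (\<integral>x. f x \<partial>M)"
  using integral_distr[of T M M f] assms by simp

lemma measure_measure_preserving:
  assumes "T \<in> M \<rightarrow>\<^sub>M M" "distr M M T = M" "A \<in> sets M"
  shows "measure M (T -` A \<inter> space M) = measure M A"
  using measure_distr[of T M M A] assms by simp

section \<open>Automorphisms modulo null sets\<close>

definition rational :: "nat \<Rightarrow> real" where
  "rational = from_nat_into \<rat>"

lemma bij_rational: "bij_betw rational UNIV \<rat>"
proof -
  have "infinite (range (of_nat :: nat \<Rightarrow> real))"
    by (rule range_inj_infinite) (rule inj_of_nat)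
  moreover have "range (of_nat :: nat \<Rightarrow> real) \<subseteq> \<rat>" by auto
  ultimately have "infinite (\<rat> :: real set)" by (metis finite_subset)
  with countable_rat show ?thesis
    unfolding rational_def by (rule bij_betw_from_nat_into)
qed

text \<open>A strictly increasing function all of whose increase takes place in jumps: the jump at the \<open>n\<close>-th
rational has height \<open>2\<^sup>-\<^sup>(\<^sup>n\<^sup>+\<^sup>1\<^sup>)\<close>.\<close>

definition jump :: "real \<Rightarrow> real" where
  "jump x = (\<Sum>n. if rational n < x then (1/2) ^ Suc n else 0)"

lemma summable_jump: "summable (\<lambda>n. if rational n < x then (1/2::real) ^ Suc n else 0)"
  by (rule summable_comparison_test'[where g="\<lambda>n. (1/2::real) ^ n" and N=0])
     (auto intro: summable_geometric)

lemma jump_mono: "x \<le> y \<Longrightarrow> jump x \<le> jump y"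
  unfolding jump_def by (intro suminf_le summable_jump) auto

lemma jump_gap:
  assumes "x \<le> rational n" "rational n < y"
  shows "jump x + (1/2) ^ Suc n \<le> jump y"
proof -
  let ?d = "\<lambda>k. (if rational k < y then (1/2::real) ^ Suc k else 0)
                 - (if rational k < x then (1/2) ^ Suc k else 0)"
  have "summable ?d" by (intro summable_diff summable_jump)
  moreover have "?d k \<ge> 0" for k using assms by auto
  ultimately have "sum ?d {n} \<le> suminf ?d" by (intro sum_le_suminf) auto
  also have "suminf ?d = jump y - jump x"
    unfolding jump_def by (intro suminf_diff[symmetric] summable_jump)
  finally show ?thesis using assms by simp
qed

lemma jump_strict_mono:
  assumes "x < y" shows "jump x < jump y"
proof -
  obtain r where "r \<in> \<rat>" "x < r" "r < y" using Rats_dense_in_real[OF assms] by auto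
  then obtain n where "rational n = r" using bij_rational by (metis bij_betw_iff_bijections)
  with jump_gap[of x n y] \<open>x < r\<close> \<open>r < y\<close> have "jump x + (1/2) ^ Suc n \<le> jump y" by auto
  moreover have "(0::real) < (1/2) ^ Suc n" by simp
  ultimately show ?thesis by linarith
qed

lemma jump_bounds: "0 \<le> jump x" "jump x \<le> 1"
proof -
  show "0 \<le> jump x" unfolding jump_def by (intro suminf_nonneg summable_jump) auto
  have "jump x \<le> (\<Sum>n. (1/2) ^ Suc n)"
    unfolding jump_def by (intro suminf_le summable_jump sums_summable[OF power_half_series]) auto
  then show "jump x \<le> 1" using sums_unique[OF power_half_series] by simp
qed

text \<open>The jumps of \<^const>\<open>jump\<close> leave out disjoint open intervals of total length \<open>1\<close>, so its values lie
in a null set \<open>C\<close>; being monotone, it and its left inverse are Borel. Thus \<open>C\<close> contains a Borel copy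
of the whole interval.\<close>

lemma null_embedding:
  obtains C \<iota> \<rho> where "C \<in> null_sets \<U>" "\<iota> \<in> \<U> \<rightarrow>\<^sub>M \<U>" "\<rho> \<in> \<U> \<rightarrow>\<^sub>M \<U>"
    "\<And>x. x \<in> {0..1} \<Longrightarrow> \<iota> x \<in> C" "\<And>x. x \<in> {0..1} \<Longrightarrow> \<rho> (\<iota> x) = x"
proof
  define G where "G n = {jump (rational n) <..< jump (rational n) + (1/2) ^ Suc n}" for n
  define C where "C = {0..1} - (\<Union>n. G n)"
  define \<rho> where "\<rho> y = Sup (insert 0 {x \<in> {0..1}. jump x \<le> y})" for y
  have avoid: "jump x \<notin> G n" for x n
    using jump_mono[of x "rational n"] jump_gap[of "rational n" n x] by (force simp: G_def)
  have G01: "G n \<subseteq> {0..1}" for n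
    using jump_bounds(1)[of "rational n"] jump_gap[of "rational n" n "rational n + 1"]
      jump_bounds(2)[of "rational n + 1"] by (auto simp: G_def)
  have disj: "disjoint_family G"
    unfolding disjoint_family_on_def
  proof safe
    have *: "G n \<inter> G k = {}" if "rational n < rational k" for n k
      using jump_gap[OF order_refl that] by (auto simp: G_def)
    fix n k x assume "n \<noteq> k" "x \<in> G n" "x \<in> G k"
    moreover from this have "rational n \<noteq> rational k"
      using bij_rational by (auto simp: bij_betw_def inj_on_def)
    ultimately show "x \<in> {}" using *[of n k] *[of k n] by (auto simp: neq_iff)
  qed
  have GU: "G n \<in> sets \<U>" for n using G01 by (auto simp: sets_unit_iff G_def)
  have "emeasure \<U> (\<Union>n. G n) = (\<Sum>n. emeasure \<U> (G n))"
    using GU disj by (intro suminf_emeasure[symmetric]) auto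
  also have "\<dots> = (\<Sum>n. ennreal ((1/2) ^ Suc n))"
    using GU by (intro suminf_cong) (simp add: emeasure_unit G_def)
  also have "\<dots> = ennreal 1"
    using power_half_series by (intro suminf_ennreal_eq) auto
  finally have "measure \<U> (\<Union>n. G n) = 1" by (simp add: measure_def)
  then have "measure \<U> C = 0"
    using unit.prob_compl[of "\<Union>n. G n"] GU unfolding C_def by auto
  then show "C \<in> null_sets \<U>"
    using sets.compl_sets[OF sets.countable_UN[of G UNIV \<U>]] GU
    by (auto simp: C_def null_sets_def unit.emeasure_eq_measure)
  show "jump \<in> \<U> \<rightarrow>\<^sub>M \<U>"
    using jump_bounds
    by (intro measurable_unitI borel_measurable_unit borel_measurable_mono) (auto simp: mono_def jump_mono)
  have bdd: "bdd_above (insert 0 {x \<in> {0..1}. jump x \<le> y})" for y by (auto intro!: bdd_aboveI[of _ 1])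
  have "mono \<rho>"
    unfolding \<rho>_def mono_def by (intro allI impI cSup_subset_mono) (use bdd in auto)
  moreover have "\<rho> y \<in> {0..1}" for y
    unfolding \<rho>_def using bdd by (auto intro!: cSup_upper cSup_least)
  ultimately show "\<rho> \<in> \<U> \<rightarrow>\<^sub>M \<U>"
    by (intro measurable_unitI borel_measurable_unit borel_measurable_mono)
  fix x :: real assume x: "x \<in> {0..1}"
  show "jump x \<in> C" using avoid jump_bounds by (auto simp: C_def)
  have "{z \<in> {0..1}. jump z \<le> jump x} = {0..x}"
    using x jump_mono jump_strict_mono by (force simp: not_le[symmetric])
  then show "\<rho> (jump x) = x" using x by (simp add: \<rho>_def insert_absorb)
qed

lemma measurable_funpow:
  "f \<in> M \<rightarrow>\<^sub>M M \<Longrightarrow> f ^^ n \<in> M \<rightarrow>\<^sub>M M"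
  by (induction n) (auto simp: id_def intro!: measurable_comp)

text \<open>The points outside \<open>N\<close> are moved into \<open>N\<close> as in Hilbert's hotel: \<open>a\<close> acts as \<open>\<iota>\<close> on all the images
\<open>\<iota>\<^sup>k(Z)\<close> of the complement \<open>Z\<close> of \<open>N\<close>, and as the identity elsewhere.\<close>

lemma Borel_bijection_onto:
  assumes \<iota>: "\<iota> \<in> \<U> \<rightarrow>\<^sub>M \<U>" "\<rho> \<in> \<U> \<rightarrow>\<^sub>M \<U>" "\<And>x. x \<in> {0..1} \<Longrightarrow> \<rho> (\<iota> x) = x"
    and N: "N \<in> sets \<U>" "\<And>x. x \<in> {0..1} \<Longrightarrow> \<iota> x \<in> N"
  obtains a b where "a \<in> \<U> \<rightarrow>\<^sub>M \<U>" "b \<in> \<U> \<rightarrow>\<^sub>M \<U>" "\<And>x. x \<in> {0..1} \<Longrightarrow> a x \<in> N"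
    "\<And>x. x \<in> {0..1} \<Longrightarrow> b (a x) = x" "\<And>y. y \<in> N \<Longrightarrow> a (b y) = y"
proof -
  note [measurable] = \<iota>(1,2) N(1)
  define Z where "Z = {0..1} - N"
  have [measurable]: "Z \<in> sets \<U>" using sets.compl_sets[OF N(1)] by (simp add: Z_def)
  have [measurable]: "\<rho> ^^ k \<in> \<U> \<rightarrow>\<^sub>M \<U>" "\<iota> ^^ k \<in> \<U> \<rightarrow>\<^sub>M \<U>" for k
    using \<iota> by (auto intro: measurable_funpow)
  define D where "D = (\<Union>k. {x \<in> space \<U>. (\<rho> ^^ k) x \<in> Z \<and> (\<iota> ^^ k) ((\<rho> ^^ k) x) = x})"
  have [measurable]: "D \<in> sets \<U>" unfolding D_def by measurable
  have \<iota>01: "\<iota> x \<in> {0..1}" if "x \<in> {0..1}" for x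
    using measurable_space[OF \<iota>(1), of x] that by auto
  have \<iota>k01: "(\<iota> ^^ k) x \<in> {0..1}" if "x \<in> {0..1}" for x k
    by (induction k) (use that \<iota>01 in auto)
  have \<rho>\<iota>: "(\<rho> ^^ k) ((\<iota> ^^ k) z) = z" if z: "z \<in> {0..1}" for z k
  proof (induction k)
    case (Suc k)
    have "(\<rho> ^^ Suc k) ((\<iota> ^^ Suc k) z) = (\<rho> ^^ k) (\<rho> (\<iota> ((\<iota> ^^ k) z)))"
      by (simp add: funpow_swap1)
    with Suc \<iota>(3)[OF \<iota>k01[OF z]] show ?case by simp
  qed simp
  have D_iff: "x \<in> D \<longleftrightarrow> (\<exists>k. \<exists>z\<in>Z. x = (\<iota> ^^ k) z)" for x
  proof
    assume "\<exists>k. \<exists>z\<in>Z. x = (\<iota> ^^ k) z"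
    then obtain k z where z: "z \<in> Z" "x = (\<iota> ^^ k) z" by auto
    then have "z \<in> {0..1}" by (auto simp: Z_def)
    with z \<rho>\<iota>[of z k] \<iota>k01[of z k] show "x \<in> D"
      unfolding D_def by (intro UN_I[of k]) auto
  next
    assume "x \<in> D"
    then obtain k where "(\<rho> ^^ k) x \<in> Z" "(\<iota> ^^ k) ((\<rho> ^^ k) x) = x" by (auto simp: D_def)
    then show "\<exists>k. \<exists>z\<in>Z. x = (\<iota> ^^ k) z" by metis
  qed
  have D_step: "\<iota> x \<in> D" if "x \<in> D" for x
  proof -
    from that obtain k z where "z \<in> Z" "x = (\<iota> ^^ k) z" unfolding D_iff by blast
    then have "\<iota> x = (\<iota> ^^ Suc k) z" by simp
    with \<open>z \<in> Z\<close> show ?thesis unfolding D_iff by blast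
  qed
  have ZD: "Z \<subseteq> D" unfolding D_iff subset_iff by (intro allI impI exI[of _ 0]) auto
  define a where "a x = (if x \<in> D then \<iota> x else x)" for x
  define b where "b x = (if x \<in> D then \<rho> x else x)" for x
  show thesis
  proof (rule that[of a b])
    show "a \<in> \<U> \<rightarrow>\<^sub>M \<U>" "b \<in> \<U> \<rightarrow>\<^sub>M \<U>" unfolding a_def b_def by measurable
    fix x :: real assume x: "x \<in> {0..1}"
    show "a x \<in> N" using ZD N(2) x by (auto simp: Z_def a_def)
    show "b (a x) = x" using D_step \<iota>(3) x by (auto simp: a_def b_def)
  next
    fix y assume y: "y \<in> N"
    show "a (b y) = y"
    proof (cases "y \<in> D")
      case True
      then obtain k z where z: "z \<in> Z" "y = (\<iota> ^^ k) z" unfolding D_iff by blast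
      with y obtain k' where "k = Suc k'" by (cases k) (auto simp: Z_def)
      moreover from z have "(\<iota> ^^ k') z \<in> {0..1}" by (intro \<iota>k01) (auto simp: Z_def)
      ultimately have "\<rho> y = (\<iota> ^^ k') z" "\<iota> (\<rho> y) = y" using z \<iota>(3) by auto
      moreover from this z have "\<rho> y \<in> D" unfolding D_iff by blast
      ultimately show ?thesis using True by (simp add: a_def b_def)
    qed (simp add: a_def b_def)
  qed
qed

definition automorphism_mod0 :: "(real \<Rightarrow> real) \<Rightarrow> (real \<Rightarrow> real) \<Rightarrow> bool" where
  "automorphism_mod0 T S \<longleftrightarrow> T \<in> \<U> \<rightarrow>\<^sub>M \<U> \<and> S \<in> \<U> \<rightarrow>\<^sub>M \<U> \<and> distr \<U> \<U> T = \<U>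
     \<and> (AE x in \<U>. S (T x) = x) \<and> (AE x in \<U>. T (S x) = x)"

text \<open>\<open>T\<close> is a bijection between conull Borel sets \<open>Z\<close> and \<open>Z'\<close>. They are chosen disjoint from the null
set \<open>C\<close> of \<open>null_embedding\<close>; then both complements contain a copy of the interval, hence both are Borel
isomorphic to the interval and so to each other; on them \<open>T\<close> is replaced by such an isomorphism.\<close>

lemma automorphism_mod0_realization:
  assumes "automorphism_mod0 T S"
  obtains R where "R \<in> mp_automorphisms \<U>" "AE x in \<U>. R x = T x" "AE x in \<U>. inv01 R x = S x"
proof -
  have [measurable]: "T \<in> \<U> \<rightarrow>\<^sub>M \<U>" "S \<in> \<U> \<rightarrow>\<^sub>M \<U>" and dT: "distr \<U> \<U> T = \<U>"
    and ST: "AE x in \<U>. S (T x) = x" and TS: "AE x in \<U>. T (S x) = x"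
    using assms by (auto simp: automorphism_mod0_def)
  have "distr \<U> \<U> S = distr (distr \<U> \<U> T) \<U> S" using dT by simp
  also have "\<dots> = distr \<U> \<U> (\<lambda>x. S (T x))" by (subst distr_distr) (auto simp: o_def)
  also have "\<dots> = distr \<U> \<U> (\<lambda>x. x)" using ST by (intro distr_cong_AE) auto
  finally have dS: "distr \<U> \<U> S = \<U>" by (simp add: distr_id)
  obtain C \<iota> \<rho> where C: "C \<in> null_sets \<U>" and \<iota>: "\<iota> \<in> \<U> \<rightarrow>\<^sub>M \<U>" "\<rho> \<in> \<U> \<rightarrow>\<^sub>M \<U>"
    "\<And>x. x \<in> {0..1} \<Longrightarrow> \<iota> x \<in> C" "\<And>x. x \<in> {0..1} \<Longrightarrow> \<rho> (\<iota> x) = x"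
    by (rule null_embedding) blast
  have [measurable]: "C \<in> sets \<U>" using C by auto
  have notC: "AE x in \<U>. x \<notin> C" using C by (rule AE_not_in)
  define Z where "Z = {x \<in> space \<U>. S (T x) = x \<and> x \<notin> C \<and> T x \<notin> C}"
  define Z' where "Z' = {x \<in> space \<U>. T (S x) = x \<and> x \<notin> C \<and> S x \<notin> C}"
  have [measurable]: "Z \<in> sets \<U>" "Z' \<in> sets \<U>" unfolding Z_def Z'_def by measurable
  have aeZ: "AE x in \<U>. x \<in> Z"
    using ST notC AE_measure_preserving[OF _ dT notC] by (auto simp: Z_def)
  have aeZ': "AE x in \<U>. x \<in> Z'"
    using TS notC AE_measure_preserving[OF _ dS notC] by (auto simp: Z'_def)
  have T01: "T x \<in> {0..1}" and S01: "S x \<in> {0..1}" if "x \<in> {0..1}" for x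
    using that measurable_space[of T \<U> \<U> x] measurable_space[of S \<U> \<U> x] by auto
  have TZ: "T x \<in> Z'" if "x \<in> Z" for x using that T01[of x] by (auto simp: Z_def Z'_def)
  have SZ: "S x \<in> Z" if "x \<in> Z'" for x using that S01[of x] by (auto simp: Z_def Z'_def)
  have N: "{0..1} - Z \<in> sets \<U>" "{0..1} - Z' \<in> sets \<U>"
    using sets.compl_sets[of Z \<U>] sets.compl_sets[of Z' \<U>] by auto
  have \<iota>01: "\<iota> x \<in> {0..1}" if "x \<in> {0..1}" for x
    using that measurable_space[OF \<iota>(1), of x] by auto
  obtain a b where ab[measurable]: "a \<in> \<U> \<rightarrow>\<^sub>M \<U>" "b \<in> \<U> \<rightarrow>\<^sub>M \<U>"
    and ab': "\<And>x. x \<in> {0..1} \<Longrightarrow> a x \<in> {0..1} - Z"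
      "\<And>x. x \<in> {0..1} \<Longrightarrow> b (a x) = x" "\<And>y. y \<in> {0..1} - Z \<Longrightarrow> a (b y) = y"
    by (rule Borel_bijection_onto[OF \<iota>(1,2,4) N(1)]) (use \<iota>(3) \<iota>01 in \<open>auto simp: Z_def\<close>)
  obtain a' b' where ab2[measurable]: "a' \<in> \<U> \<rightarrow>\<^sub>M \<U>" "b' \<in> \<U> \<rightarrow>\<^sub>M \<U>"
    and ab2': "\<And>x. x \<in> {0..1} \<Longrightarrow> a' x \<in> {0..1} - Z'"
      "\<And>x. x \<in> {0..1} \<Longrightarrow> b' (a' x) = x" "\<And>y. y \<in> {0..1} - Z' \<Longrightarrow> a' (b' y) = y"
    by (rule Borel_bijection_onto[OF \<iota>(1,2,4) N(2)]) (use \<iota>(3) \<iota>01 in \<open>auto simp: Z'_def\<close>)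
  have b01: "b x \<in> {0..1}" "b' x \<in> {0..1}" if "x \<in> {0..1}" for x
    using that measurable_space[OF ab(2), of x] measurable_space[OF ab2(2), of x] by auto
  define R where "R x = (if x \<in> Z then T x else a' (b x))" for x
  define R' where "R' x = (if x \<in> Z' then S x else a (b' x))" for x
  have [measurable]: "R \<in> \<U> \<rightarrow>\<^sub>M \<U>" "R' \<in> \<U> \<rightarrow>\<^sub>M \<U>" unfolding R_def R'_def by measurable
  have RT: "AE x in \<U>. R x = T x" using aeZ by eventually_elim (simp add: R_def)
  have RS: "AE x in \<U>. R' x = S x" using aeZ' by eventually_elim (simp add: R'_def)
  have "distr \<U> \<U> R = distr \<U> \<U> T" using RT by (intro distr_cong_AE) auto
  note * = mp_automorphismI[of R R', OF _ _ this[unfolded dT]]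
  have R'R: "R' (R x) = x" if x: "x \<in> {0..1}" for x
  proof (cases "x \<in> Z")
    case True then show ?thesis using TZ[OF True] by (simp add: R_def R'_def Z_def)
  next
    case False
    then show ?thesis
      using ab2'(1)[OF b01(1)[OF x]] ab2'(2)[OF b01(1)[OF x]] ab'(3) x by (auto simp: R_def R'_def)
  qed
  have RR': "R (R' x) = x" if x: "x \<in> {0..1}" for x
  proof (cases "x \<in> Z'")
    case True then show ?thesis using SZ[OF True] by (simp add: R_def R'_def Z'_def)
  next
    case False
    then show ?thesis
      using ab'(1)[OF b01(2)[OF x]] ab'(2)[OF b01(2)[OF x]] ab2'(3) x by (auto simp: R_def R'_def)
  qed
  have "R \<in> mp_automorphisms \<U>" and inv: "\<And>x. x \<in> {0..1} \<Longrightarrow> inv01 R x = R' x"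
    using * R'R RR' by auto
  moreover have "AE x in \<U>. inv01 R x = S x"
    using RS AE_space by eventually_elim (use inv in auto)
  ultimately show thesis using that RT by blast
qed

section \<open>Weakly open sets and the distance in mean\<close>

text \<open>Limits of automorphisms are measure-preserving before they are known to be invertible; the
continuity results below have to cover them.\<close>

definition mp_maps :: "(real \<Rightarrow> real) set" where
  "mp_maps = {T \<in> \<U> \<rightarrow>\<^sub>M \<U>. distr \<U> \<U> T = \<U>}"

lemma mp_mapsD:
  assumes "T \<in> mp_maps"
  shows "T \<in> \<U> \<rightarrow>\<^sub>M \<U>" "distr \<U> \<U> T = \<U>" "\<And>x. x \<in> {0..1} \<Longrightarrow> T x \<in> {0..1}"
  using assms measurable_space[of T \<U> \<U>] by (auto simp: mp_maps_def)

lemma mp_automorphism_mp_map: "T \<in> mp_automorphisms \<U> \<Longrightarrow> T \<in> mp_maps"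
  using mp_automorphismD(1,3)[of T] by (auto simp: mp_maps_def)

definition l1_dist :: "(real \<Rightarrow> real) \<Rightarrow> (real \<Rightarrow> real) \<Rightarrow> real" where
  "l1_dist S T = (\<integral>x. \<bar>S x - T x\<bar> \<partial>\<U>)"

lemma l1_dist_nonneg [simp]: "0 \<le> l1_dist S T"
  by (simp add: l1_dist_def)

lemma integrable_unit_bounded:
  fixes f :: "real \<Rightarrow> real"
  assumes "f \<in> borel_measurable \<U>" "\<And>x. x \<in> {0..1} \<Longrightarrow> \<bar>f x\<bar> \<le> B"
  shows "integrable \<U> f"
  using assms by (intro unit.integrable_const_bound[where B=B]) auto

lemma integrable_l1_dist:
  assumes [measurable]: "S \<in> \<U> \<rightarrow>\<^sub>M \<U>" "T \<in> \<U> \<rightarrow>\<^sub>M \<U>"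
  shows "integrable \<U> (\<lambda>x. \<bar>S x - T x\<bar>)"
proof (rule integrable_unit_bounded[where B=1])
  show "\<bar>\<bar>S x - T x\<bar>\<bar> \<le> 1" if "x \<in> {0..1}" for x
    using measurable_space[OF assms(1), of x] measurable_space[OF assms(2), of x] that by auto
qed measurable

lemma l1_dist_triangle:
  assumes "R \<in> \<U> \<rightarrow>\<^sub>M \<U>" "S \<in> \<U> \<rightarrow>\<^sub>M \<U>" "T \<in> \<U> \<rightarrow>\<^sub>M \<U>"
  shows "l1_dist R T \<le> l1_dist R S + l1_dist S T"
proof -
  have "l1_dist R T \<le> (\<integral>x. \<bar>R x - S x\<bar> + \<bar>S x - T x\<bar> \<partial>\<U>)"
    unfolding l1_dist_def using assms by (intro integral_mono) (auto intro: integrable_l1_dist)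
  also have "\<dots> = l1_dist R S + l1_dist S T"
    unfolding l1_dist_def using assms by (intro Bochner_Integration.integral_add integrable_l1_dist)
  finally show ?thesis .
qed

definition discrepancy :: "real set \<Rightarrow> (real \<Rightarrow> real) \<Rightarrow> (real \<Rightarrow> real) \<Rightarrow> real" where
  "discrepancy A S T = measure \<U> {x \<in> space \<U>. (S x \<in> A) \<noteq> (T x \<in> A)}"

lemma discrepancy_nonneg [simp]: "0 \<le> discrepancy A S T"
  by (simp add: discrepancy_def)

lemma L2_indicator: "A \<in> sets \<U> \<Longrightarrow> (indicator A :: real \<Rightarrow> real) \<in> L2 \<U>"
  unfolding L2_def
  by (auto intro!: integrable_unit_bounded[where B=1] simp: indicator_def)

lemma discrepancy_eq_koopman_dist:
  assumes "A \<in> sets \<U>" "S \<in> mp_maps" "T \<in> mp_maps"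
  shows "discrepancy A S T = (koopman_dist \<U> (indicator A) S T)\<^sup>2"
proof -
  have [measurable]: "A \<in> sets \<U>" "S \<in> \<U> \<rightarrow>\<^sub>M \<U>" "T \<in> \<U> \<rightarrow>\<^sub>M \<U>"
    using assms mp_mapsD by auto
  have "(\<integral>x. (indicator A (S x) - indicator A (T x) :: real)\<^sup>2 \<partial>\<U>)
      = (\<integral>x. indicator {x \<in> space \<U>. (S x \<in> A) \<noteq> (T x \<in> A)} x \<partial>\<U>)"
    by (intro Bochner_Integration.integral_cong) (auto simp: indicator_def)
  also have "\<dots> = measure \<U> ({x \<in> space \<U>. (S x \<in> A) \<noteq> (T x \<in> A)} \<inter> space \<U>)"
    by (rule Bochner_Integration.integral_indicator)
  also have "\<dots> = discrepancy A S T"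
    unfolding discrepancy_def by (intro arg_cong[where f="measure \<U>"]) auto
  finally show ?thesis by (simp add: koopman_dist_def)
qed

text \<open>Convergence along this filter expresses that a quantity depending on two measure-preserving maps
is small as soon as their distance in mean is small, uniformly in the maps.\<close>

definition close_pairs :: "((real \<Rightarrow> real) \<times> (real \<Rightarrow> real)) filter" where
  "close_pairs = inf (filtercomap (\<lambda>(S, T). l1_dist S T) (nhds 0)) (principal (mp_maps \<times> mp_maps))"

lemma eventually_close_pairs:
  "eventually P close_pairs \<longleftrightarrow>
     (\<exists>\<delta>>0. \<forall>S\<in>mp_maps. \<forall>T\<in>mp_maps. l1_dist S T < \<delta> \<longrightarrow> P (S, T))"
proof
  assume "eventually P close_pairs"
  then obtain Q where Q: "eventually Q (nhds 0)"
    "\<forall>p. Q (case p of (S, T) \<Rightarrow> l1_dist S T) \<longrightarrow> p \<in> mp_maps \<times> mp_maps \<longrightarrow> P p"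
    unfolding close_pairs_def eventually_inf_principal eventually_filtercomap by blast
  from Q(1) obtain d where "d > 0" "\<forall>x. dist x 0 < d \<longrightarrow> Q x"
    unfolding eventually_nhds_metric by blast
  with Q(2) show "\<exists>\<delta>>0. \<forall>S\<in>mp_maps. \<forall>T\<in>mp_maps. l1_dist S T < \<delta> \<longrightarrow> P (S, T)"
    by (intro exI[of _ d]) (auto simp: dist_real_def)
next
  assume "\<exists>\<delta>>0. \<forall>S\<in>mp_maps. \<forall>T\<in>mp_maps. l1_dist S T < \<delta> \<longrightarrow> P (S, T)"
  then obtain d :: real where "0 < d" "\<forall>S\<in>mp_maps. \<forall>T\<in>mp_maps. l1_dist S T < d \<longrightarrow> P (S, T)"
    by blast
  moreover from \<open>0 < d\<close> have "\<forall>\<^sub>F x in nhds 0. x < d" by (rule eventually_nhds_in_open[of "{..<d}", simplified])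
  ultimately show "eventually P close_pairs"
    unfolding close_pairs_def eventually_inf_principal eventually_filtercomap
    by (intro exI[of _ "\<lambda>x. x < d"]) auto
qed

text \<open>If \<open>S x\<close> and \<open>T x\<close> lie on different sides of \<open>a\<close>, then they are at distance at least \<open>\<eta>\<close>, or one
of them lies in \<open>(a - \<eta>, a]\<close>. The first event is bounded by Markov's inequality and the second one
by invariance of the measure.\<close>

lemma discrepancy_ray:
  assumes [simp]: "S \<in> mp_maps" "T \<in> mp_maps" and \<eta>: "\<eta> > 0"
  shows "discrepancy {..a} S T \<le> l1_dist S T / \<eta> + 2 * \<eta>"
proof -
  note [measurable] = mp_mapsD(1)[OF assms(1)] mp_mapsD(1)[OF assms(2)]
  define I where "I = {a - \<eta><..a} \<inter> {0..1}"
  have I: "I \<in> sets \<U>" by (auto simp: I_def sets_unit_iff)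
  have "measure \<U> I = measure lborel I"
    using emeasure_unit[OF I] by (simp add: measure_def)
  also have "\<dots> \<le> measure lborel {a - \<eta><..a}"
    by (intro measure_mono_fmeasurable) (use \<eta> in \<open>auto simp: I_def fmeasurable_def emeasure_lborel_Ioc\<close>)
  finally have mI: "measure \<U> I \<le> \<eta>" using \<eta> by simp
  define X Y Z where "X = {x \<in> space \<U>. \<eta> \<le> \<bar>S x - T x\<bar>}"
    and "Y = S -` I \<inter> space \<U>" and "Z = T -` I \<inter> space \<U>"
  have XYZ: "X \<in> sets \<U>" "Y \<in> sets \<U>" "Z \<in> sets \<U>"
    using I unfolding X_def Y_def Z_def by measurable
  have "{x \<in> space \<U>. (S x \<in> {..a}) \<noteq> (T x \<in> {..a})} \<subseteq> X \<union> (Y \<union> Z)"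
  proof
    fix x assume x: "x \<in> {x \<in> space \<U>. (S x \<in> {..a}) \<noteq> (T x \<in> {..a})}"
    then have x01: "x \<in> {0..1}" by simp
    note ST = mp_mapsD(3)[OF assms(1) x01] mp_mapsD(3)[OF assms(2) x01]
    from x have "S x \<le> a \<and> a < T x \<or> T x \<le> a \<and> a < S x" by auto
    then have "\<eta> \<le> \<bar>S x - T x\<bar> \<or> S x \<in> {a - \<eta><..a} \<or> T x \<in> {a - \<eta><..a}" by auto
    then show "x \<in> X \<union> (Y \<union> Z)" using x01 ST by (auto simp: X_def Y_def Z_def I_def)
  qed
  then have "discrepancy {..a} S T \<le> measure \<U> (X \<union> (Y \<union> Z))"
    unfolding discrepancy_def using XYZ by (intro unit.finite_measure_mono) auto
  also have "\<dots> \<le> measure \<U> X + (measure \<U> Y + measure \<U> Z)"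
    using XYZ by (intro order_trans[OF measure_Un_le] add_mono) auto
  also have "measure \<U> X \<le> l1_dist S T / \<eta>"
    unfolding X_def l1_dist_def using \<eta>
    by (intro integral_Markov_inequality_measure[where A="{}"] integrable_l1_dist) auto
  also have "measure \<U> Y = measure \<U> I"
    unfolding Y_def by (rule measure_measure_preserving[OF mp_mapsD(1,2)[OF assms(1)] I])
  also have "measure \<U> Z = measure \<U> I"
    unfolding Z_def by (rule measure_measure_preserving[OF mp_mapsD(1,2)[OF assms(2)] I])
  finally show ?thesis using mI by simp
qed

text \<open>Induction over the Borel sets. For a disjoint union, invariance of the measure bounds the
contribution of a tail by twice the measure of the tail, uniformly in the maps.\<close>

lemma discrepancy_tendsto_0:
  assumes "A \<in> sets \<U>"
  shows "((\<lambda>(S, T). discrepancy A S T) \<longlongrightarrow> 0) close_pairs"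
proof -
  define D where "D A p = discrepancy A (fst p) (snd p)" for A p
  have mp: "\<forall>\<^sub>F p in close_pairs. fst p \<in> mp_maps \<and> snd p \<in> mp_maps"
    by (auto simp: eventually_close_pairs intro: exI[of _ 1])
  have "sets \<U> = (\<lambda>A. A \<inter> {0..1}) ` sigma_sets UNIV (range atMost)"
    by (simp add: unit_lebesgue_def sets_restrict_space borel_eq_atMost Int_commute)
  with assms obtain B where B: "B \<in> sigma_sets UNIV (range atMost)" and A: "A = B \<inter> {0..1}" by auto
  have "Int_stable (range (atMost :: real \<Rightarrow> real set))"
    by (auto simp: Int_stable_def)
  moreover have "range (atMost :: real \<Rightarrow> real set) \<subseteq> Pow UNIV" by simp
  ultimately have "((D B) \<longlongrightarrow> 0) close_pairs"
    using B
  proof (induction rule: sigma_sets_induct_disjoint)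
    case (basic B)
    then obtain a where a: "B = {..a}" by auto
    show ?case
    proof (rule tendstoI)
      fix e :: real assume e: "e > 0"
      show "\<forall>\<^sub>F p in close_pairs. dist (D B p) 0 < e"
        unfolding eventually_close_pairs
      proof (intro exI[of _ "e * e / 8"] conjI ballI impI)
        fix S T assume ST: "S \<in> mp_maps" "T \<in> mp_maps" and "l1_dist S T < e * e / 8"
        then have "l1_dist S T / (e/4) < e / 2" using e by (simp add: field_simps)
        with discrepancy_ray[OF ST, of "e/4" a] e show "dist (D B (S, T)) 0 < e"
          by (simp add: D_def a dist_real_def)
      qed (use e in simp)
    qed
  next
    case empty
    show ?case by (simp add: D_def discrepancy_def)
  next
    case (compl B)
    have "D (UNIV - B) = D B"
      unfolding D_def discrepancy_def by (intro ext arg_cong[where f="measure \<U>"]) auto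
    with compl(2) show ?case by simp
  next
    case (union B)
    define B' where "B' i = B i \<inter> {0..1}" for i
    have B': "B' i \<in> sets \<U>" for i
    proof -
      have "B i \<in> sets borel" using union(2) unfolding borel_eq_atMost sets_measure_of_conv by auto
      then show ?thesis by (auto simp: B'_def sets_unit_iff)
    qed
    show ?case
    proof (rule tendstoI)
      fix e :: real assume e: "e > 0"
      have "(\<lambda>n. measure \<U> (\<Union>i\<in>{n..}. B' i)) \<longlonglongrightarrow> measure \<U> (\<Inter>n. \<Union>i\<in>{n..}. B' i)"
      proof (rule unit.finite_Lim_measure_decseq)
        show "decseq (\<lambda>n. \<Union>i\<in>{n..}. B' i)"
          unfolding decseq_def by (intro allI impI UN_mono) auto
      qed (use B' in auto)
      moreover have "(\<Inter>n. \<Union>i\<in>{n..}. B' i) = {}"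
      proof (rule ccontr)
        assume "(\<Inter>n. \<Union>i\<in>{n..}. B' i) \<noteq> {}"
        then obtain x where x: "\<And>n. \<exists>i\<ge>n. x \<in> B i" by (fastforce simp: B'_def)
        from x[of 0] obtain i where i: "x \<in> B i" by auto
        from x[of "Suc i"] obtain j where j: "j \<ge> Suc i" "x \<in> B j" by auto
        then have "B i \<inter> B j = {}" using union(1) by (intro disjoint_family_onD[of B UNIV]) auto
        with i j show False by blast
      qed
      ultimately have "(\<lambda>n. measure \<U> (\<Union>i\<in>{n..}. B' i)) \<longlonglongrightarrow> 0" by simp
      then have "\<forall>\<^sub>F n in sequentially. measure \<U> (\<Union>i\<in>{n..}. B' i) < e / 4"
        using e by (intro order_tendstoD) auto
      then obtain N where N: "measure \<U> (\<Union>i\<in>{N..}. B' i) < e / 4"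
        by (auto simp: eventually_sequentially)
      \<comment> \<open>Only finitely many of the sets have to be compared individually.\<close>
      define R where "R = (\<Union>i\<in>{N..}. B' i)"
      have R: "R \<in> sets \<U>" unfolding R_def using B' by auto
      have "((\<lambda>p. \<Sum>i<N. D (B i) p) \<longlongrightarrow> 0) close_pairs"
        using union(3) by (intro tendsto_null_sum) auto
      then have "\<forall>\<^sub>F p in close_pairs. (\<Sum>i<N. D (B i) p) < e / 2"
        using e by (intro order_tendstoD) auto
      with mp show "\<forall>\<^sub>F p in close_pairs. dist (D (\<Union>i. B i) p) 0 < e"
      proof eventually_elim
        case (elim p)
        obtain S T where p: "p = (S, T)" by (cases p)
        have S: "S \<in> mp_maps" and T: "T \<in> mp_maps" using elim p by auto
        note [measurable] = mp_mapsD(1)[OF S] mp_mapsD(1)[OF T]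
        have [measurable]: "B' i \<in> sets \<U>" for i by (rule B')
        define E where "E i = {x \<in> space \<U>. (S x \<in> B' i) \<noteq> (T x \<in> B' i)}" for i
        have E: "E i \<in> sets \<U>" for i unfolding E_def by measurable
        have DE: "D (B i) p = measure \<U> (E i)" for i
          unfolding D_def discrepancy_def E_def p B'_def using mp_mapsD(3)[OF S] mp_mapsD(3)[OF T]
          by (intro arg_cong[where f="measure \<U>"]) auto
        have ST: "S -` R \<inter> space \<U> \<in> sets \<U>" "T -` R \<inter> space \<U> \<in> sets \<U>"
          using R by measurable
        have "{x \<in> space \<U>. (S x \<in> (\<Union>i. B i)) \<noteq> (T x \<in> (\<Union>i. B i))}
            \<subseteq> (\<Union>i<N. E i) \<union> ((S -` R \<inter> space \<U>) \<union> (T -` R \<inter> space \<U>))"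
        proof
          fix x assume x: "x \<in> {x \<in> space \<U>. (S x \<in> (\<Union>i. B i)) \<noteq> (T x \<in> (\<Union>i. B i))}"
          then have "x \<in> {0..1}" by simp
          with mp_mapsD(3)[OF S this] mp_mapsD(3)[OF T this]
          have iff: "S x \<in> B i \<longleftrightarrow> S x \<in> B' i" "T x \<in> B i \<longleftrightarrow> T x \<in> B' i" for i by (auto simp: B'_def)
          from x iff obtain i where "(S x \<in> B' i) \<noteq> (T x \<in> B' i)" by auto
          then show "x \<in> (\<Union>i<N. E i) \<union> ((S -` R \<inter> space \<U>) \<union> (T -` R \<inter> space \<U>))"
            using \<open>x \<in> {0..1}\<close> by (cases "i < N") (auto simp: E_def R_def not_less)
        qed
        then have "D (\<Union>i. B i) p \<le> measure \<U> ((\<Union>i<N. E i) \<union> ((S -` R \<inter> space \<U>) \<union> (T -` R \<inter> space \<U>)))"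
          unfolding D_def discrepancy_def p fst_conv snd_conv using E ST
          by (intro unit.finite_measure_mono) auto
        also have "\<dots> \<le> measure \<U> (\<Union>i<N. E i) + (measure \<U> (S -` R \<inter> space \<U>) + measure \<U> (T -` R \<inter> space \<U>))"
          using E ST by (intro order_trans[OF measure_Un_le] add_mono) auto
        also have "measure \<U> (\<Union>i<N. E i) \<le> (\<Sum>i<N. measure \<U> (E i))"
          using E by (intro measure_UNION_le) auto
        also have "\<dots> = (\<Sum>i<N. D (B i) p)" by (simp add: DE)
        also have "measure \<U> (S -` R \<inter> space \<U>) = measure \<U> R"
          using R mp_mapsD[OF S] by (intro measure_measure_preserving)
        also have "measure \<U> (T -` R \<inter> space \<U>) = measure \<U> R"
          using R mp_mapsD[OF T] by (intro measure_measure_preserving)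
        finally show ?case using elim N by (simp add: R_def D_def dist_real_def)
      qed
    qed
  qed
  moreover have "\<forall>\<^sub>F p in close_pairs. D B p = discrepancy A (fst p) (snd p)"
    using mp
  proof eventually_elim
    case (elim p)
    then show ?case unfolding D_def discrepancy_def A
      using mp_mapsD(3)[of "fst p"] mp_mapsD(3)[of "snd p"]
      by (intro arg_cong[where f="measure \<U>"]) auto
  qed
  ultimately have "((\<lambda>p. discrepancy A (fst p) (snd p)) \<longlongrightarrow> 0) close_pairs"
    by (rule Lim_transform_eventually)
  then show ?thesis by (simp add: case_prod_unfold)
qed

lemma L2_comp_mp_map:
  assumes f: "f \<in> L2 \<U>" and T: "T \<in> mp_maps"
  shows "(\<lambda>x. f (T x)) \<in> L2 \<U>" "(\<integral>x. (f (T x))\<^sup>2 \<partial>\<U>) = (\<integral>x. (f x)\<^sup>2 \<partial>\<U>)"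
proof -
  note [measurable] = mp_mapsD(1)[OF T]
  have [measurable]: "f \<in> borel_measurable \<U>" using f by (auto simp: L2_def)
  have "integrable (distr \<U> \<U> T) (\<lambda>x. (f x)\<^sup>2)" using f mp_mapsD(2)[OF T] by (simp add: L2_def)
  then show "(\<lambda>x. f (T x)) \<in> L2 \<U>" by (simp add: L2_def integrable_distr_eq)
  show "(\<integral>x. (f (T x))\<^sup>2 \<partial>\<U>) = (\<integral>x. (f x)\<^sup>2 \<partial>\<U>)"
    by (rule integral_measure_preserving[OF mp_mapsD(1,2)[OF T]]) simp
qed

lemma L2_scale: "f \<in> L2 M \<Longrightarrow> (\<lambda>x. c * f x) \<in> L2 M"
  by (auto simp: L2_def power_mult_distrib)

lemma L2_diff_mp_map:
  assumes "f \<in> L2 \<U>" "S \<in> mp_maps" "T \<in> mp_maps"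
  shows "(\<lambda>x. f (S x) - f (T x)) \<in> L2 \<U>"
    "koopman_dist \<U> f S T \<le> 2 * sqrt (\<integral>x. (f x)\<^sup>2 \<partial>\<U>)"
proof -
  note S = L2_comp_mp_map[OF assms(1,2)] and T = L2_comp_mp_map[OF assms(1,3)]
  have "(\<lambda>x. - f (T x)) \<in> L2 \<U>" using L2_scale[OF T(1), of "-1"] by simp
  from L2_norm_triangle[OF S(1) this] S(2) T(2)
  show "(\<lambda>x. f (S x) - f (T x)) \<in> L2 \<U>"
    "koopman_dist \<U> f S T \<le> 2 * sqrt (\<integral>x. (f x)\<^sup>2 \<partial>\<U>)"
    by (simp_all add: koopman_dist_def)
qed

lemma koopman_dist_add:
  assumes "f \<in> L2 \<U>" "g \<in> L2 \<U>" "S \<in> mp_maps" "T \<in> mp_maps"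
  shows "koopman_dist \<U> (\<lambda>x. f x + g x) S T \<le> koopman_dist \<U> f S T + koopman_dist \<U> g S T"
  using L2_norm_triangle(1)[OF L2_diff_mp_map(1)[OF assms(1,3,4)] L2_diff_mp_map(1)[OF assms(2,3,4)]]
  by (simp add: koopman_dist_def algebra_simps)

lemma koopman_dist_sum:
  assumes "finite I" "\<And>i. i \<in> I \<Longrightarrow> f i \<in> L2 \<U>" "S \<in> mp_maps" "T \<in> mp_maps"
  shows "(\<lambda>x. \<Sum>i\<in>I. f i x) \<in> L2 \<U>"
    "koopman_dist \<U> (\<lambda>x. \<Sum>i\<in>I. f i x) S T \<le> (\<Sum>i\<in>I. koopman_dist \<U> (f i) S T)"
  using assms(1,2)
proof (induction I)
  case empty
  { case 1 show ?case by (simp add: L2_def) }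
  { case 2 show ?case by (simp add: koopman_dist_def) }
next
  case (insert i I)
  { case 1 with insert show ?case by (auto intro!: L2_norm_triangle(2)) }
  { case 2
    with koopman_dist_add[OF _ insert(3) assms(3,4), of "f i"] insert show ?case by simp }
qed

lemma koopman_dist_scale: "koopman_dist M (\<lambda>x. c * f x) S T = \<bar>c\<bar> * koopman_dist M f S T"
proof -
  have "(\<integral>x. (c * f (S x) - c * f (T x))\<^sup>2 \<partial>M) = c\<^sup>2 * (\<integral>x. (f (S x) - f (T x))\<^sup>2 \<partial>M)"
    by (subst integral_mult_right_zero[symmetric]) (simp add: power_mult_distrib[symmetric] right_diff_distrib)
  then show ?thesis by (simp add: koopman_dist_def real_sqrt_mult)
qed

lemma koopman_dist_indicator_tendsto_0:
  assumes "A \<in> sets \<U>"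
  shows "((\<lambda>(S, T). koopman_dist \<U> (indicator A) S T) \<longlongrightarrow> 0) close_pairs"
proof -
  have "((\<lambda>(S, T). sqrt (discrepancy A S T)) \<longlongrightarrow> 0) close_pairs"
    using tendsto_real_sqrt[OF discrepancy_tendsto_0[OF assms]] by (simp add: case_prod_unfold)
  moreover have "\<forall>\<^sub>F p in close_pairs. (case p of (S, T) \<Rightarrow> sqrt (discrepancy A S T))
      = (case p of (S, T) \<Rightarrow> koopman_dist \<U> (indicator A) S T)"
    unfolding eventually_close_pairs
    by (intro exI[of _ 1]) (auto simp: discrepancy_eq_koopman_dist[OF assms] koopman_dist_def)
  ultimately show ?thesis by (simp only: filterlim_cong[OF refl refl])
qed

text \<open>Approximation of \<open>f\<close> by a simple function in \<open>L\<^sup>2\<close>; the error is the same for all maps, since they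
preserve the measure.\<close>

lemma koopman_dist_tendsto_0:
  assumes f: "f \<in> L2 \<U>"
  shows "((\<lambda>(S, T). koopman_dist \<U> f S T) \<longlongrightarrow> 0) close_pairs"
proof (rule tendstoI)
  fix e :: real assume e: "e > 0"
  have [measurable]: "f \<in> borel_measurable \<U>" and f2: "integrable \<U> (\<lambda>x. (f x)\<^sup>2)"
    using f by (auto simp: L2_def)
  obtain s where "\<forall>i. simple_function \<U> (s i)"
    "\<forall>x\<in>space \<U>. (\<lambda>i. s i x) \<longlonglongrightarrow> f x"
    "\<forall>i. \<forall>x\<in>space \<U>. dist (s i x) 0 \<le> 2 * dist (f x) 0"
    using borel_measurable_implies_sequence_metric[OF \<open>f \<in> borel_measurable \<U>\<close>, of 0]
    by (elim exE conjE) (rule that)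
  then have s: "\<And>i. simple_function \<U> (s i)"
    "\<And>x. x \<in> space \<U> \<Longrightarrow> (\<lambda>i. s i x) \<longlonglongrightarrow> f x"
    "\<And>i x. x \<in> space \<U> \<Longrightarrow> dist (s i x) 0 \<le> 2 * dist (f x) 0" by (blast, blast, blast)
  have [measurable]: "s i \<in> borel_measurable \<U>" for i
    using s(1) by (rule borel_measurable_simple_function)
  have "(\<lambda>i. \<integral>x. (f x - s i x)\<^sup>2 \<partial>\<U>) \<longlonglongrightarrow> (\<integral>x. 0 \<partial>\<U>)"
  proof (rule integral_dominated_convergence[where w="\<lambda>x. 9 * (f x)\<^sup>2"])
    show "AE x in \<U>. (\<lambda>i. (f x - s i x)\<^sup>2) \<longlonglongrightarrow> 0"
    proof (rule AE_I2)
      fix x assume "x \<in> space \<U>"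
      then have "(\<lambda>i. (f x - s i x)\<^sup>2) \<longlonglongrightarrow> (f x - f x)\<^sup>2" by (intro tendsto_intros s)
      then show "(\<lambda>i. (f x - s i x)\<^sup>2) \<longlonglongrightarrow> 0" by simp
    qed
    fix i
    show "AE x in \<U>. norm ((f x - s i x)\<^sup>2) \<le> 9 * (f x)\<^sup>2"
    proof (rule AE_I2)
      fix x assume "x \<in> space \<U>"
      from s(3)[OF this, of i] have "\<bar>f x - s i x\<bar> \<le> \<bar>3 * f x\<bar>" by (simp add: dist_real_def)
      then have "(f x - s i x)\<^sup>2 \<le> (3 * f x)\<^sup>2" by (simp only: abs_le_square_iff)
      then show "norm ((f x - s i x)\<^sup>2) \<le> 9 * (f x)\<^sup>2" by (simp add: power_mult_distrib)
    qed
  qed (use f2 in auto)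
  then have "\<forall>\<^sub>F i in sequentially. (\<integral>x. (f x - s i x)\<^sup>2 \<partial>\<U>) < (e/4)\<^sup>2"
    using e by (intro order_tendstoD) auto
  then obtain i where i: "(\<integral>x. (f x - s i x)\<^sup>2 \<partial>\<U>) < (e/4)\<^sup>2" by (auto simp: eventually_sequentially)
  define g where "g = s i"
  define h where "h x = (\<Sum>y\<in>g ` {0..1}. y * indicator (g -` {y} \<inter> {0..1}) x)" for x
  have fin: "finite (g ` {0..1})" and gs: "g -` {y} \<inter> {0..1} \<in> sets \<U>" for y
    using simple_functionD(1)[OF s(1), of i] simple_functionD(2)[OF s(1), of i "{y}"]
    by (simp_all add: g_def)
  have gh: "g x = h x" if "x \<in> {0..1}" for x
  proof -
    have "h x = (\<Sum>y\<in>g ` {0..1}. if y = g x then y else 0)"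
      unfolding h_def using that by (intro sum.cong) (auto simp: indicator_def)
    then show ?thesis using that fin by simp
  qed
  have hL2: "h \<in> L2 \<U>" and "koopman_dist \<U> h S T \<le>
      (\<Sum>y\<in>g ` {0..1}. koopman_dist \<U> (\<lambda>x. y * indicator (g -` {y} \<inter> {0..1}) x) S T)"
    if "S \<in> mp_maps" "T \<in> mp_maps" for S T
    unfolding h_def using koopman_dist_sum[OF fin _ that] L2_scale[OF L2_indicator[OF gs]] by auto
  then have hle: "koopman_dist \<U> h S T \<le>
      (\<Sum>y\<in>g ` {0..1}. \<bar>y\<bar> * koopman_dist \<U> (indicator (g -` {y} \<inter> {0..1})) S T)"
    if "S \<in> mp_maps" "T \<in> mp_maps" for S T
    using that by (simp add: koopman_dist_scale)
  have "((\<lambda>p. \<Sum>y\<in>g ` {0..1}. \<bar>y\<bar> * (case p of (S, T) \<Rightarrow> koopman_dist \<U> (indicator (g -` {y} \<inter> {0..1})) S T))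
      \<longlongrightarrow> 0) close_pairs"
    by (intro tendsto_null_sum tendsto_mult_right_zero koopman_dist_indicator_tendsto_0 gs)
  then have "\<forall>\<^sub>F p in close_pairs.
      (\<Sum>y\<in>g ` {0..1}. \<bar>y\<bar> * (case p of (S, T) \<Rightarrow> koopman_dist \<U> (indicator (g -` {y} \<inter> {0..1})) S T)) < e / 2"
    using e by (intro order_tendstoD) auto
  moreover have "\<forall>\<^sub>F p in close_pairs. p \<in> mp_maps \<times> mp_maps"
    by (auto simp: eventually_close_pairs intro: exI[of _ 1])
  ultimately show "\<forall>\<^sub>F p in close_pairs. dist (case p of (S, T) \<Rightarrow> koopman_dist \<U> f S T) 0 < e"
  proof eventually_elim
    case (elim p)
    obtain S T where p: "p = (S, T)" by (cases p)
    have S: "S \<in> mp_maps" and T: "T \<in> mp_maps" using elim p by auto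
    have "(\<lambda>x. - h x) \<in> L2 \<U>" using L2_scale[OF hL2[OF S T], of "-1"] by simp
    from L2_norm_triangle(2)[OF f this] have d: "(\<lambda>x. f x - h x) \<in> L2 \<U>" by simp
    have "(\<integral>x. (f x - h x)\<^sup>2 \<partial>\<U>) = (\<integral>x. (f x - s i x)\<^sup>2 \<partial>\<U>)"
      using gh by (intro Bochner_Integration.integral_cong) (auto simp: g_def)
    with i e have "sqrt (\<integral>x. (f x - h x)\<^sup>2 \<partial>\<U>) < e/4" by (intro real_less_lsqrt) auto
    then have "koopman_dist \<U> (\<lambda>x. f x - h x) S T < e / 2"
      using L2_diff_mp_map(2)[OF d S T] by simp
    moreover have "koopman_dist \<U> h S T < e / 2" using hle[OF S T] elim p by simp
    moreover have "koopman_dist \<U> f S T \<le> koopman_dist \<U> (\<lambda>x. f x - h x) S T + koopman_dist \<U> h S T"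
      using koopman_dist_add[OF d hL2[OF S T] S T] by simp
    ultimately show ?case by (simp add: p dist_real_def koopman_dist_def)
  qed
qed

text \<open>The sets generating the topology are open for the distance in mean by \<open>koopman_dist_tendsto_0\<close>, and
this property passes to finite intersections and to unions.\<close>

lemma weak_open_contains_l1_ball:
  assumes V: "openin (weak_topology \<U>) V" and T: "T \<in> mp_automorphisms \<U>" "aut_class \<U> T \<in> V"
  obtains \<delta> where "\<delta> > 0"
    "\<And>S. S \<in> mp_automorphisms \<U> \<Longrightarrow> l1_dist S T < \<delta> \<Longrightarrow> aut_class \<U> S \<in> V"
proof -
  let ?\<S> = "{aut_class \<U> ` {S \<in> mp_automorphisms \<U>. koopman_dist \<U> f S T < e} | f T e.
        f \<in> L2 \<U> \<and> T \<in> mp_automorphisms \<U> \<and> 0 < e}"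
  have "generate_topology_on ?\<S> V"
    using V unfolding weak_topology_def openin_topology_generated_by_iff .
  then have "aut_class \<U> T \<in> V \<longrightarrow>
    (\<exists>\<delta>>0. \<forall>S\<in>mp_automorphisms \<U>. l1_dist S T < \<delta> \<longrightarrow> aut_class \<U> S \<in> V)"
  proof induction
    case (Int a b)
    show ?case
    proof
      assume "aut_class \<U> T \<in> a \<inter> b"
      with Int obtain d d' where "d > 0" "d' > 0"
        "\<forall>S\<in>mp_automorphisms \<U>. l1_dist S T < d \<longrightarrow> aut_class \<U> S \<in> a"
        "\<forall>S\<in>mp_automorphisms \<U>. l1_dist S T < d' \<longrightarrow> aut_class \<U> S \<in> b" by auto
      then show "\<exists>\<delta>>0. \<forall>S\<in>mp_automorphisms \<U>. l1_dist S T < \<delta> \<longrightarrow> aut_class \<U> S \<in> a \<inter> b"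
        by (intro exI[of _ "min d d'"]) auto
    qed
  next
    case (UN K)
    then show ?case by (meson UnionE UnionI)
  next
    case (Basis s)
    then obtain f R e where f: "f \<in> L2 \<U>" and R: "R \<in> mp_automorphisms \<U>" and "0 < e"
      and s: "s = aut_class \<U> ` {S \<in> mp_automorphisms \<U>. koopman_dist \<U> f S R < e}" by blast
    show ?case
    proof
      assume "aut_class \<U> T \<in> s"
      then have "e - koopman_dist \<U> f T R > 0"
        unfolding s aut_class_in_ball_iff[OF f T(1) R] by simp
      from tendstoD[OF koopman_dist_tendsto_0[OF f] this] obtain \<delta> where "\<delta> > 0" and
        \<delta>: "\<And>S T'. S \<in> mp_maps \<Longrightarrow> T' \<in> mp_maps \<Longrightarrow> l1_dist S T' < \<delta>
            \<Longrightarrow> koopman_dist \<U> f S T' < e - koopman_dist \<U> f T R"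
        unfolding eventually_close_pairs by (fastforce simp: dist_real_def abs_less_iff)
      have "aut_class \<U> S \<in> s" if S: "S \<in> mp_automorphisms \<U>" "l1_dist S T < \<delta>" for S
        using \<delta>[OF mp_automorphism_mp_map[OF S(1)] mp_automorphism_mp_map[OF T(1)] S(2)]
          koopman_dist_triangle[OF f S(1) T(1) R]
        unfolding s aut_class_in_ball_iff[OF f S(1) R] by simp
      with \<open>\<delta> > 0\<close> show "\<exists>\<delta>>0. \<forall>S\<in>mp_automorphisms \<U>. l1_dist S T < \<delta> \<longrightarrow> aut_class \<U> S \<in> s"
        by blast
    qed
  qed simp
  with T(2) that show thesis by auto
qed

section \<open>Weak continuity of correlations\<close>

lemma openin_koopman_ball:
  assumes "f \<in> L2 M" "T \<in> mp_automorphisms M" "0 < e"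
  shows "openin (weak_topology M) (aut_class M ` {S \<in> mp_automorphisms M. koopman_dist M f S T < e})"
  unfolding weak_topology_def by (rule topology_generated_by_Basis) (use assms in blast)

lemma discrepancy_triangle:
  assumes [measurable]: "A \<in> sets \<U>" "R \<in> \<U> \<rightarrow>\<^sub>M \<U>" "S \<in> \<U> \<rightarrow>\<^sub>M \<U>" "T \<in> \<U> \<rightarrow>\<^sub>M \<U>"
  shows "discrepancy A R T \<le> discrepancy A R S + discrepancy A S T"
proof -
  let ?X = "{x \<in> space \<U>. (R x \<in> A) \<noteq> (S x \<in> A)}" and ?Y = "{x \<in> space \<U>. (S x \<in> A) \<noteq> (T x \<in> A)}"
  have *: "?X \<in> sets \<U>" "?Y \<in> sets \<U>" by measurable
  have "discrepancy A R T \<le> measure \<U> (?X \<union> ?Y)"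
    unfolding discrepancy_def using * by (intro unit.finite_measure_mono) auto
  also have "\<dots> \<le> discrepancy A R S + discrepancy A S T"
    unfolding discrepancy_def using * by (intro measure_Un_le)
  finally show ?thesis .
qed

text \<open>Telescoping: exchange \<open>S\<close> for \<open>T\<close> one factor at a time.\<close>

lemma discrepancy_funpow:
  assumes S: "S \<in> mp_automorphisms \<U>" and T: "T \<in> mp_automorphisms \<U>" and B: "B \<in> sets \<U>"
  shows "discrepancy B (S ^^ n) (T ^^ n) \<le> (\<Sum>i<n. discrepancy ((T ^^ i) -` B \<inter> {0..1}) S T)"
proof (induction n)
  case 0
  show ?case by (simp add: discrepancy_def)
next
  case (Suc n)
  note mS = mp_automorphismD[OF S] and mT = mp_automorphismD[OF T]
  have [measurable]: "S ^^ n \<in> \<U> \<rightarrow>\<^sub>M \<U>" "T ^^ n \<in> \<U> \<rightarrow>\<^sub>M \<U>" "S \<in> \<U> \<rightarrow>\<^sub>M \<U>" "T \<in> \<U> \<rightarrow>\<^sub>M \<U>"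
    using mS(1) mT(1) by (auto intro: measurable_funpow)
  note [measurable] = B
  have "discrepancy B (S ^^ Suc n) (T ^^ Suc n)
      \<le> discrepancy B (S ^^ n \<circ> S) (T ^^ n \<circ> S) + discrepancy B (T ^^ n \<circ> S) (T ^^ n \<circ> T)"
    unfolding funpow_Suc_right using B by (intro discrepancy_triangle) auto
  also have "discrepancy B (S ^^ n \<circ> S) (T ^^ n \<circ> S) = discrepancy B (S ^^ n) (T ^^ n)"
  proof -
    let ?D = "{x \<in> space \<U>. ((S ^^ n) x \<in> B) \<noteq> ((T ^^ n) x \<in> B)}"
    have "?D \<in> sets \<U>" by measurable
    then have "measure \<U> (S -` ?D \<inter> space \<U>) = measure \<U> ?D"
      by (rule measure_measure_preserving[OF mS(1,3)])
    moreover have "S -` ?D \<inter> space \<U> = {x \<in> space \<U>. ((S ^^ n \<circ> S) x \<in> B) \<noteq> ((T ^^ n \<circ> S) x \<in> B)}"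
      using measurable_space[OF mS(1)] by (intro set_eqI) (simp only: Int_iff vimage_eq mem_Collect_eq o_apply, blast)
    ultimately show ?thesis by (simp only: discrepancy_def)
  qed
  also have "discrepancy B (T ^^ n \<circ> S) (T ^^ n \<circ> T) = discrepancy ((T ^^ n) -` B \<inter> {0..1}) S T"
  proof -
    have "S x \<in> {0..1}" "T x \<in> {0..1}" if "x \<in> space \<U>" for x
      using measurable_space[OF mS(1) that] measurable_space[OF mT(1) that] by simp_all
    then show ?thesis
      unfolding discrepancy_def by (intro arg_cong[where f="measure \<U>"] Collect_cong conj_cong) simp_all
  qed
  finally show ?case using Suc by simp
qed

abbreviation correlation :: "real set \<Rightarrow> real set \<Rightarrow> nat \<Rightarrow> (real \<Rightarrow> real) \<Rightarrow> real" where
  "correlation A B n T \<equiv> measure \<U> (A \<inter> ((T ^^ n) -` B \<inter> space \<U>))"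

lemma correlation_diff_le_discrepancy:
  assumes S: "S ^^ n \<in> \<U> \<rightarrow>\<^sub>M \<U>" and T: "T ^^ n \<in> \<U> \<rightarrow>\<^sub>M \<U>" and AB: "A \<in> sets \<U>" "B \<in> sets \<U>"
  shows "\<bar>correlation A B n S - correlation A B n T\<bar> \<le> discrepancy B (S ^^ n) (T ^^ n)"
proof -
  have le: "correlation A B n S \<le> correlation A B n T + discrepancy B (S ^^ n) (T ^^ n)"
    if [measurable]: "S ^^ n \<in> \<U> \<rightarrow>\<^sub>M \<U>" "T ^^ n \<in> \<U> \<rightarrow>\<^sub>M \<U>" for S T
  proof -
    note [measurable] = AB
    let ?D = "{x \<in> space \<U>. ((S ^^ n) x \<in> B) \<noteq> ((T ^^ n) x \<in> B)}"
    have D: "?D \<in> sets \<U>" by measurable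
    have C: "A \<inter> ((T ^^ n) -` B \<inter> space \<U>) \<in> sets \<U>" by measurable
    have "correlation A B n S \<le> measure \<U> ((A \<inter> ((T ^^ n) -` B \<inter> space \<U>)) \<union> ?D)"
      using C D by (intro unit.finite_measure_mono) auto
    also have "\<dots> \<le> correlation A B n T + measure \<U> ?D" using C D by (rule measure_Un_le)
    finally show ?thesis by (simp add: discrepancy_def)
  qed
  have "discrepancy B (S ^^ n) (T ^^ n) = discrepancy B (T ^^ n) (S ^^ n)"
    unfolding discrepancy_def by (intro arg_cong[where f="measure \<U>"]) auto
  with le[OF S T] le[OF T S] show ?thesis by linarith
qed

lemma correlation_weakly_continuous:
  assumes T: "T \<in> mp_automorphisms \<U>" and A: "A \<in> sets \<U>" and B: "B \<in> sets \<U>" and e: "0 < e"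
  obtains V where "openin (weak_topology \<U>) V" "aut_class \<U> T \<in> V"
    "\<And>S. S \<in> mp_automorphisms \<U> \<Longrightarrow> aut_class \<U> S \<in> V \<Longrightarrow>
      \<bar>correlation A B n S - correlation A B n T\<bar> < e"
proof -
  define f where "f i = (indicator ((T ^^ i) -` B \<inter> {0..1}) :: real \<Rightarrow> real)" for i
  have Tm: "T ^^ i \<in> \<U> \<rightarrow>\<^sub>M \<U>" for i
    using mp_automorphismD(1)[OF T] by (rule measurable_funpow)
  have Ti: "(T ^^ i) -` B \<inter> {0..1} \<in> sets \<U>" for i
    using measurable_sets[OF Tm B, of i] by simp
  have f: "f i \<in> L2 \<U>" for i
    unfolding f_def by (rule L2_indicator[OF Ti])
  define r where "r = sqrt (e / Suc n)"
  have r: "r > 0" using e by (simp add: r_def)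
  define V where "V i = aut_class \<U> ` {S \<in> mp_automorphisms \<U>. koopman_dist \<U> (f i) S T < r}" for i
  define W where "W = (\<Inter>i\<in>{..n}. V i)"
  show thesis
  proof (rule that[of W])
    show "openin (weak_topology \<U>) W"
      unfolding W_def V_def by (intro openin_INT2) (auto intro: openin_koopman_ball f T r)
    have "koopman_dist \<U> (f i) T T = 0" for i by (simp add: koopman_dist_def)
    then show "aut_class \<U> T \<in> W" using T r by (auto simp: W_def V_def)
    fix S assume S: "S \<in> mp_automorphisms \<U>" and SW: "aut_class \<U> S \<in> W"
    have Sm: "S ^^ i \<in> \<U> \<rightarrow>\<^sub>M \<U>" for i
      using mp_automorphismD(1)[OF S] by (rule measurable_funpow)
    have d: "discrepancy ((T ^^ i) -` B \<inter> {0..1}) S T < e / Suc n" if "i < n" for i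
    proof -
      have "aut_class \<U> S \<in> V i" using SW that by (auto simp: W_def)
      then have "koopman_dist \<U> (f i) S T < r"
        unfolding V_def aut_class_in_ball_iff[OF f S T] .
      moreover have "0 \<le> koopman_dist \<U> (f i) S T" by (simp add: koopman_dist_def)
      ultimately have "(koopman_dist \<U> (f i) S T)\<^sup>2 < r\<^sup>2" by (intro power_strict_mono) auto
      then show ?thesis
        unfolding discrepancy_eq_koopman_dist[OF Ti mp_automorphism_mp_map[OF S] mp_automorphism_mp_map[OF T]]
        using e by (simp add: f_def r_def)
    qed
    have "\<bar>correlation A B n S - correlation A B n T\<bar> \<le> (\<Sum>i<n. discrepancy ((T ^^ i) -` B \<inter> {0..1}) S T)"
      using correlation_diff_le_discrepancy[OF Sm Tm A B] discrepancy_funpow[OF S T B] by (rule order_trans)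
    also have "\<dots> \<le> (\<Sum>i<n. e / Suc n)" using d by (intro sum_mono) (auto intro: less_imp_le)
    also have "\<dots> < e" using e by (simp add: field_simps)
    finally show "\<bar>correlation A B n S - correlation A B n T\<bar> < e" .
  qed
qed

lemma correlation_cong_class:
  assumes "S \<in> mp_automorphisms \<U>" "T \<in> mp_automorphisms \<U>" "A \<in> sets \<U>" "B \<in> sets \<U>"
    and "aut_class \<U> S = aut_class \<U> T"
  shows "correlation A B n S = correlation A B n T"
proof (rule ccontr)
  assume "correlation A B n S \<noteq> correlation A B n T"
  then have "\<bar>correlation A B n S - correlation A B n T\<bar> > 0" by simp
  then obtain V where V: "openin (weak_topology \<U>) V" "aut_class \<U> T \<in> V" "\<And>R. R \<in> mp_automorphisms \<U> \<Longrightarrow> aut_class \<U> R \<in> V \<Longrightarrow>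
      \<bar>correlation A B n R - correlation A B n T\<bar> < \<bar>correlation A B n S - correlation A B n T\<bar>"
    by (rule correlation_weakly_continuous[OF assms(2-4), where n=n]) (rule that)
  from V(3)[OF assms(1)] V(2) assms(5) show False by simp
qed

section \<open>Completeness and the argument of Baire\<close>

text \<open>The differences \<open>T n - T (Suc n)\<close> are summable almost everywhere, so the \<open>T n\<close> converge almost
everywhere. The limit preserves the measure because its characteristic function is the limit of
those of the \<open>T n\<close>, which are all equal.\<close>

lemma mp_maps_limit:
  assumes T: "\<And>n. T n \<in> mp_maps" and step: "\<And>n. l1_dist (T n) (T (Suc n)) \<le> (1/2) ^ n"
  obtains L where "L \<in> mp_maps" "(\<lambda>n. l1_dist (T n) L) \<longlonglongrightarrow> 0"
proof -
  have [measurable]: "T n \<in> \<U> \<rightarrow>\<^sub>M \<U>" for n using mp_mapsD(1)[OF T] .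
  have T01: "T n x \<in> {0..1}" if "x \<in> {0..1}" for n x using mp_mapsD(3)[OF T that] .
  have "(\<integral>\<^sup>+x. (\<Sum>n. ennreal \<bar>T n x - T (Suc n) x\<bar>) \<partial>\<U>)
      = (\<Sum>n. \<integral>\<^sup>+x. ennreal \<bar>T n x - T (Suc n) x\<bar> \<partial>\<U>)"
    by (intro nn_integral_suminf) measurable
  also have "\<dots> = (\<Sum>n. ennreal (l1_dist (T n) (T (Suc n))))"
    unfolding l1_dist_def
    by (intro suminf_cong nn_integral_eq_integral integrable_l1_dist) auto
  also have "\<dots> \<le> (\<Sum>n. ennreal ((1/2) ^ n))"
    using step by (intro suminf_le ennreal_leI) auto
  also have "\<dots> = ennreal (\<Sum>n. (1/2) ^ n)"
    by (intro suminf_ennreal2 summable_geometric) auto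
  finally have "(\<integral>\<^sup>+x. (\<Sum>n. ennreal \<bar>T n x - T (Suc n) x\<bar>) \<partial>\<U>) \<noteq> \<infinity>"
    by (auto simp: top_unique)
  then have "AE x in \<U>. (\<Sum>n. ennreal \<bar>T n x - T (Suc n) x\<bar>) \<noteq> \<infinity>"
    by (intro nn_integral_noteq_infinite) measurable
  then have conv: "AE x in \<U>. convergent (\<lambda>n. T n x)"
  proof eventually_elim
    case (elim x)
    then have "summable (\<lambda>n. \<bar>T n x - T (Suc n) x\<bar>)"
      by (intro summable_suminf_not_top) auto
    then have "summable (\<lambda>n. T n x - T (Suc n) x)" by (rule summable_rabs_cancel)
    then have "convergent (\<lambda>n. \<Sum>i<n. T i x - T (Suc i) x)" by (rule summable_iff_convergent[THEN iffD1])
    moreover have "(\<Sum>i<n. T i x - T (Suc i) x) = T 0 x - T n x" for n by (induction n) auto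
    ultimately have "convergent (\<lambda>n. T 0 x - T n x)" by (simp only:)
    then have "convergent (\<lambda>n. T 0 x - (T 0 x - T n x))" by (rule convergent_diff[OF convergent_const])
    then show ?case by simp
  qed
  define L where "L x = max 0 (min 1 (lim (\<lambda>n. T n x)))" for x
  have Lb [measurable]: "L \<in> borel_measurable \<U>" unfolding L_def by measurable
  have L [measurable]: "L \<in> \<U> \<rightarrow>\<^sub>M \<U>"
    by (rule measurable_unitI[OF Lb]) (auto simp: L_def)
  have lim: "AE x in \<U>. (\<lambda>n. T n x) \<longlonglongrightarrow> L x"
    using conv AE_space
  proof eventually_elim
    case (elim x)
    then have *: "(\<lambda>n. T n x) \<longlonglongrightarrow> lim (\<lambda>n. T n x)" by (simp add: convergent_LIMSEQ_iff)
    have "lim (\<lambda>n. T n x) \<in> {0..1}"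
      by (rule closed_sequentially[OF _ _ *]) (use T01 elim in auto)
    with * show ?case by (simp add: L_def)
  qed
  have "(\<lambda>n. l1_dist (T n) L) \<longlonglongrightarrow> (\<integral>x. 0 \<partial>\<U>)"
    unfolding l1_dist_def
  proof (rule integral_dominated_convergence[where w="\<lambda>x. 1"])
    show "AE x in \<U>. (\<lambda>n. \<bar>T n x - L x\<bar>) \<longlonglongrightarrow> 0"
      using lim
    proof eventually_elim
      case (elim x)
      from tendsto_rabs[OF tendsto_diff[OF elim tendsto_const[of "L x"]]] show ?case by simp
    qed
    fix n
    show "AE x in \<U>. norm \<bar>T n x - L x\<bar> \<le> 1"
    proof (rule AE_I2)
      fix x assume "x \<in> space \<U>"
      then show "norm \<bar>T n x - L x\<bar> \<le> 1"
        using T01[of x n] measurable_space[OF L, of x] by auto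
    qed
  qed auto
  then have l1: "(\<lambda>n. l1_dist (T n) L) \<longlonglongrightarrow> 0" by simp
  have id [measurable]: "(\<lambda>x. x) \<in> borel_measurable \<U>" by (rule borel_measurable_unit) simp
  have "distr \<U> borel L = distr \<U> borel (\<lambda>x. x)"
  proof (rule Levy_uniqueness)
    show "real_distribution (distr \<U> borel L)" "real_distribution (distr \<U> borel (\<lambda>x. x))"
      by (auto intro!: unit.real_distribution_distr)
    show "char (distr \<U> borel L) = char (distr \<U> borel (\<lambda>x. x))"
    proof
      fix t
      have "(\<lambda>n. \<integral>x. iexp (t * T n x) \<partial>\<U>) \<longlonglongrightarrow> (\<integral>x. iexp (t * L x) \<partial>\<U>)"
      proof (rule integral_dominated_convergence[where w="\<lambda>x. 1"])
        show "AE x in \<U>. (\<lambda>n. iexp (t * T n x)) \<longlonglongrightarrow> iexp (t * L x)"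
          using lim
        proof eventually_elim
          case (elim x)
          show ?case by (intro tendsto_intros elim)
        qed
      qed auto
      moreover have "(\<integral>x. iexp (t * T n x) \<partial>\<U>) = (\<integral>x. iexp (t * x) \<partial>\<U>)" for n
        using integral_distr[of "T n" \<U> \<U> "\<lambda>x. iexp (t * x)"] mp_mapsD(2)[OF T] by simp
      ultimately have "(\<integral>x. iexp (t * L x) \<partial>\<U>) = (\<integral>x. iexp (t * x) \<partial>\<U>)"
        by (simp add: LIMSEQ_const_iff)
      then show "char (distr \<U> borel L) t = char (distr \<U> borel (\<lambda>x. x)) t"
        by (simp add: char_def integral_distr)
    qed
  qed
  note d = this
  have "distr \<U> \<U> L = \<U>"
  proof (rule measure_eqI)
    fix A assume "A \<in> sets (distr \<U> \<U> L)"
    then have A: "A \<in> sets \<U>" and A': "A \<in> sets borel" "A \<subseteq> {0..1}" by (auto simp: sets_unit_iff)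
    have "emeasure (distr \<U> \<U> L) A = emeasure (distr \<U> borel L) A"
      using A A' by (simp add: emeasure_distr)
    also have "\<dots> = emeasure \<U> A"
      unfolding d using A' by (simp add: emeasure_distr Int_absorb2)
    finally show "emeasure (distr \<U> \<U> L) A = emeasure \<U> A" .
  qed simp
  with L l1 show thesis by (intro that[of L]) (auto simp: mp_maps_def)
qed

lemma l1_dist_commute: "l1_dist S T = l1_dist T S"
  by (simp add: l1_dist_def abs_minus_commute)

text \<open>Compare \<open>S' (T' x)\<close> with \<open>S' (T n x)\<close> and this with \<open>S n (T n x) = x\<close>. The first step uses the
\<open>L\<^sup>2\<close> continuity of \<open>T \<mapsto> S' \<circ> T\<close>, the second one that \<open>T n\<close> preserves the measure.\<close>

lemma inverse_relation_limit:
  assumes ST: "\<And>n. S n \<in> mp_maps" "\<And>n. T n \<in> mp_maps" "S' \<in> mp_maps" "T' \<in> mp_maps"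
    and inv: "\<And>n x. x \<in> {0..1} \<Longrightarrow> S n (T n x) = x"
    and lim: "(\<lambda>n. l1_dist (S n) S') \<longlonglongrightarrow> 0" "(\<lambda>n. l1_dist (T n) T') \<longlonglongrightarrow> 0"
  shows "AE x in \<U>. S' (T' x) = x"
proof -
  have [measurable]: "S n \<in> \<U> \<rightarrow>\<^sub>M \<U>" "T n \<in> \<U> \<rightarrow>\<^sub>M \<U>" "S' \<in> \<U> \<rightarrow>\<^sub>M \<U>" "T' \<in> \<U> \<rightarrow>\<^sub>M \<U>" for n
    using ST mp_mapsD(1) by auto
  have id [measurable]: "(\<lambda>x. x) \<in> borel_measurable \<U>" by (rule borel_measurable_unit) simp
  have ST01: "S n x \<in> {0..1}" "T n x \<in> {0..1}" "S' x \<in> {0..1}" "T' x \<in> {0..1}"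
    if "x \<in> {0..1}" for n x
    using ST mp_mapsD(3) that by metis+
  have S': "S' \<in> L2 \<U>"
    unfolding L2_def using ST01(3)
    by (auto intro!: integrable_unit_bounded[where B=1] simp: abs_square_le_1 abs_le_iff)
  let ?I = "\<integral>x. (S' (T' x) - x)\<^sup>2 \<partial>\<U>"
  have bound: "?I \<le> 2 * (koopman_dist \<U> S' T' (T n))\<^sup>2 + 2 * l1_dist S' (S n)" for n
  proof -
    have i1: "integrable \<U> (\<lambda>x. (S' (T' x) - S' (T n x))\<^sup>2)"
      using L2_diff_mp_map(1)[OF S' ST(4) ST(2)] by (simp add: L2_def)
    have i2: "integrable \<U> (\<lambda>x. \<bar>S' (T n x) - S n (T n x)\<bar>)"
      using integrable_l1_dist[of "\<lambda>x. S' (T n x)" "\<lambda>x. S n (T n x)"] by simp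
    have "?I \<le> (\<integral>x. 2 * (S' (T' x) - S' (T n x))\<^sup>2 + 2 * \<bar>S' (T n x) - S n (T n x)\<bar> \<partial>\<U>)"
    proof (rule integral_mono)
      have b: "\<bar>S' (T' x) - x\<bar> \<le> 1" if "x \<in> {0..1}" for x
        using ST01(3)[OF ST01(4)[OF that]] that by auto
      show "integrable \<U> (\<lambda>x. (S' (T' x) - x)\<^sup>2)"
        using b by (intro integrable_unit_bounded[where B=1]) (auto simp: abs_square_le_1)
      show "integrable \<U> (\<lambda>x. 2 * (S' (T' x) - S' (T n x))\<^sup>2 + 2 * \<bar>S' (T n x) - S n (T n x)\<bar>)"
        using i1 i2 by auto
      fix x assume "x \<in> space \<U>"
      then have x: "x \<in> {0..1}" by simp
      define u v where "u = S' (T' x) - S' (T n x)" and "v = S' (T n x) - S n (T n x)"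
      have "\<bar>v\<bar> \<le> 1" unfolding v_def inv[OF x] using ST01(3)[OF ST01(2)[OF x], of n] x unfolding abs_le_iff by simp
      then have "v\<^sup>2 \<le> \<bar>v\<bar>" using mult_left_le[of "\<bar>v\<bar>" "\<bar>v\<bar>"] by (simp add: power2_eq_square abs_mult[symmetric])
      moreover have "(u + v)\<^sup>2 \<le> 2 * u\<^sup>2 + 2 * v\<^sup>2"
        using zero_le_power2[of "u - v"] by (simp add: power2_sum power2_diff)
      moreover have "S' (T' x) - x = u + v" by (simp add: u_def v_def inv[OF x])
      ultimately show "(S' (T' x) - x)\<^sup>2 \<le> 2 * (S' (T' x) - S' (T n x))\<^sup>2 + 2 * \<bar>S' (T n x) - S n (T n x)\<bar>"
        by (simp add: u_def[symmetric] v_def[symmetric])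
    qed
    also have "\<dots> = 2 * (\<integral>x. (S' (T' x) - S' (T n x))\<^sup>2 \<partial>\<U>) + 2 * (\<integral>x. \<bar>S' (T n x) - S n (T n x)\<bar> \<partial>\<U>)"
      using i1 i2 by simp
    also have "(\<integral>x. \<bar>S' (T n x) - S n (T n x)\<bar> \<partial>\<U>) = l1_dist S' (S n)"
      unfolding l1_dist_def using mp_mapsD(1,2)[OF ST(2)] by (rule integral_measure_preserving) measurable
    finally show ?thesis by (simp add: koopman_dist_def)
  qed
  have "filterlim (\<lambda>n. (T', T n)) close_pairs sequentially"
    unfolding filterlim_def le_filter_def eventually_filtermap eventually_close_pairs
  proof (intro allI impI, elim exE conjE)
    fix P and \<delta> :: real assume "\<delta> > 0" and P: "\<forall>S\<in>mp_maps. \<forall>T\<in>mp_maps. l1_dist S T < \<delta> \<longrightarrow> P (S, T)"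
    from order_tendstoD(2)[OF lim(2) \<open>\<delta> > 0\<close>] show "\<forall>\<^sub>F n in sequentially. P (T', T n)"
      by eventually_elim (use P ST l1_dist_commute in auto)
  qed
  from filterlim_compose[OF koopman_dist_tendsto_0[OF S'] this]
  have "(\<lambda>n. koopman_dist \<U> S' T' (T n)) \<longlonglongrightarrow> 0" by simp
  then have "(\<lambda>n. 2 * (koopman_dist \<U> S' T' (T n))\<^sup>2 + 2 * l1_dist S' (S n)) \<longlonglongrightarrow> 2 * 0\<^sup>2 + 2 * 0"
    using lim(1) unfolding l1_dist_commute[of S'] by (intro tendsto_intros)
  from LIMSEQ_le_const[OF this] bound have "?I \<le> 0" by simp
  moreover have "?I \<ge> 0" by simp
  ultimately have I0: "?I = 0" by linarith
  have b: "\<bar>S' (T' x) - x\<bar> \<le> 1" if "x \<in> {0..1}" for x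
    using ST01(3)[OF ST01(4)[OF that]] that by auto
  have "integrable \<U> (\<lambda>x. (S' (T' x) - x)\<^sup>2)"
    using b by (intro integrable_unit_bounded[where B=1]) (auto simp: abs_square_le_1)
  with I0 have "AE x in \<U>. (S' (T' x) - x)\<^sup>2 = 0"
    by (subst (asm) integral_nonneg_eq_0_iff_AE) auto
  then show ?thesis by simp
qed

text \<open>The inverses are included for the sake of completeness: a limit in mean of automorphisms need not
be invertible.\<close>

definition aut_dist :: "(real \<Rightarrow> real) \<Rightarrow> (real \<Rightarrow> real) \<Rightarrow> real" where
  "aut_dist S T = l1_dist S T + l1_dist (inv01 S) (inv01 T)"

lemma aut_dist_triangle:
  assumes "R \<in> mp_automorphisms \<U>" "S \<in> mp_automorphisms \<U>" "T \<in> mp_automorphisms \<U>"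
  shows "aut_dist R T \<le> aut_dist R S + aut_dist S T"
  using l1_dist_triangle[of R S T] l1_dist_triangle[of "inv01 R" "inv01 S" "inv01 T"]
    mp_automorphismD(1,2)[OF assms(1)] mp_automorphismD(1,2)[OF assms(2)] mp_automorphismD(1,2)[OF assms(3)]
  unfolding aut_dist_def by linarith

lemma aut_dist_commute: "aut_dist S T = aut_dist T S"
  by (simp add: aut_dist_def l1_dist_commute)

lemma l1_dist_cong_AE:
  assumes "R \<in> \<U> \<rightarrow>\<^sub>M \<U>" "S \<in> \<U> \<rightarrow>\<^sub>M \<U>" "T \<in> \<U> \<rightarrow>\<^sub>M \<U>" "AE x in \<U>. S x = T x"
  shows "l1_dist R S = l1_dist R T"
proof -
  note [measurable] = assms(1-3)
  show ?thesis unfolding l1_dist_def using assms(4) by (intro integral_cong_AE) auto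
qed

lemma aut_dist_complete:
  assumes T: "\<And>n. T n \<in> mp_automorphisms \<U>" and step: "\<And>n. aut_dist (T n) (T (Suc n)) \<le> (1/2) ^ n"
  obtains L where "L \<in> mp_automorphisms \<U>" "(\<lambda>n. aut_dist (T n) L) \<longlonglongrightarrow> 0"
proof -
  note mT = mp_automorphism_mp_map[OF T] and mI = mp_automorphism_mp_map[OF mp_automorphism_inv(1)[OF T]]
  have "l1_dist (T n) (T (Suc n)) \<le> (1/2) ^ n" "l1_dist (inv01 (T n)) (inv01 (T (Suc n))) \<le> (1/2) ^ n" for n
    using step[of n] l1_dist_nonneg[of "T n" "T (Suc n)"] l1_dist_nonneg[of "inv01 (T n)" "inv01 (T (Suc n))"]
    unfolding aut_dist_def by linarith+
  note step' = this
  obtain F where F: "F \<in> mp_maps" "(\<lambda>n. l1_dist (T n) F) \<longlonglongrightarrow> 0"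
    by (rule mp_maps_limit[OF mT step'(1)])
  obtain G where G: "G \<in> mp_maps" "(\<lambda>n. l1_dist (inv01 (T n)) G) \<longlonglongrightarrow> 0"
    by (rule mp_maps_limit[OF mI step'(2)])
  have "automorphism_mod0 F G"
    unfolding automorphism_mod0_def
    using inverse_relation_limit[OF mI mT G(1) F(1) _ G(2) F(2)]
      inverse_relation_limit[OF mT mI F(1) G(1) _ F(2) G(2)]
      mp_automorphismD(8,9)[OF T] mp_mapsD(1,2)[OF F(1)] mp_mapsD(1)[OF G(1)] by blast
  then obtain L where L: "L \<in> mp_automorphisms \<U>" "AE x in \<U>. L x = F x" "AE x in \<U>. inv01 L x = G x"
    by (rule automorphism_mod0_realization)
  have "l1_dist (T n) L = l1_dist (T n) F" "l1_dist (inv01 (T n)) (inv01 L) = l1_dist (inv01 (T n)) G" for n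
    using mp_automorphismD(1,2)[OF T] mp_automorphismD(1,2)[OF L(1)] mp_mapsD(1)[OF F(1)] mp_mapsD(1)[OF G(1)] L
    by (auto intro: l1_dist_cong_AE)
  with tendsto_add[OF F(2) G(2)] have "(\<lambda>n. aut_dist (T n) L) \<longlonglongrightarrow> 0"
    by (simp add: aut_dist_def)
  with L show thesis by (intro that)
qed

text \<open>Nested balls for \<^const>\<open>aut_dist\<close>, of radius \<open>r n \<le> 2\<^sup>-\<^sup>n\<close>, the first one inside \<open>V\<close> and the next ones inside
\<open>W 0\<close>, \<open>W 1\<close> and so on; the limit of their centres lies in all of them.\<close>

lemma Baire_weak_topology:
  fixes W :: "nat \<Rightarrow> (real \<Rightarrow> real) set set"
  assumes open_W: "\<And>n. openin (weak_topology \<U>) (W n)"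
    and dense_W: "\<And>n T e. T \<in> mp_automorphisms \<U> \<Longrightarrow> 0 < e \<Longrightarrow>
      \<exists>S \<in> mp_automorphisms \<U>. aut_class \<U> S \<in> W n \<and> aut_dist S T < e"
    and V: "openin (weak_topology \<U>) V" "T \<in> mp_automorphisms \<U>" "aut_class \<U> T \<in> V"
  shows "\<exists>S \<in> mp_automorphisms \<U>. aut_class \<U> S \<in> V \<and> (\<forall>n. aut_class \<U> S \<in> W n)"
proof -
  have ball: "\<exists>\<delta>>0. \<forall>S\<in>mp_automorphisms \<U>. aut_dist S T < \<delta> \<longrightarrow> aut_class \<U> S \<in> X"
    if X: "openin (weak_topology \<U>) X" "T \<in> mp_automorphisms \<U>" "aut_class \<U> T \<in> X" for X T
  proof -
    obtain \<delta> where \<delta>: "\<delta> > 0"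
      "\<And>S. S \<in> mp_automorphisms \<U> \<Longrightarrow> l1_dist S T < \<delta> \<Longrightarrow> aut_class \<U> S \<in> X"
      using weak_open_contains_l1_ball[OF X] by blast
    have "l1_dist S T \<le> aut_dist S T" for S by (simp add: aut_dist_def)
    with \<delta> show ?thesis by (meson le_less_trans)
  qed
  define X where "X n = (case n of 0 \<Rightarrow> V | Suc k \<Rightarrow> W k)" for n
  define P where "P n p \<longleftrightarrow> (case p of (T, r) \<Rightarrow> T \<in> mp_automorphisms \<U> \<and> 0 < r \<and> r \<le> (1/2) ^ n
      \<and> (\<forall>S\<in>mp_automorphisms \<U>. aut_dist S T < r \<longrightarrow> aut_class \<U> S \<in> X n))" for n p
  define Q where "Q p p' \<longleftrightarrow> (case (p, p') of ((T, r), (T', r')) \<Rightarrow> aut_dist T' T < r / 2 \<and> r' \<le> r / 2)"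
    for p p' :: "(real \<Rightarrow> real) \<times> real"
  have "\<exists>p. \<forall>n. P n (p n) \<and> Q (p n) (p (Suc n))"
  proof (rule dependent_nat_choice)
    obtain \<delta> where "\<delta> > 0" "\<forall>S\<in>mp_automorphisms \<U>. aut_dist S T < \<delta> \<longrightarrow> aut_class \<U> S \<in> V"
      using ball[OF V] by blast
    then have "P 0 (T, min 1 \<delta>)" using V by (auto simp: P_def X_def)
    then show "\<exists>p. P 0 p" ..
  next
    fix p n assume p: "P n p"
    obtain T r where pT: "p = (T, r)" by (cases p)
    have T: "T \<in> mp_automorphisms \<U>" "0 < r" "r \<le> (1/2) ^ n" using p by (auto simp: P_def pT)
    then obtain S where S: "S \<in> mp_automorphisms \<U>" "aut_class \<U> S \<in> W n" "aut_dist S T < r / 2"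
      using dense_W[of T "r / 2" n] by auto
    obtain \<delta> where "\<delta> > 0" "\<forall>S'\<in>mp_automorphisms \<U>. aut_dist S' S < \<delta> \<longrightarrow> aut_class \<U> S' \<in> W n"
      using ball[OF open_W S(1,2)] by blast
    then have "P (Suc n) (S, min \<delta> (r / 2))" "Q p (S, min \<delta> (r / 2))"
      using S T by (auto simp: P_def Q_def pT X_def min_less_iff_disj)
    then show "\<exists>p'. P (Suc n) p' \<and> Q p p'" by blast
  qed
  then obtain p where p: "\<And>n. P n (p n)" "\<And>n. Q (p n) (p (Suc n))" by blast
  define S r where "S n = fst (p n)" and "r n = snd (p n)" for n
  have S: "S n \<in> mp_automorphisms \<U>" "0 < r n" "r n \<le> (1/2) ^ n"
    "\<And>R. R \<in> mp_automorphisms \<U> \<Longrightarrow> aut_dist R (S n) < r n \<Longrightarrow> aut_class \<U> R \<in> X n"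
    "aut_dist (S (Suc n)) (S n) < r n / 2" "r (Suc n) \<le> r n / 2" for n
    using p[of n] by (auto simp: P_def Q_def S_def r_def split: prod.splits)
  have "aut_dist (S n) (S (Suc n)) \<le> (1/2) ^ n" for n
    using S(2,3,5)[of n] by (simp add: aut_dist_commute[of "S n"])
  then obtain L where L: "L \<in> mp_automorphisms \<U>" "(\<lambda>n. aut_dist (S n) L) \<longlonglongrightarrow> 0"
    using aut_dist_complete[of S] S(1) by blast
  \<comment> \<open>The closed balls of radius \<open>r n\<close> about \<open>S n\<close> decrease.\<close>
  have nested: "aut_dist (S (n + k)) (S n) + r (n + k) \<le> r n" for n k
  proof (induction k)
    case 0
    show ?case by (simp add: aut_dist_def l1_dist_def)
  next
    case (Suc k)
    have "aut_dist (S (n + Suc k)) (S n) \<le> aut_dist (S (Suc (n + k))) (S (n + k)) + aut_dist (S (n + k)) (S n)"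
      using aut_dist_triangle[OF S(1) S(1) S(1)] by simp
    with Suc S(5,6)[of "n + k"] show ?case by simp
  qed
  have le: "aut_dist L (S n) \<le> r n" for n
  proof (rule LIMSEQ_le_const)
    show "(\<lambda>k. aut_dist (S (k + n)) L + r n) \<longlonglongrightarrow> r n"
      using tendsto_add[OF LIMSEQ_ignore_initial_segment[OF L(2), of n] tendsto_const[of "r n"]] by simp
    have "aut_dist L (S n) \<le> aut_dist (S (k + n)) L + r n" for k
    proof -
      have "aut_dist L (S n) \<le> aut_dist L (S (k + n)) + aut_dist (S (k + n)) (S n)"
        by (rule aut_dist_triangle[OF L(1) S(1) S(1)])
      then show ?thesis
        using nested[of n k] S(2)[of "n + k"]
        unfolding aut_dist_commute[of L "S (k + n)"] add.commute[of n k] by linarith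
    qed
    then show "\<exists>N. \<forall>k\<ge>N. aut_dist L (S n) \<le> aut_dist (S (k + n)) L + r n" by blast
  qed
  have "aut_dist L (S n) < r n" for n
  proof -
    have "aut_dist L (S n) \<le> aut_dist L (S (Suc n)) + aut_dist (S (Suc n)) (S n)"
      by (rule aut_dist_triangle[OF L(1) S(1) S(1)])
    then show ?thesis using le[of "Suc n"] S(5,6)[of n] by linarith
  qed
  then have "aut_class \<U> L \<in> X n" for n using S(4) L(1) by blast
  from this[of 0] this[of "Suc n" for n] have "aut_class \<U> L \<in> V" "\<forall>n. aut_class \<U> L \<in> W n"
    by (auto simp: X_def)
  with L(1) show ?thesis by blast
qed

section \<open>Isomorphisms between sets of equal measure\<close>

abbreviation "\<Omega> \<equiv> restrict_space lborel {0<..<1::real}"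

text \<open>\<open>C\<close> is the distribution function of the uniform measure on \<open>K\<close> and \<open>J\<close> its quantile function. As
this measure has no atoms, \<open>C\<close> is continuous, and \<open>J\<close> is an isomorphism modulo null sets from the
unit interval to \<open>K\<close> with inverse \<open>C\<close>.\<close>

lemma quantile_coordinates:
  assumes K: "K \<in> sets \<U>" "0 < measure \<U> K"
  obtains J C where "J \<in> borel_measurable borel" "C \<in> borel_measurable borel"
    "\<And>t. J t \<in> {0..1}" "distr \<Omega> borel J = uniform_measure lborel K" "AE t in \<Omega>. C (J t) = t"
proof -
  define M where "M = uniform_measure lborel K"
  have Kb: "K \<in> sets borel" "K \<subseteq> {0..1}" using K by (auto simp: sets_unit_iff)
  have eK: "emeasure lborel K = measure \<U> K" using emeasure_unit[OF K(1)] unit.emeasure_eq_measure by simp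
  then have K0: "emeasure lborel K \<noteq> 0" "emeasure lborel K \<noteq> \<infinity>" using K(2) by auto
  have "prob_space M" unfolding M_def using K0 by (intro prob_space_uniform_measure)
  then interpret M: real_distribution M
    by (simp add: real_distribution_def real_distribution_axioms_def M_def)
  interpret M: cdf_distribution M by unfold_locales
  have atom: "measure M {x} = 0" for x
  proof -
    have "emeasure M {x} = emeasure lborel (K \<inter> {x}) / emeasure lborel K"
      unfolding M_def using Kb by (intro emeasure_uniform_measure) auto
    moreover have "emeasure lborel (K \<inter> {x}) \<le> emeasure lborel {x}"
      by (intro emeasure_mono) auto
    ultimately show ?thesis by (simp add: measure_def)
  qed
  have CI: "M.C (M.I t) = t" if t: "0 < t" "t < 1" for t
  proof (rule antisym)
    show "t \<le> M.C (M.I t)" using M.pseudoinverse[OF t, of "M.I t"] by simp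
    have "isCont M.C (M.I t)" using atom M.isCont_cdf by simp
    then have "(M.C \<longlongrightarrow> M.C (M.I t)) (at_left (M.I t))"
      by (simp add: continuous_within filterlim_at_split)
    moreover have "eventually (\<lambda>x. M.C x \<le> t) (at_left (M.I t))"
    proof (rule eventually_at_leftI[of "M.I t - 1"])
      fix x assume "x \<in> {M.I t - 1<..<M.I t}"
      then have "\<not> M.I t \<le> x" by simp
      then show "M.C x \<le> t" using M.pseudoinverse[OF t, of x] by linarith
    qed simp
    ultimately show "M.C (M.I t) \<le> t"
      by (rule tendsto_upperbound) simp
  qed
  have I_dist: "distr \<Omega> borel M.I = M" by (rule M.distr_I_eq_M)
  have I_meas: "M.I \<in> borel_measurable \<Omega>" using M.measurable_CI by (simp cong: measurable_cong_sets)
  \<comment> \<open>The quantile function of a measure carried by the interval has its values there; truncation makes this hold everywhere.\<close>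
  define J where "J t = indicat_real {0<..<1} t * max 0 (min 1 (M.I t))" for t
  have "AE x in M. x \<in> K"
    unfolding M_def using K0 Kb by (intro AE_uniform_measureI) auto
  then have "AE x in distr \<Omega> borel M.I. x \<in> K" unfolding I_dist .
  then have "AE t in \<Omega>. M.I t \<in> K" by (rule AE_distrD[OF I_meas])
  then have JI: "AE t in \<Omega>. J t = M.I t"
    using AE_space
  proof eventually_elim
    case (elim t)
    then have "M.I t \<in> {0..1}" using Kb(2) by auto
    with elim show ?case by (auto simp: J_def space_restrict_space)
  qed
  have J_meas: "J \<in> borel_measurable borel"
  proof -
    have "(\<lambda>t. max 0 (min 1 (M.I t))) \<in> borel_measurable (restrict_space borel {0<..<1})"
      by measurable
    then have "(\<lambda>t. indicat_real {0<..<1} t *\<^sub>R max 0 (min 1 (M.I t))) \<in> borel_measurable borel"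
      by (subst (asm) borel_measurable_restrict_space_iff) auto
    then show ?thesis by (simp add: J_def[abs_def])
  qed
  have "distr \<Omega> borel J = distr \<Omega> borel M.I"
    using JI J_meas I_meas by (intro distr_cong_AE) (auto intro: measurable_restrict_space1)
  then have "distr \<Omega> borel J = uniform_measure lborel K" unfolding I_dist by (simp add: M_def)
  moreover have "AE t in \<Omega>. M.C (J t) = t"
    using JI AE_space
  proof eventually_elim
    case (elim t)
    then show ?case using CI[of t] by (simp add: space_restrict_space)
  qed
  ultimately show thesis using J_meas M.measurable_C by (intro that[of J M.C]) (auto simp: J_def indicator_def)
qed

text \<open>Both sets are parametrized, up to null sets, by their quantile functions over the same interval;
\<open>f\<close> leads from \<open>K\<close> to the parameter and on to \<open>K'\<close>, and \<open>g\<close> back.\<close>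

lemma equal_measure_isomorphism:
  assumes K: "K \<in> sets \<U>" "K' \<in> sets \<U>" and eq: "measure \<U> K = measure \<U> K'"
  obtains f g where "f \<in> \<U> \<rightarrow>\<^sub>M \<U>" "g \<in> \<U> \<rightarrow>\<^sub>M \<U>"
    "\<And>B. B \<in> sets \<U> \<Longrightarrow> measure \<U> (K \<inter> f -` B) = measure \<U> (K' \<inter> B)"
    "AE x in \<U>. x \<in> K \<longrightarrow> f x \<in> K' \<and> g (f x) = x"
    "AE x in \<U>. x \<in> K' \<longrightarrow> g x \<in> K \<and> f (g x) = x"
proof (cases "measure \<U> K = 0")
  case True
  have null: "measure \<U> (X \<inter> B) = 0" if "measure \<U> X = 0" "X \<in> sets \<U>" for X B
  proof -
    have "measure \<U> (X \<inter> B) \<le> measure \<U> X" using that by (intro unit.finite_measure_mono) auto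
    with that show ?thesis by (simp add: measure_le_0_iff)
  qed
  have ae: "AE x in \<U>. x \<notin> X" if "measure \<U> X = 0" "X \<in> sets \<U>" for X
    using that by (intro AE_not_in) (auto simp: null_sets_def unit.emeasure_eq_measure)
  show thesis
  proof (rule that[of "\<lambda>x. x" "\<lambda>x. x"])
    show "AE x in \<U>. x \<in> K \<longrightarrow> x \<in> K' \<and> x = x" using ae[of K] True K by auto
    show "AE x in \<U>. x \<in> K' \<longrightarrow> x \<in> K \<and> x = x" using ae[of K'] True K eq by auto
  qed (use null True eq K in auto)
next
  case False
  then have pos: "0 < measure \<U> K" "0 < measure \<U> K'" using eq by (auto simp: less_le)
  have eK: "emeasure lborel X = measure \<U> X" if "X \<in> sets \<U>" for X
    using emeasure_unit[OF that] unit.emeasure_eq_measure by simp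
  obtain J C where JC[measurable]: "J \<in> borel_measurable borel" "C \<in> borel_measurable borel"
    and JC': "\<And>t. J t \<in> {0..1}" "distr \<Omega> borel J = uniform_measure lborel K" "AE t in \<Omega>. C (J t) = t"
    by (rule quantile_coordinates[OF K(1) pos(1)]) blast
  obtain J' C' where JC2[measurable]: "J' \<in> borel_measurable borel" "C' \<in> borel_measurable borel"
    and JC2': "\<And>t. J' t \<in> {0..1}" "distr \<Omega> borel J' = uniform_measure lborel K'" "AE t in \<Omega>. C' (J' t) = t"
    by (rule quantile_coordinates[OF K(2) pos(2)]) blast
  have J\<Omega>[measurable]: "J \<in> borel_measurable \<Omega>" "J' \<in> borel_measurable \<Omega>"
    by (auto intro: measurable_restrict_space1)
  have AE_K: "AE x in \<U>. x \<in> X \<longrightarrow> P x"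
    if "distr \<Omega> borel Q = uniform_measure lborel X" "AE t in \<Omega>. P (Q t)" "X \<in> sets \<U>"
      "0 < measure \<U> X" "Measurable.pred borel P" "Q \<in> borel_measurable \<Omega>" for X P Q
  proof -
    have m: "{x \<in> space borel. P x} \<in> sets borel" using that(5) by measurable
    have "AE x in distr \<Omega> borel Q. P x" using AE_distr_iff[OF that(6) m] that(2) by simp
    then have "AE x in uniform_measure lborel X. P x" by (simp only: that(1))
    moreover have "emeasure lborel X \<noteq> 0" "emeasure lborel X < \<infinity>" using that(4) eK[OF that(3)] by auto
    ultimately have "AE x in lborel. x \<in> X \<longrightarrow> P x" by (simp add: AE_uniform_measure)
    then show ?thesis unfolding unit_lebesgue_def by (subst AE_restrict_space_iff) auto
  qed
  define f g where "f x = J' (C x)" and "g x = J (C' x)" for x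
  have [measurable]: "f \<in> borel_measurable borel" "g \<in> borel_measurable borel"
    unfolding f_def g_def by measurable
  have fJ: "AE t in \<Omega>. f (J t) = J' t" using JC'(3) by eventually_elim (simp add: f_def)
  have gJ: "AE t in \<Omega>. g (J' t) = J t" using JC2'(3) by eventually_elim (simp add: g_def)
  have inK: "AE t in \<Omega>. Q t \<in> X"
    if "distr \<Omega> borel Q = uniform_measure lborel X" "X \<in> sets \<U>" "0 < measure \<U> X" "Q \<in> borel_measurable \<Omega>" for Q X
  proof -
    have "AE x in distr \<Omega> borel Q. x \<in> X"
      unfolding that(1) using that(2,3) eK[OF that(2)] by (intro AE_uniform_measureI) (auto simp: sets_unit_iff)
    then show ?thesis by (rule AE_distrD[OF that(4)])
  qed
  have Kb[measurable]: "K \<in> sets borel" "K' \<in> sets borel" using K by (auto simp: sets_unit_iff)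
  show thesis
  proof (rule that[of f g])
    show "f \<in> \<U> \<rightarrow>\<^sub>M \<U>" "g \<in> \<U> \<rightarrow>\<^sub>M \<U>"
      using JC'(1) JC2'(1)
      by (auto intro!: measurable_unitI borel_measurable_unit simp: f_def g_def simp del: atLeastAtMost_iff)
    show "AE x in \<U>. x \<in> K \<longrightarrow> f x \<in> K' \<and> g (f x) = x"
    proof (rule AE_K[OF JC'(2) _ K(1) pos(1)])
      show "AE t in \<Omega>. f (J t) \<in> K' \<and> g (f (J t)) = J t"
        using fJ gJ inK[OF JC2'(2) K(2) pos(2) J\<Omega>(2)] by eventually_elim auto
    qed measurable
    show "AE x in \<U>. x \<in> K' \<longrightarrow> g x \<in> K \<and> f (g x) = x"
    proof (rule AE_K[OF JC2'(2) _ K(2) pos(2)])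
      show "AE t in \<Omega>. g (J' t) \<in> K \<and> f (g (J' t)) = J' t"
        using fJ gJ inK[OF JC'(2) K(1) pos(1) J\<Omega>(1)] by eventually_elim auto
    qed measurable
    fix B assume "B \<in> sets \<U>"
    then have B[measurable]: "B \<in> sets borel" by (auto simp: sets_unit_iff)
    have fB: "f -` B \<in> sets borel"
      using measurable_sets[of f borel borel B] B by simp
    have mu: "measure (uniform_measure lborel X) Y = measure \<U> (X \<inter> Y) / measure \<U> X"
      if "X \<in> sets \<U>" "Y \<in> sets borel" "0 < measure \<U> X" for X Y
    proof -
      have XY: "X \<inter> Y \<in> sets \<U>" "X \<in> sets borel" using that by (auto simp: sets_unit_iff)
      have "emeasure (uniform_measure lborel X) Y = emeasure lborel (X \<inter> Y) / emeasure lborel X"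
        using that XY by (intro emeasure_uniform_measure) auto
      also have "\<dots> = ennreal (measure \<U> (X \<inter> Y) / measure \<U> X)"
        using eK[OF XY(1)] eK[OF that(1)] that(3) by (simp add: divide_ennreal)
      finally show ?thesis by (simp add: measure_def)
    qed
    have "measure (uniform_measure lborel K) (f -` B) = measure (distr \<Omega> borel J) (f -` B)"
      by (simp add: JC'(2))
    also have "\<dots> = measure (distr \<Omega> borel (\<lambda>t. f (J t))) B"
      using fB by (subst (1 2) measure_distr) (auto simp: vimage_def)
    also have "distr \<Omega> borel (\<lambda>t. f (J t)) = distr \<Omega> borel J'"
      using fJ by (intro distr_cong_AE) auto
    finally have "measure (uniform_measure lborel K) (f -` B) = measure (uniform_measure lborel K') B"
      by (simp add: JC2'(2))
    with fB show "measure \<U> (K \<inter> f -` B) = measure \<U> (K' \<inter> B)"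
      using pos eq by (simp add: mu K)
  qed
qed

section \<open>Permuting the cells of a finite partition\<close>

lemma measure_finite_partition:
  assumes \<kappa>: "\<kappa> \<in> \<U> \<rightarrow>\<^sub>M count_space J" and fin: "finite J" and X: "X \<in> sets \<U>"
  shows "measure \<U> X = (\<Sum>j\<in>J. measure \<U> ({x \<in> space \<U>. \<kappa> x = j} \<inter> X))"
proof -
  have K: "{x \<in> space \<U>. \<kappa> x = j} \<inter> X \<in> sets \<U>" if "j \<in> J" for j
  proof -
    have "\<kappa> -` {j} \<inter> space \<U> \<in> sets \<U>" using \<kappa> that by (intro measurable_sets) auto
    moreover have "\<kappa> -` {j} \<inter> space \<U> = {x \<in> space \<U>. \<kappa> x = j}" by auto
    ultimately show ?thesis using X by auto
  qed
  have "X = (\<Union>j\<in>J. {x \<in> space \<U>. \<kappa> x = j} \<inter> X)"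
    using sets.sets_into_space[OF X] measurable_space[OF \<kappa>] by auto
  then have "measure \<U> X = measure \<U> (\<Union>j\<in>J. {x \<in> space \<U>. \<kappa> x = j} \<inter> X)" by simp
  also have "\<dots> = (\<Sum>j\<in>J. measure \<U> ({x \<in> space \<U>. \<kappa> x = j} \<inter> X))"
    using K fin by (intro unit.finite_measure_finite_Union) (auto simp: disjoint_family_on_def)
  finally show ?thesis .
qed

lemma measure_labels:
  assumes \<kappa>: "\<kappa> \<in> \<U> \<rightarrow>\<^sub>M count_space J" and fin: "finite J"
  shows "measure \<U> {x \<in> space \<U>. R (\<kappa> x)} = (\<Sum>j\<in>J. of_bool (R j) * measure \<U> {x \<in> space \<U>. \<kappa> x = j})"
proof -
  have "\<kappa> -` {j \<in> J. R j} \<inter> space \<U> \<in> sets \<U>" using \<kappa> by (intro measurable_sets) auto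
  moreover have "\<kappa> -` {j \<in> J. R j} \<inter> space \<U> = {x \<in> space \<U>. R (\<kappa> x)}"
    using measurable_space[OF \<kappa>] by auto
  ultimately have "{x \<in> space \<U>. R (\<kappa> x)} \<in> sets \<U>" by simp
  from measure_finite_partition[OF \<kappa> fin this]
  have "measure \<U> {x \<in> space \<U>. R (\<kappa> x)}
      = (\<Sum>j\<in>J. measure \<U> ({x \<in> space \<U>. \<kappa> x = j} \<inter> {x \<in> space \<U>. R (\<kappa> x)}))" .
  also have "\<dots> = (\<Sum>j\<in>J. of_bool (R j) * measure \<U> {x \<in> space \<U>. \<kappa> x = j})"
  proof (rule sum.cong[OF refl])
    fix j assume "j \<in> J"
    have "{x \<in> space \<U>. \<kappa> x = j} \<inter> {x \<in> space \<U>. R (\<kappa> x)} = (if R j then {x \<in> space \<U>. \<kappa> x = j} else {})"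
      by auto
    then show "measure \<U> ({x \<in> space \<U>. \<kappa> x = j} \<inter> {x \<in> space \<U>. R (\<kappa> x)})
        = of_bool (R j) * measure \<U> {x \<in> space \<U>. \<kappa> x = j}" by auto
  qed
  finally show ?thesis .
qed

text \<open>A labelling \<open>\<kappa>\<close> with values in a finite set encodes a partition. Isomorphisms from each cell to its
image cell are glued together.\<close>

lemma automorphism_permuting_cells:
  assumes \<kappa>: "\<kappa> \<in> \<U> \<rightarrow>\<^sub>M count_space J" and fin: "finite J" and \<sigma>: "bij_betw \<sigma> J J"
    and eq: "\<And>j. j \<in> J \<Longrightarrow> measure \<U> {x \<in> space \<U>. \<kappa> x = \<sigma> j} = measure \<U> {x \<in> space \<U>. \<kappa> x = j}"
  obtains T where "T \<in> mp_automorphisms \<U>" "AE x in \<U>. \<kappa> (T x) = \<sigma> (\<kappa> x)"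
proof -
  define K where "K j = {x \<in> space \<U>. \<kappa> x = j}" for j
  have K: "K j \<in> sets \<U>" if "j \<in> J" for j
  proof -
    have "\<kappa> -` {j} \<inter> space \<U> \<in> sets \<U>" using \<kappa> that by (intro measurable_sets) auto
    moreover have "\<kappa> -` {j} \<inter> space \<U> = K j" by (auto simp: K_def)
    ultimately show ?thesis by simp
  qed
  have \<sigma>J: "\<sigma> j \<in> J" if "j \<in> J" for j using \<sigma> that by (auto simp: bij_betw_def)
  have "\<forall>j\<in>J. \<exists>f g. f \<in> \<U> \<rightarrow>\<^sub>M \<U> \<and> g \<in> \<U> \<rightarrow>\<^sub>M \<U> \<and>
      (\<forall>B\<in>sets \<U>. measure \<U> (K j \<inter> f -` B) = measure \<U> (K (\<sigma> j) \<inter> B)) \<and>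
      (AE x in \<U>. x \<in> K j \<longrightarrow> f x \<in> K (\<sigma> j) \<and> g (f x) = x) \<and>
      (AE x in \<U>. x \<in> K (\<sigma> j) \<longrightarrow> g x \<in> K j \<and> f (g x) = x)"
  proof
    fix j assume j: "j \<in> J"
    show "\<exists>f g. f \<in> \<U> \<rightarrow>\<^sub>M \<U> \<and> g \<in> \<U> \<rightarrow>\<^sub>M \<U> \<and>
      (\<forall>B\<in>sets \<U>. measure \<U> (K j \<inter> f -` B) = measure \<U> (K (\<sigma> j) \<inter> B)) \<and>
      (AE x in \<U>. x \<in> K j \<longrightarrow> f x \<in> K (\<sigma> j) \<and> g (f x) = x) \<and>
      (AE x in \<U>. x \<in> K (\<sigma> j) \<longrightarrow> g x \<in> K j \<and> f (g x) = x)"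
      by (rule equal_measure_isomorphism[OF K[OF j] K[OF \<sigma>J[OF j]]])
        (use eq[OF j] in \<open>simp add: K_def\<close>, blast)
  qed
  then obtain f g where fg: "\<And>j. j \<in> J \<Longrightarrow> f j \<in> \<U> \<rightarrow>\<^sub>M \<U>" "\<And>j. j \<in> J \<Longrightarrow> g j \<in> \<U> \<rightarrow>\<^sub>M \<U>"
    "\<And>j B. j \<in> J \<Longrightarrow> B \<in> sets \<U> \<Longrightarrow> measure \<U> (K j \<inter> f j -` B) = measure \<U> (K (\<sigma> j) \<inter> B)"
    "\<And>j. j \<in> J \<Longrightarrow> AE x in \<U>. x \<in> K j \<longrightarrow> f j x \<in> K (\<sigma> j) \<and> g j (f j x) = x"
    "\<And>j. j \<in> J \<Longrightarrow> AE x in \<U>. x \<in> K (\<sigma> j) \<longrightarrow> g j x \<in> K j \<and> f j (g j x) = x"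
    unfolding bchoice_iff by blast
  define \<tau> where "\<tau> = the_inv_into J \<sigma>"
  have \<tau>: "\<tau> (\<sigma> j) = j" if "j \<in> J" for j
    using \<sigma> that by (auto simp: \<tau>_def bij_betw_def the_inv_into_f_f)
  have \<tau>J: "\<tau> j \<in> J" "\<sigma> (\<tau> j) = j" if "j \<in> J" for j
    using \<sigma> that by (auto simp: \<tau>_def bij_betw_def intro: the_inv_into_into f_the_inv_into_f)
  define T S where "T x = f (\<kappa> x) x" and "S x = g (\<tau> (\<kappa> x)) x" for x
  have T: "T \<in> \<U> \<rightarrow>\<^sub>M \<U>"
    unfolding T_def
    by (rule measurable_compose_countable'[where I=J, OF _ \<kappa>]) (use fg(1) fin in \<open>auto intro: countable_finite\<close>)
  have S: "S \<in> \<U> \<rightarrow>\<^sub>M \<U>"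
    unfolding S_def
    by (rule measurable_compose_countable'[where I=J, OF _ \<kappa>]) (use fg(2) \<tau>J fin in \<open>auto intro: countable_finite\<close>)
  have "distr \<U> \<U> T = \<U>"
  proof (rule measure_eqI)
    fix B assume "B \<in> sets (distr \<U> \<U> T)"
    then have B: "B \<in> sets \<U>" by simp
    have TB: "T -` B \<inter> space \<U> \<in> sets \<U>" using T B by (rule measurable_sets)
    have "measure \<U> (T -` B \<inter> space \<U>) = (\<Sum>j\<in>J. measure \<U> (K j \<inter> (T -` B \<inter> space \<U>)))"
      unfolding K_def by (rule measure_finite_partition[OF \<kappa> fin TB])
    also have "\<dots> = (\<Sum>j\<in>J. measure \<U> (K j \<inter> f j -` B))"
      by (intro sum.cong refl arg_cong[where f="measure \<U>"]) (auto simp: K_def T_def)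
    also have "\<dots> = (\<Sum>j\<in>J. measure \<U> (K (\<sigma> j) \<inter> B))" using fg(3) B by simp
    also have "\<dots> = (\<Sum>j\<in>J. measure \<U> (K j \<inter> B))" by (rule sum.reindex_bij_betw[OF \<sigma>])
    also have "\<dots> = measure \<U> B" unfolding K_def by (rule measure_finite_partition[OF \<kappa> fin B, symmetric])
    finally show "emeasure (distr \<U> \<U> T) B = emeasure \<U> B"
      using T B by (simp add: emeasure_distr unit.emeasure_eq_measure)
  qed simp
  have \<kappa>J: "\<kappa> x \<in> J" if "x \<in> {0..1}" for x using measurable_space[OF \<kappa>, of x] that by simp
  have ae1: "AE x in \<U>. \<forall>j\<in>J. x \<in> K j \<longrightarrow> f j x \<in> K (\<sigma> j) \<and> g j (f j x) = x"
    using fg(4) fin by (intro AE_finite_allI) auto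
  have ae2: "AE x in \<U>. \<forall>j\<in>J. x \<in> K (\<sigma> j) \<longrightarrow> g j x \<in> K j \<and> f j (g j x) = x"
    using fg(5) fin by (intro AE_finite_allI) auto
  have "AE x in \<U>. \<kappa> (T x) = \<sigma> (\<kappa> x) \<and> S (T x) = x"
    using ae1 AE_space
  proof eventually_elim
    case (elim x)
    then have "\<kappa> x \<in> J" "x \<in> K (\<kappa> x)" using \<kappa>J by (auto simp: K_def)
    with elim have "T x \<in> K (\<sigma> (\<kappa> x))" "g (\<kappa> x) (T x) = x" by (auto simp: T_def)
    then show ?case using \<tau>[OF \<open>\<kappa> x \<in> J\<close>] by (auto simp: K_def S_def)
  qed
  moreover have "AE x in \<U>. T (S x) = x"
    using ae2 AE_space
  proof eventually_elim
    case (elim x)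
    then have j: "\<tau> (\<kappa> x) \<in> J" "x \<in> K (\<sigma> (\<tau> (\<kappa> x)))" using \<kappa>J \<tau>J by (auto simp: K_def)
    with elim have "S x \<in> K (\<tau> (\<kappa> x))" "f (\<tau> (\<kappa> x)) (S x) = x" by (auto simp: S_def)
    then show ?case by (auto simp: K_def T_def)
  qed
  ultimately have "automorphism_mod0 T S"
    unfolding automorphism_mod0_def using T S \<open>distr \<U> \<U> T = \<U>\<close> by auto
  then obtain R where R: "R \<in> mp_automorphisms \<U>" "AE x in \<U>. R x = T x"
    by (rule automorphism_mod0_realization)
  have "AE x in \<U>. \<kappa> (R x) = \<sigma> (\<kappa> x)"
    using R(2) \<open>AE x in \<U>. \<kappa> (T x) = \<sigma> (\<kappa> x) \<and> S (T x) = x\<close> by eventually_elim simp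
  with R(1) show thesis by (rule that)
qed

text \<open>Intermediate value theorem for \<open>t \<mapsto> \<mu>(A \<inter> (-\<infinity>, t])\<close>.\<close>

lemma exists_subset_of_measure:
  assumes A: "A \<in> sets \<U>" and c: "0 \<le> c" "c \<le> measure \<U> A"
  obtains B where "B \<in> sets \<U>" "B \<subseteq> A" "measure \<U> B = c"
proof -
  define h where "h t = measure \<U> (A \<inter> {..t})" for t
  have At: "A \<inter> X \<in> sets \<U>" if "X \<in> sets borel" for X using A that by (auto simp: sets_unit_iff)
  have lip: "\<bar>h s - h t\<bar> \<le> \<bar>s - t\<bar>" for s t
  proof -
    have *: "h t \<le> h s \<and> h s - h t \<le> s - t" if "t \<le> s" for s t
    proof -
      have "h s = measure \<U> ((A \<inter> {..t}) \<union> (A \<inter> {t<..s}))"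
        unfolding h_def using that by (intro arg_cong[where f="measure \<U>"]) auto
      also have "\<dots> = h t + measure \<U> (A \<inter> {t<..s})"
        unfolding h_def by (intro unit.finite_measure_Union At) auto
      finally have "h s = h t + measure \<U> (A \<inter> {t<..s})" .
      moreover have "emeasure \<U> (A \<inter> {t<..s}) \<le> emeasure lborel {t<..s}"
        using At[of "{t<..s}"] by (subst emeasure_unit) (auto intro!: emeasure_mono)
      then have "measure \<U> (A \<inter> {t<..s}) \<le> s - t"
        using that by (simp add: unit.emeasure_eq_measure emeasure_lborel_Ioc)
      ultimately show ?thesis by simp
    qed
    show ?thesis using *[of s t] *[of t s] by (cases "s \<le> t") auto
  qed
  have "continuous_on {0..1} h"
    unfolding continuous_on_iff dist_real_def using lip by (meson le_less_trans)
  moreover have "h 0 \<le> c"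
  proof -
    have "A \<inter> {..0} \<subseteq> {0}" using A by (auto simp: sets_unit_iff)
    then have "emeasure lborel (A \<inter> {..0}) \<le> emeasure lborel {0::real}"
      by (rule emeasure_mono) simp
    then have "emeasure \<U> (A \<inter> {..0}) = 0"
      using At[of "{..0}"] by (simp add: emeasure_unit)
    then show ?thesis using c by (simp add: h_def measure_def)
  qed
  moreover have "h 1 = measure \<U> A"
    unfolding h_def using A by (intro arg_cong[where f="measure \<U>"]) (auto simp: sets_unit_iff)
  ultimately obtain t where "h t = c" using IVT'[of h 0 c 1] c by auto
  then show thesis using At[of "{..t}"] by (intro that[of "A \<inter> {..t}"]) (auto simp: h_def)
qed

lemma exists_disjoint_subsets_of_measures:
  assumes "finite J" "A \<in> sets \<U>" "\<And>j. j \<in> J \<Longrightarrow> 0 \<le> \<omega> j" "sum \<omega> J \<le> measure \<U> A"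
  shows "\<exists>K. disjoint_family_on K J \<and> (\<forall>j\<in>J. K j \<in> sets \<U> \<and> K j \<subseteq> A \<and> measure \<U> (K j) = \<omega> j)"
  using assms
proof (induction J arbitrary: A rule: finite_induct)
  case empty
  then show ?case by (auto simp: disjoint_family_on_def)
next
  case (insert i J)
  have "0 \<le> sum \<omega> J" using insert by (intro sum_nonneg) auto
  with insert have "0 \<le> \<omega> i" "\<omega> i \<le> measure \<U> A" by auto
  then obtain B where B: "B \<in> sets \<U>" "B \<subseteq> A" "measure \<U> B = \<omega> i"
    using exists_subset_of_measure[OF insert(4)] by metis
  have "measure \<U> (A - B) = measure \<U> A - \<omega> i"
    using B insert(4) by (simp add: unit.finite_measure_Diff)
  then have "\<exists>K. disjoint_family_on K J \<and> (\<forall>j\<in>J. K j \<in> sets \<U> \<and> K j \<subseteq> A - B \<and> measure \<U> (K j) = \<omega> j)"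
    using B insert by (intro insert.IH) auto
  then obtain K where K: "disjoint_family_on K J"
    "\<forall>j\<in>J. K j \<in> sets \<U> \<and> K j \<subseteq> A - B \<and> measure \<U> (K j) = \<omega> j" by blast
  have "disjoint_family_on (K(i := B)) (insert i J)"
    using K insert(2) unfolding disjoint_family_on_def by (auto split: if_splits)
  moreover have "\<forall>j\<in>insert i J. (K(i := B)) j \<in> sets \<U> \<and> (K(i := B)) j \<subseteq> A \<and> measure \<U> ((K(i := B)) j) = \<omega> j"
    using K B insert(2) by auto
  ultimately show ?case by blast
qed

text \<open>Any finite refinement of a partition that is consistent as far as measures are concerned is realized
by sets: each cell \<open>{x. q x = a}\<close> is cut into pieces of the prescribed measures \<open>\<omega> j\<close>.\<close>

lemma refine_labelling:
  assumes q: "q \<in> \<U> \<rightarrow>\<^sub>M count_space L" and fin: "finite L" "finite J" and lab: "\<And>j. j \<in> J \<Longrightarrow> lab j \<in> L"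
    and \<omega>: "\<And>j. j \<in> J \<Longrightarrow> 0 \<le> \<omega> j"
    and total: "\<And>a. a \<in> L \<Longrightarrow> (\<Sum>j | j \<in> J \<and> lab j = a. \<omega> j) = measure \<U> {x \<in> space \<U>. q x = a}"
  obtains \<kappa> where "\<kappa> \<in> \<U> \<rightarrow>\<^sub>M count_space J" "AE x in \<U>. lab (\<kappa> x) = q x"
    "\<And>j. j \<in> J \<Longrightarrow> measure \<U> {x \<in> space \<U>. \<kappa> x = j} = \<omega> j"
proof -
  define Q where "Q a = {x \<in> space \<U>. q x = a}" for a
  have Q: "Q a \<in> sets \<U>" if "a \<in> L" for a
  proof -
    have "q -` {a} \<inter> space \<U> \<in> sets \<U>" using q that by (intro measurable_sets) auto
    moreover have "q -` {a} \<inter> space \<U> = Q a" by (auto simp: Q_def)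
    ultimately show ?thesis by simp
  qed
  have "\<forall>a\<in>L. \<exists>K. disjoint_family_on K {j \<in> J. lab j = a} \<and>
      (\<forall>j\<in>{j \<in> J. lab j = a}. K j \<in> sets \<U> \<and> K j \<subseteq> Q a \<and> measure \<U> (K j) = \<omega> j)"
    using fin \<omega> total Q by (intro ballI exists_disjoint_subsets_of_measures) (auto simp: Q_def)
  then obtain K' where K': "\<And>a. a \<in> L \<Longrightarrow> disjoint_family_on (K' a) {j \<in> J. lab j = a}"
    "\<And>a j. a \<in> L \<Longrightarrow> j \<in> J \<Longrightarrow> lab j = a \<Longrightarrow> K' a j \<in> sets \<U> \<and> K' a j \<subseteq> Q a \<and> measure \<U> (K' a j) = \<omega> j"
    unfolding bchoice_iff by blast
  define K where "K j = K' (lab j) j" for j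
  have K: "K j \<in> sets \<U>" "K j \<subseteq> Q (lab j)" "measure \<U> (K j) = \<omega> j" if "j \<in> J" for j
    using K'(2)[OF lab[OF that] that refl] by (auto simp: K_def)
  have disj: "disjoint_family_on K J"
    unfolding disjoint_family_on_def
  proof (intro ballI impI)
    fix i j assume ij: "i \<in> J" "j \<in> J" "i \<noteq> j"
    show "K i \<inter> K j = {}"
    proof (cases "lab i = lab j")
      case True
      then show ?thesis using disjoint_family_onD[OF K'(1)[OF lab[OF ij(1)]], of i j] ij by (auto simp: K_def)
    next
      case False
      then have "Q (lab i) \<inter> Q (lab j) = {}" by (auto simp: Q_def)
      then show ?thesis using K(2)[OF ij(1)] K(2)[OF ij(2)] by blast
    qed
  qed
  have "measure \<U> (\<Union>j\<in>J. K j) = (\<Sum>j\<in>J. \<omega> j)"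
    using K disj fin by (subst unit.finite_measure_finite_Union) auto
  also have "\<dots> = (\<Sum>a\<in>L. \<Sum>j | j \<in> J \<and> lab j = a. \<omega> j)"
    using fin lab by (intro sum.group[symmetric]) auto
  also have "\<dots> = (\<Sum>a\<in>L. measure \<U> (Q a \<inter> space \<U>))"
  proof (intro sum.cong refl)
    fix a assume "a \<in> L"
    moreover have "Q a \<inter> space \<U> = {x \<in> space \<U>. q x = a}" by (auto simp: Q_def)
    ultimately show "(\<Sum>j | j \<in> J \<and> lab j = a. \<omega> j) = measure \<U> (Q a \<inter> space \<U>)"
      by (simp only: total)
  qed
  also have "\<dots> = 1"
    using measure_finite_partition[OF q fin(1) sets.top] unit.prob_space by (simp add: Q_def)
  finally have full: "measure \<U> (\<Union>j\<in>J. K j) = 1" .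
  have UK: "(\<Union>j\<in>J. K j) \<in> sets \<U>" using K fin by auto
  have ae: "AE x in \<U>. x \<in> (\<Union>j\<in>J. K j)"
    using unit.AE_in_set_eq_1[OF UK] full by simp
  have "J \<noteq> {}" using full by auto
  \<comment> \<open>The pieces cover the interval up to a null set, on which the label is arbitrary.\<close>
  then obtain j0 where j0: "j0 \<in> J" by auto
  define \<kappa> where "\<kappa> x = (if x \<in> (\<Union>j\<in>J. K j) then THE j. j \<in> J \<and> x \<in> K j else j0)" for x
  have \<kappa>_eq: "\<kappa> x = j" if "j \<in> J" "x \<in> K j" for x j
  proof -
    have "(THE j. j \<in> J \<and> x \<in> K j) = j"
      using that disj by (intro the_equality) (auto simp: disjoint_family_on_def)
    with that show ?thesis by (auto simp: \<kappa>_def)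
  qed
  have \<kappa>J: "\<kappa> x \<in> J" for x using \<kappa>_eq[of _ x] j0 by (cases "x \<in> (\<Union>j\<in>J. K j)") (auto simp: \<kappa>_def)
  have cell: "{x \<in> space \<U>. \<kappa> x = j} = K j \<union> (if j = j0 then space \<U> - (\<Union>j\<in>J. K j) else {})" if "j \<in> J" for j
  proof -
    have K01: "K j \<subseteq> space \<U>" using sets.sets_into_space[OF K(1)[OF that]] .
    show ?thesis
    proof (intro set_eqI)
      fix x
      show "x \<in> {x \<in> space \<U>. \<kappa> x = j} \<longleftrightarrow> x \<in> K j \<union> (if j = j0 then space \<U> - (\<Union>j\<in>J. K j) else {})"
      proof (cases "x \<in> (\<Union>j\<in>J. K j)")
        case True
        then obtain i where i: "i \<in> J" "x \<in> K i" by blast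
        then have "x \<in> K j \<longleftrightarrow> i = j" "\<kappa> x = i" using \<kappa>_eq that by blast+
        with True i K01 show ?thesis using sets.sets_into_space[OF K(1)[OF i(1)]] by auto
      next
        case False
        then have "\<kappa> x = j0" by (simp add: \<kappa>_def)
        with False that show ?thesis by auto
      qed
    qed
  qed
  have cell_sets: "{x \<in> space \<U>. \<kappa> x = j} \<in> sets \<U>" if "j \<in> J" for j
    unfolding cell[OF that] using K(1)[OF that] UK sets.compl_sets[OF UK] by auto
  show thesis
  proof (rule that[of \<kappa>])
    show "\<kappa> \<in> \<U> \<rightarrow>\<^sub>M count_space J"
      unfolding measurable_count_space_eq2[OF fin(2)]
    proof (intro conjI ballI)
      fix j assume "j \<in> J"
      moreover have "\<kappa> -` {j} \<inter> space \<U> = {x \<in> space \<U>. \<kappa> x = j}" by auto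
      ultimately show "\<kappa> -` {j} \<inter> space \<U> \<in> sets \<U>" using cell_sets by simp
    qed (use \<kappa>J in auto)
    show "AE x in \<U>. lab (\<kappa> x) = q x"
      using ae
    proof eventually_elim
      case (elim x)
      then obtain j where j: "j \<in> J" "x \<in> K j" by auto
      then have "x \<in> Q (lab j)" using K(2) by blast
      then show ?case using \<kappa>_eq[OF j] by (simp add: Q_def)
    qed
    fix j assume j: "j \<in> J"
    have "measure \<U> {x \<in> space \<U>. \<kappa> x = j} = measure \<U> (K j)"
      using ae AE_space cell_sets[OF j] K(1)[OF j]
    proof (intro measure_eq_AE)
      show "AE x in \<U>. (x \<in> {x \<in> space \<U>. \<kappa> x = j}) = (x \<in> K j)"
        using ae AE_space
      proof eventually_elim
        case (elim x)
        then obtain i where "i \<in> J" "x \<in> K i" by auto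
        with elim \<kappa>_eq[of i x] \<kappa>_eq[of j x] j show ?case by auto
      qed
    qed
    with K(3)[OF j] show "measure \<U> {x \<in> space \<U>. \<kappa> x = j} = \<omega> j" by simp
  qed
qed

section \<open>Partially mixing approximations\<close>

text \<open>The suspension of \<open>s\<close> under a tower of height \<open>m\<close>: climb one level at a time, and apply \<open>s\<close> on the
way from the top to the bottom.\<close>

definition tower_step :: "nat \<Rightarrow> ('a \<Rightarrow> 'a) \<Rightarrow> nat \<times> 'a \<Rightarrow> nat \<times> 'a" where
  "tower_step m s p = (if Suc (fst p) < m then (Suc (fst p), snd p) else (0, s (snd p)))"

lemma tower_step_climb: "i + n < m \<Longrightarrow> (tower_step m s ^^ n) (i, z) = (i + n, z)"
  by (induction n) (auto simp: tower_step_def)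

lemma tower_step_return:
  assumes "i < m" shows "(tower_step m s ^^ m) (i, z) = (i, s z)"
proof -
  have "m = i + Suc (m - Suc i)" using assms by simp
  then have "(tower_step m s ^^ m) (i, z)
      = (tower_step m s ^^ i) (tower_step m s ((tower_step m s ^^ (m - Suc i)) (i, z)))"
    by (metis comp_apply funpow.simps(2) funpow_add)
  also have "\<dots> = (tower_step m s ^^ i) (0, s z)"
  proof -
    have "(tower_step m s ^^ (m - Suc i)) (i, z) = (m - 1, z)"
      using assms by (subst tower_step_climb) auto
    then show ?thesis using assms by (simp add: tower_step_def)
  qed
  also have "\<dots> = (i, s z)" using tower_step_climb[of 0 i m s "s z"] assms by simp
  finally show ?thesis .
qed

lemma bij_betw_tower_step:
  assumes fin: "finite Z" and s: "bij_betw s Z Z" and m: "1 \<le> m"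
  shows "bij_betw (tower_step m s) ({..<m} \<times> Z) ({..<m} \<times> Z)"
proof -
  have "tower_step m s ` ({..<m} \<times> Z) \<subseteq> {..<m} \<times> Z"
    using s m by (auto simp: tower_step_def bij_betw_def)
  moreover have "inj_on (tower_step m s) ({..<m} \<times> Z)"
    using s by (auto simp: inj_on_def tower_step_def bij_betw_def split: if_splits)
  ultimately show ?thesis
    using fin by (simp add: bij_betw_def endo_inj_surj)
qed

definition swap_if :: "'a \<times> 'a \<times> bool \<Rightarrow> 'a \<times> 'a \<times> bool" where
  "swap_if z = (case z of (w, w', c) \<Rightarrow> if c then (w', w, c) else (w, w', c))"

lemma bij_betw_swap_if: "bij_betw swap_if (W \<times> W \<times> UNIV) (W \<times> W \<times> UNIV)"
  by (rule bij_betw_byWitness[where f'=swap_if]) (auto simp: swap_if_def split: if_splits)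

lemma measurable_membership_pattern:
  assumes "finite I" "\<And>i. i \<in> I \<Longrightarrow> {x \<in> space M. P i x} \<in> sets M"
  shows "(\<lambda>x. {i \<in> I. P i x}) \<in> M \<rightarrow>\<^sub>M count_space (Pow I)"
proof -
  have "finite (Pow I)" using assms by simp
  then show ?thesis
    unfolding measurable_count_space_eq2[OF \<open>finite (Pow I)\<close>]
  proof (intro conjI ballI)
    fix a assume "a \<in> Pow I"
    then have a: "a \<subseteq> I" by simp
    have "{x \<in> space M. \<forall>i\<in>I. P i x \<longleftrightarrow> i \<in> a} \<in> sets M"
    proof (rule sets.sets_Collect_finite_All[OF _ assms(1)])
      fix i assume "i \<in> I"
      have "{x \<in> space M. P i x} \<in> sets M" by (rule assms(2)[OF \<open>i \<in> I\<close>])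
      moreover have "{x \<in> space M. P i x \<longleftrightarrow> i \<in> a}
          = (if i \<in> a then {x \<in> space M. P i x} else space M - {x \<in> space M. P i x})" by auto
      ultimately show "{x \<in> space M. P i x \<longleftrightarrow> i \<in> a} \<in> sets M" by auto
    qed
    moreover have "(\<lambda>x. {i \<in> I. P i x}) -` {a} \<inter> space M = {x \<in> space M. \<forall>i\<in>I. P i x \<longleftrightarrow> i \<in> a}"
      using a by auto
    ultimately show "(\<lambda>x. {i \<in> I. P i x}) -` {a} \<inter> space M \<in> sets M" by simp
  qed auto
qed

lemma AE_label_funpow:
  assumes T: "T \<in> \<U> \<rightarrow>\<^sub>M \<U>" "distr \<U> \<U> T = \<U>" and ae: "AE x in \<U>. \<kappa> (T x) = \<sigma> (\<kappa> x)"
  shows "AE x in \<U>. \<kappa> ((T ^^ n) x) = (\<sigma> ^^ n) (\<kappa> x)"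
proof (induction n)
  case (Suc n)
  from AE_measure_preserving[OF T Suc] ae show ?case
    by eventually_elim (simp add: funpow_swap1)
qed simp

text \<open>The construction described at the beginning, with points \<open>x\<close> and \<open>y\<close> replaced by their words: the
word of \<open>x\<close> records in which sets of \<open>\<G>\<close> the points \<open>x, T\<^sub>0 x, \<dots>, T\<^sub>0\<^sup>m\<^sup>-\<^sup>1 x\<close> lie. Here \<open>\<G>\<close> contains,
besides \<open>\<A>\<close>, the preimages and the images of its members under \<open>T\<^sub>0\<close>, so that the letter at a time
determines how the points before and after it are situated with respect to \<open>\<A>\<close>. The exceptional sets
\<open>N\<close> and \<open>N'\<close> are the top level and the bottom level of the tower.\<close>

lemma partial_mixing_approximation:
  assumes T0: "T0 \<in> mp_automorphisms \<U>" and \<A>: "finite \<A>" "\<A> \<subseteq> sets \<U>"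
    and m: "1 \<le> m" and l: "0 \<le> l" "l \<le> 1"
  obtains T N N' where "T \<in> mp_automorphisms \<U>"
    "\<And>A B. A \<in> \<A> \<Longrightarrow> B \<in> \<A> \<Longrightarrow>
       correlation A B m T = (1 - l) * measure \<U> (A \<inter> B) + l * (measure \<U> A * measure \<U> B)"
    "N \<in> sets \<U>" "measure \<U> N = 1 / m" "AE x in \<U>. x \<notin> N \<longrightarrow> (\<forall>A\<in>\<A>. T x \<in> A \<longleftrightarrow> T0 x \<in> A)"
    "N' \<in> sets \<U>" "measure \<U> N' = 1 / m" "AE x in \<U>. x \<notin> N' \<longrightarrow> (\<forall>A\<in>\<A>. inv01 T x \<in> A \<longleftrightarrow> inv01 T0 x \<in> A)"
proof -
  note T0' = mp_automorphismD[OF T0]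
  have T0n: "T0 ^^ i \<in> mp_automorphisms \<U>" for i by (rule mp_automorphism_funpow[OF T0])
  note T0n' = mp_automorphismD[OF T0n]
  define pre where "pre A = T0 -` A \<inter> {0..1}" for A
  define post where "post A = inv01 T0 -` A \<inter> {0..1}" for A
  define \<G> where "\<G> = \<A> \<union> pre ` \<A> \<union> post ` \<A>"
  have fin\<G>: "finite \<G>" using \<A> by (simp add: \<G>_def)
  have \<G>: "G \<in> sets \<U>" if "G \<in> \<G>" for G
    using that \<A> measurable_sets[OF T0'(1)] measurable_sets[OF T0'(2)]
    by (auto simp: \<G>_def pre_def post_def)
  define q where "q x = {G \<in> \<G>. x \<in> G}" for x :: real
  have q: "q \<in> \<U> \<rightarrow>\<^sub>M count_space (Pow \<G>)"
    unfolding q_def[abs_def]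
  proof (rule measurable_membership_pattern[OF fin\<G>])
    fix G assume "G \<in> \<G>"
    then have G: "G \<in> sets \<U>" by (rule \<G>)
    have "{x \<in> space \<U>. x \<in> G} = G" using sets.sets_into_space[OF G] by auto
    with G show "{x \<in> space \<U>. x \<in> G} \<in> sets \<U>" by simp
  qed
  define I where "I = {..<m} \<times> \<G>"
  define word where "word x = {p \<in> I. (T0 ^^ fst p) x \<in> snd p}" for x
  have finI: "finite I" using fin\<G> by (simp add: I_def)
  have word: "word \<in> \<U> \<rightarrow>\<^sub>M count_space (Pow I)"
    unfolding word_def[abs_def]
  proof (rule measurable_membership_pattern[OF finI])
    fix p assume "p \<in> I"
    then have "snd p \<in> sets \<U>" using \<G> by (auto simp: I_def)
    from measurable_sets[OF T0n'(1) this, of "fst p"]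
    show "{x \<in> space \<U>. (T0 ^^ fst p) x \<in> snd p} \<in> sets \<U>" by (simp add: vimage_def Int_def conj_commute)
  qed
  define lett where "lett i w = {G. (i, G) \<in> w}" for i and w :: "(nat \<times> real set) set"
  have lett_word: "lett i (word x) = q ((T0 ^^ i) x)" if "i < m" for i x
    using that by (auto simp: lett_def word_def q_def I_def)
  define Wd where "Wd = word ` {0..1}"
  have Wd: "word \<in> \<U> \<rightarrow>\<^sub>M count_space Wd" and finW: "finite Wd"
  proof -
    have sub: "Wd \<subseteq> Pow I" by (auto simp: Wd_def word_def)
    then show fin: "finite Wd" using finI by (meson finite_Pow_iff finite_subset)
    show "word \<in> \<U> \<rightarrow>\<^sub>M count_space Wd"
      unfolding measurable_count_space_eq2[OF fin]
    proof (intro conjI ballI)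
      fix a assume "a \<in> Wd"
      then show "word -` {a} \<inter> space \<U> \<in> sets \<U>"
        using word sub by (intro measurable_sets[OF word]) auto
    qed (auto simp: Wd_def)
  qed
  define p where "p w = measure \<U> {x \<in> space \<U>. word x = w}" for w
  have p0: "0 \<le> p w" for w by (simp add: p_def)
  have psum: "(\<Sum>w\<in>Wd. of_bool (R w) * p w) = measure \<U> {x \<in> space \<U>. R (word x)}" for R
    unfolding p_def by (rule measure_labels[OF Wd finW, symmetric])
  have p1: "sum p Wd = 1" using psum[of "\<lambda>_. True"] unit.prob_space by (simp del: space_unit)
  \<comment> \<open>The letter at each time has the distribution of the label itself, as \<open>T\<^sub>0\<close> preserves the measure.\<close>
  have letter: "(\<Sum>w\<in>Wd. of_bool (R (lett i w)) * p w) = measure \<U> {x \<in> space \<U>. R (q x)}" if i: "i < m" for R i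
  proof -
    have "{x \<in> space \<U>. R (q x)} \<in> sets \<U>"
    proof -
      have "q -` {a \<in> Pow \<G>. R a} \<inter> space \<U> \<in> sets \<U>" using q by (rule measurable_sets) auto
      moreover have "q -` {a \<in> Pow \<G>. R a} \<inter> space \<U> = {x \<in> space \<U>. R (q x)}" by (auto simp: q_def)
      ultimately show ?thesis by simp
    qed
    note * = measure_measure_preserving[OF T0n'(1,3) this, of i]
    have "(T0 ^^ i) -` {x \<in> space \<U>. R (q x)} \<inter> space \<U> = {x \<in> space \<U>. R (lett i (word x))}"
      using lett_word[OF i] T0n'(6)[of _ i] by auto
    with * show ?thesis by (simp only: psum[of "\<lambda>w. R (lett i w)"])
  qed
  define Z where "Z = Wd \<times> Wd \<times> (UNIV :: bool set)"
  define J where "J = {..<m} \<times> Z"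
  define lab where "lab j = lett (fst j) (fst (snd j))"
    for j :: "nat \<times> (nat \<times> real set) set \<times> (nat \<times> real set) set \<times> bool"
  define \<omega> where "\<omega> j = (case j of (i, w, w', c) \<Rightarrow> p w * p w' * (if c then l else 1 - l) / m)"
    for j :: "nat \<times> (nat \<times> real set) set \<times> (nat \<times> real set) set \<times> bool"
  define \<sigma> where "\<sigma> = tower_step m (swap_if :: (nat \<times> real set) set \<times> (nat \<times> real set) set \<times> bool \<Rightarrow> _)"
  have finJ: "finite J" and finZ: "finite Z" using finW by (auto simp: J_def Z_def)
  have weight_sum: "(\<Sum>j\<in>J. F j * \<omega> j) =
      (\<Sum>i<m. (1 - l) * (\<Sum>w\<in>Wd. \<Sum>w'\<in>Wd. F (i, w, w', False) * (p w * p w'))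
         + l * (\<Sum>w\<in>Wd. \<Sum>w'\<in>Wd. F (i, w, w', True) * (p w * p w'))) / m" for F
  proof -
    have "(\<Sum>j\<in>J. F j * \<omega> j) = (\<Sum>i<m. \<Sum>w\<in>Wd. \<Sum>w'\<in>Wd. \<Sum>c\<in>UNIV. F (i, w, w', c) * \<omega> (i, w, w', c))"
      by (simp add: J_def Z_def sum.cartesian_product case_prod_unfold)
    also have "\<dots> = (\<Sum>i<m. \<Sum>w\<in>Wd. \<Sum>w'\<in>Wd.
        ((1 - l) * (F (i, w, w', False) * (p w * p w')) + l * (F (i, w, w', True) * (p w * p w'))) / m)"
      by (intro sum.cong refl) (simp add: UNIV_bool \<omega>_def add_divide_distrib mult_ac)
    also have "\<dots> = (\<Sum>i<m. (1 - l) * (\<Sum>w\<in>Wd. \<Sum>w'\<in>Wd. F (i, w, w', False) * (p w * p w'))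
         + l * (\<Sum>w\<in>Wd. \<Sum>w'\<in>Wd. F (i, w, w', True) * (p w * p w'))) / m"
      by (simp add: sum_divide_distrib[symmetric] sum.distrib sum_distrib_left)
    finally show ?thesis .
  qed
  \<comment> \<open>The two words are drawn independently.\<close>
  have sum2: "(\<Sum>w\<in>Wd. \<Sum>w'\<in>Wd. of_bool (R w) * of_bool (S w') * (p w * p w'))
      = (\<Sum>w\<in>Wd. of_bool (R w) * p w) * (\<Sum>w\<in>Wd. of_bool (S w) * p w)" for R S
    by (simp add: sum_product mult_ac)
  have sum1: "(\<Sum>w\<in>Wd. \<Sum>w'\<in>Wd. of_bool (R w) * (p w * p w')) = (\<Sum>w\<in>Wd. of_bool (R w) * p w)" for R
    using sum2[of R "\<lambda>_. True"] p1 by simp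
  have lab: "lab j \<in> Pow \<G>" if "j \<in> J" for j
    using that by (auto simp: J_def Z_def lab_def Wd_def lett_def word_def I_def)
  have \<omega>0: "0 \<le> \<omega> j" for j using l p0 by (auto simp: \<omega>_def split: prod.splits)
  have total: "(\<Sum>j | j \<in> J \<and> lab j = a. \<omega> j) = measure \<U> {x \<in> space \<U>. q x = a}" for a
  proof -
    have "(\<Sum>j | j \<in> J \<and> lab j = a. \<omega> j) = (\<Sum>j\<in>J. of_bool (lab j = a) * \<omega> j)"
      using finJ by (simp add: sum.inter_filter of_bool_def if_distrib[of "\<lambda>x. x * _"] cong: if_cong)
    also have "\<dots> = (\<Sum>i<m. measure \<U> {x \<in> space \<U>. q x = a}) / m"
      unfolding weight_sum lab_def fst_conv snd_conv sum1
    proof (intro arg_cong[where f="\<lambda>x. x / m"] sum.cong refl)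
      fix i assume "i \<in> {..<m}"
      then have "(\<Sum>w\<in>Wd. of_bool (lett i w = a) * p w) = measure \<U> {x \<in> space \<U>. q x = a}"
        by (intro letter) simp
      then show "(1 - l) * (\<Sum>w\<in>Wd. of_bool (lett i w = a) * p w) + l * (\<Sum>w\<in>Wd. of_bool (lett i w = a) * p w)
          = measure \<U> {x \<in> space \<U>. q x = a}"
        by (simp only:) (simp add: algebra_simps)
    qed
    also have "\<dots> = measure \<U> {x \<in> space \<U>. q x = a}" using m by simp
    finally show ?thesis .
  qed
  have finPow: "finite (Pow \<G>)" using fin\<G> by simp
  obtain \<kappa> where \<kappa>: "\<kappa> \<in> \<U> \<rightarrow>\<^sub>M count_space J" and \<kappa>q: "AE x in \<U>. lab (\<kappa> x) = q x"
    and \<kappa>\<omega>: "\<And>j. j \<in> J \<Longrightarrow> measure \<U> {x \<in> space \<U>. \<kappa> x = j} = \<omega> j"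
    by (rule refine_labelling[OF q finPow finJ lab \<omega>0 total]) (assumption, rule that)
  have \<sigma>: "bij_betw \<sigma> J J"
    unfolding \<sigma>_def J_def using finZ m bij_betw_swap_if
    by (intro bij_betw_tower_step) (auto simp: Z_def)
  have \<omega>\<sigma>: "\<omega> (\<sigma> j) = \<omega> j" for j
    by (cases j) (auto simp: \<omega>_def \<sigma>_def tower_step_def swap_if_def)
  have eq: "measure \<U> {x \<in> space \<U>. \<kappa> x = \<sigma> j} = measure \<U> {x \<in> space \<U>. \<kappa> x = j}" if "j \<in> J" for j
  proof -
    have "\<sigma> j \<in> J" using \<sigma> that by (auto simp: bij_betw_def)
    then show ?thesis using \<kappa>\<omega> that \<omega>\<sigma> by simp
  qed
  obtain T where T: "T \<in> mp_automorphisms \<U>" and T\<kappa>: "AE x in \<U>. \<kappa> (T x) = \<sigma> (\<kappa> x)"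
    by (rule automorphism_permuting_cells[OF \<kappa> finJ \<sigma> eq])
  note T' = mp_automorphismD[OF T]
  note Tm = mp_automorphismD[OF mp_automorphism_funpow[OF T, of m]]
  have \<kappa>J: "\<kappa> x \<in> J" if "x \<in> {0..1}" for x using measurable_space[OF \<kappa>] that by simp
  have label_measure: "measure \<U> {x \<in> space \<U>. R (\<kappa> x)} = (\<Sum>j\<in>J. of_bool (R j) * \<omega> j)" for R
    unfolding measure_labels[OF \<kappa> finJ] by (intro sum.cong refl) (simp only: \<kappa>\<omega>)
  have label_sets: "{x \<in> space \<U>. R (\<kappa> x)} \<in> sets \<U>" for R
  proof -
    have "\<kappa> -` {j \<in> J. R j} \<inter> space \<U> \<in> sets \<U>" using \<kappa> by (rule measurable_sets) auto
    moreover have "\<kappa> -` {j \<in> J. R j} \<inter> space \<U> = {x \<in> space \<U>. R (\<kappa> x)}" using \<kappa>J by auto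
    ultimately show ?thesis by simp
  qed
  have q_mem: "G \<in> q x \<longleftrightarrow> x \<in> G" if "G \<in> \<G>" for G x using that by (simp add: q_def)
  have \<A>\<G>: "A \<in> \<G>" "pre A \<in> \<G>" "post A \<in> \<G>" if "A \<in> \<A>" for A using that by (auto simp: \<G>_def)
  have J_cases: "\<exists>i w w' c y. j = (i, w, w', c) \<and> i < m \<and> w \<in> Wd \<and> w' \<in> Wd \<and> y \<in> {0..1} \<and> w = word y"
    if "j \<in> J" for j
    using that by (cases j) (auto simp: J_def Z_def Wd_def)
  show thesis
  proof (rule that[of T "{x \<in> space \<U>. fst (\<kappa> x) = m - 1}" "{x \<in> space \<U>. fst (\<kappa> x) = 0}"])
    show "T \<in> mp_automorphisms \<U>" by (rule T)
    show "{x \<in> space \<U>. fst (\<kappa> x) = m - 1} \<in> sets \<U>" "{x \<in> space \<U>. fst (\<kappa> x) = 0} \<in> sets \<U>"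
      by (rule label_sets)+
    have level: "measure \<U> {x \<in> space \<U>. fst (\<kappa> x) = k} = 1 / m" if "k < m" for k
    proof -
      have "measure \<U> {x \<in> space \<U>. fst (\<kappa> x) = k} = (\<Sum>i<m. of_bool (i = k)) / m"
        unfolding label_measure[of "\<lambda>j. fst j = k"] weight_sum fst_conv sum1[of "\<lambda>_. _ = _"]
        by (intro arg_cong[where f="\<lambda>x. x / m"] sum.cong refl) (simp add: p1 algebra_simps)
      also have "(\<Sum>i<m. of_bool (i = k) :: real) = 1" using that by (simp add: of_bool_def)
      finally show ?thesis .
    qed
    show "measure \<U> {x \<in> space \<U>. fst (\<kappa> x) = m - 1} = 1 / m" "measure \<U> {x \<in> space \<U>. fst (\<kappa> x) = 0} = 1 / m"
      using level m by auto
    have q\<kappa>T: "AE x in \<U>. lab (\<sigma> (\<kappa> x)) = q (T x)"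
      using AE_measure_preserving[OF T'(1,3) \<kappa>q] T\<kappa> by eventually_elim simp
    show "AE x in \<U>. x \<notin> {x \<in> space \<U>. fst (\<kappa> x) = m - 1} \<longrightarrow> (\<forall>A\<in>\<A>. T x \<in> A \<longleftrightarrow> T0 x \<in> A)"
      using \<kappa>q q\<kappa>T AE_space
    proof eventually_elim
      case (elim x)
      then have x: "x \<in> {0..1}" by simp
      obtain i w w' c y where j: "\<kappa> x = (i, w, w', c)" "i < m" and y: "y \<in> {0..1}" "w = word y"
        using J_cases[OF \<kappa>J[OF x]] by blast
      show ?case
      proof (intro impI ballI)
        fix A assume "x \<notin> {x \<in> space \<U>. fst (\<kappa> x) = m - 1}" and A: "A \<in> \<A>"
        then have i: "Suc i < m" using j x by auto
        have 1: "q x = q ((T0 ^^ i) y)" using elim(1) j y lett_word[OF j(2)] by (simp add: lab_def)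
        have 2: "q (T x) = q ((T0 ^^ Suc i) y)"
          using elim(2) j y lett_word[OF i] i by (simp add: lab_def \<sigma>_def tower_step_def)
        \<comment> \<open>The word \<open>w\<close> is realized by a point \<open>y\<close>; membership in \<open>pre A\<close> at time \<open>i\<close> is membership in \<open>A\<close> at time \<open>i + 1\<close>.\<close>
        have "T0 x \<in> A \<longleftrightarrow> pre A \<in> q x" using x \<A>\<G>[OF A] by (simp add: q_mem) (simp add: pre_def)
        also have "\<dots> \<longleftrightarrow> (T0 ^^ i) y \<in> pre A" unfolding 1 using \<A>\<G>[OF A] by (simp add: q_mem)
        also have "\<dots> \<longleftrightarrow> A \<in> q (T x)"
          unfolding 2 using \<A>\<G>[OF A] T0n'(6)[OF y(1), of i] by (simp add: q_mem) (simp add: pre_def)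
        also have "\<dots> \<longleftrightarrow> T x \<in> A" using \<A>\<G>[OF A] by (simp add: q_mem)
        finally show "T x \<in> A \<longleftrightarrow> T0 x \<in> A" by simp
      qed
    qed
    show "AE x in \<U>. x \<notin> {x \<in> space \<U>. fst (\<kappa> x) = 0} \<longrightarrow> (\<forall>A\<in>\<A>. inv01 T x \<in> A \<longleftrightarrow> inv01 T0 x \<in> A)"
      using \<kappa>q AE_measure_preserving[OF T'(2,4) \<kappa>q] AE_measure_preserving[OF T'(2,4) T\<kappa>] AE_space
    proof eventually_elim
      case (elim x)
      then have x: "x \<in> {0..1}" by simp
      define V where "V = inv01 T x"
      have V: "V \<in> {0..1}" "T V = x" using T'(7)[OF x] T'(9)[OF x] by (simp_all add: V_def)
      obtain i w w' c y where j: "\<kappa> V = (i, w, w', c)" "i < m" and y: "y \<in> {0..1}" "w = word y"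
        using J_cases[OF \<kappa>J[OF V(1)]] by blast
      have \<kappa>x: "\<kappa> x = \<sigma> (\<kappa> V)" using elim(3) V by (simp add: V_def)
      show ?case
      proof (intro impI ballI)
        fix A assume "x \<notin> {x \<in> space \<U>. fst (\<kappa> x) = 0}" and A: "A \<in> \<A>"
        then have "fst (\<kappa> x) \<noteq> 0" using x by simp
        then have i: "Suc i < m" unfolding \<kappa>x by (auto simp: j \<sigma>_def tower_step_def split: if_splits)
        have 1: "q V = q ((T0 ^^ i) y)" using elim(2) j y lett_word[OF j(2)] by (simp add: lab_def V_def)
        have 2: "q x = q ((T0 ^^ Suc i) y)"
          using elim(1) \<kappa>x j y lett_word[OF i] i by (simp add: lab_def \<sigma>_def tower_step_def)
        have "inv01 T0 x \<in> A \<longleftrightarrow> post A \<in> q x" using x \<A>\<G>[OF A] by (simp add: q_mem) (simp add: post_def)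
        also have "\<dots> \<longleftrightarrow> (T0 ^^ Suc i) y \<in> post A" unfolding 2 using \<A>\<G>[OF A] by (simp only: q_mem)
        also have "\<dots> \<longleftrightarrow> A \<in> q V"
          unfolding 1 using \<A>\<G>[OF A] T0'(8)[OF T0n'(6)[OF y(1), of i]] T0n'(6)[OF y(1), of "Suc i"]
          by (simp add: q_mem) (simp add: post_def)
        also have "\<dots> \<longleftrightarrow> V \<in> A" using \<A>\<G>[OF A] by (simp add: q_mem)
        finally show "inv01 T x \<in> A \<longleftrightarrow> inv01 T0 x \<in> A" by (simp add: V_def)
      qed
    qed
    fix A B assume A: "A \<in> \<A>" and B: "B \<in> \<A>"
    have AB: "A \<in> sets \<U>" "B \<in> sets \<U>" using A B \<A> by auto
    have ae: "AE x in \<U>. (x \<in> A \<inter> ((T ^^ m) -` B \<inter> space \<U>))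
        = (x \<in> {x \<in> space \<U>. A \<in> lab (\<kappa> x) \<and> B \<in> lab ((\<sigma> ^^ m) (\<kappa> x))})"
      using \<kappa>q AE_label_funpow[OF T'(1,3) T\<kappa>, of m] AE_measure_preserving[OF Tm(1,3) \<kappa>q] AE_space
    proof eventually_elim
      case (elim x)
      then have "x \<in> A \<longleftrightarrow> A \<in> lab (\<kappa> x)" "(T ^^ m) x \<in> B \<longleftrightarrow> B \<in> lab ((\<sigma> ^^ m) (\<kappa> x))"
        using \<A>\<G>(1)[OF A] \<A>\<G>(1)[OF B] by (auto simp: q_mem)
      with elim(4) show ?case by auto
    qed
    have "correlation A B m T = measure \<U> {x \<in> space \<U>. A \<in> lab (\<kappa> x) \<and> B \<in> lab ((\<sigma> ^^ m) (\<kappa> x))}"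
      using ae label_sets[of "\<lambda>j. A \<in> lab j \<and> B \<in> lab ((\<sigma> ^^ m) j)"] AB measurable_sets[OF Tm(1) AB(2)]
      by (intro measure_eq_AE) auto
    also have "\<dots> = (\<Sum>j\<in>J. of_bool (A \<in> lab j \<and> B \<in> lab ((\<sigma> ^^ m) j)) * \<omega> j)"
      by (rule label_measure)
    also have "\<dots> = (\<Sum>i<m. (1 - l) * measure \<U> (A \<inter> B) + l * (measure \<U> A * measure \<U> B)) / m"
      unfolding weight_sum
    proof (intro arg_cong[where f="\<lambda>x. x / m"] sum.cong refl)
      fix i assume "i \<in> {..<m}"
      then have i: "i < m" by simp
      have ret: "lab ((\<sigma> ^^ m) (i, w, w', c)) = lett i (if c then w' else w)" for w w' c
        unfolding \<sigma>_def tower_step_return[OF i] by (simp add: lab_def swap_if_def)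
      have l1: "lab (i, w, w', c) = lett i w" for w w' c by (simp add: lab_def)
      have sA: "{x \<in> space \<U>. A \<in> q x} = A" "{x \<in> space \<U>. B \<in> q x} = B"
        "{x \<in> space \<U>. A \<in> q x \<and> B \<in> q x} = A \<inter> B"
        using \<A>\<G>(1)[OF A] \<A>\<G>(1)[OF B] sets.sets_into_space[OF AB(1)] sets.sets_into_space[OF AB(2)]
        by (auto simp: q_mem)
      have "(\<Sum>w\<in>Wd. \<Sum>w'\<in>Wd. of_bool (A \<in> lab (i, w, w', False) \<and> B \<in> lab ((\<sigma> ^^ m) (i, w, w', False))) * (p w * p w'))
          = measure \<U> (A \<inter> B)"
        using sum1[of "\<lambda>w. A \<in> lett i w \<and> B \<in> lett i w"] letter[OF i, of "\<lambda>a. A \<in> a \<and> B \<in> a", unfolded sA]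
        by (simp add: ret l1)
      moreover have "(\<Sum>w\<in>Wd. \<Sum>w'\<in>Wd. of_bool (A \<in> lab (i, w, w', True) \<and> B \<in> lab ((\<sigma> ^^ m) (i, w, w', True))) * (p w * p w'))
          = measure \<U> A * measure \<U> B"
        using sum2[of "\<lambda>w. A \<in> lett i w" "\<lambda>w. B \<in> lett i w"] letter[OF i, of "\<lambda>a. A \<in> a", unfolded sA] letter[OF i, of "\<lambda>a. B \<in> a", unfolded sA]
        by (simp add: ret l1 of_bool_conj)
      ultimately show "(1 - l) * (\<Sum>w\<in>Wd. \<Sum>w'\<in>Wd. of_bool (A \<in> lab (i, w, w', False) \<and> B \<in> lab ((\<sigma> ^^ m) (i, w, w', False))) * (p w * p w'))
          + l * (\<Sum>w\<in>Wd. \<Sum>w'\<in>Wd. of_bool (A \<in> lab (i, w, w', True) \<and> B \<in> lab ((\<sigma> ^^ m) (i, w, w', True))) * (p w * p w'))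
          = (1 - l) * measure \<U> (A \<inter> B) + l * (measure \<U> A * measure \<U> B)" by simp
    qed
    also have "\<dots> = (1 - l) * measure \<U> (A \<inter> B) + l * (measure \<U> A * measure \<U> B)"
      using m by simp
    finally show "correlation A B m T = (1 - l) * measure \<U> (A \<inter> B) + l * (measure \<U> A * measure \<U> B)" .
  qed
qed

section \<open>Density of the approximate conditions\<close>

lemma l1_dist_le:
  assumes ST: "S \<in> \<U> \<rightarrow>\<^sub>M \<U>" "T \<in> \<U> \<rightarrow>\<^sub>M \<U>" and N: "N \<in> sets \<U>"
    and c: "0 \<le> c" and le: "AE x in \<U>. x \<notin> N \<longrightarrow> \<bar>S x - T x\<bar> \<le> c"
  shows "l1_dist S T \<le> c + measure \<U> N"
proof -
  have iN: "integrable \<U> (\<lambda>x. indicat_real N x)"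
    using N by (intro integrable_unit_bounded[where B=1]) (auto simp: indicator_def)
  have "l1_dist S T \<le> (\<integral>x. c + indicator N x \<partial>\<U>)"
    unfolding l1_dist_def
  proof (rule integral_mono_AE)
    show "AE x in \<U>. \<bar>S x - T x\<bar> \<le> c + indicator N x"
      using le AE_space
    proof eventually_elim
      case (elim x)
      then have "S x \<in> {0..1}" "T x \<in> {0..1}"
        using measurable_space[OF ST(1), of x] measurable_space[OF ST(2), of x] by auto
      with elim c show ?case by (auto simp: indicator_def)
    qed
  qed (use iN in \<open>auto intro: integrable_l1_dist ST\<close>)
  also have "\<dots> = c + measure \<U> N"
  proof -
    have "(\<integral>x. indicat_real N x \<partial>\<U>) = measure \<U> N"
      using N sets.sets_into_space[OF N] by (simp add: Int_absorb2)
    then show ?thesis using iN unit.prob_space by (simp del: space_unit)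
  qed
  finally show ?thesis .
qed

lemma close_if_same_grid_rays:
  fixes s t :: real
  assumes st: "s \<in> {0..1}" "t \<in> {0..1}" and n: "1 \<le> n"
    and grid: "\<And>j :: nat. j \<le> n \<Longrightarrow> s \<le> real j / real n \<longleftrightarrow> t \<le> real j / real n"
  shows "\<bar>s - t\<bar> \<le> 1 / real n"
proof -
  have *: "t \<le> s + 1 / n" if s: "s \<in> {0..1}" and g: "\<And>j :: nat. j \<le> n \<Longrightarrow> s \<le> real j / real n \<longleftrightarrow> t \<le> real j / real n" for s t :: real
  proof -
    define j where "j = nat \<lceil>s * n\<rceil>"
    have sn: "0 \<le> s * n" "s * n \<le> n" using s n by (auto simp: mult_left_le_one_le)
    then have "j \<le> n" unfolding j_def by (simp add: ceiling_le_iff nat_le_iff)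
    moreover have j: "s * n \<le> j" "j < s * n + 1" using sn unfolding j_def by linarith+
    then have "s \<le> j / n" using n by (simp add: field_simps)
    ultimately have "t \<le> j / n" using g by simp
    also have "j / n \<le> s + 1 / n" using j n by (simp add: field_simps)
    finally show ?thesis .
  qed
  from *[OF st(1) grid] *[of t s] st(2) grid show ?thesis by (auto simp: abs_le_iff)
qed

definition ray :: "nat \<Rightarrow> real set" where
  "ray i = {..rational i} \<inter> {0..1}"

lemma ray_sets: "ray i \<in> sets \<U>"
  by (auto simp: ray_def sets_unit_iff)

definition mixing_limit :: "real \<Rightarrow> real set \<Rightarrow> real set \<Rightarrow> real" where
  "mixing_limit l A B = (1 - l) * measure \<U> (A \<inter> B) + l * (measure \<U> A * measure \<U> B)"

definition nearly_mixing :: "real \<Rightarrow> nat \<Rightarrow> nat \<Rightarrow> (real \<Rightarrow> real) \<Rightarrow> bool" where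
  "nearly_mixing l N n T \<longleftrightarrow>
     (\<forall>a\<le>N. \<forall>b\<le>N. \<bar>correlation (ray a) (ray b) n T - mixing_limit l (ray a) (ray b)\<bar> < 1 / Suc N)"

lemma nearly_mixing_antimono:
  assumes "nearly_mixing l N n T" "N' \<le> N"
  shows "nearly_mixing l N' n T"
proof -
  have "1 / real (Suc N) \<le> 1 / real (Suc N')" using assms(2) by (simp add: frac_le)
  with assms show ?thesis unfolding nearly_mixing_def by (meson le_trans less_le_trans)
qed

text \<open>The sets \<open>[0, j / (n + 1)]\<close> are added to the family so that agreement of \<open>T\<close> and \<open>T\<^sub>0\<close> on it means that
their values are close.\<close>

lemma nearly_mixing_dense:
  assumes T0: "T0 \<in> mp_automorphisms \<U>" and e: "0 < e" and m: "strict_mono m" and l: "0 \<le> l" "l \<le> 1"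
  shows "\<exists>T\<in>mp_automorphisms \<U>. (\<exists>k\<ge>N. nearly_mixing l N (m k) T) \<and> aut_dist T T0 < e"
proof -
  obtain n where n: "1 / real (Suc n) < e / 4" using e by (metis nat_approx_posE zero_less_divide_iff zero_less_numeral)
  \<comment> \<open>This makes \<open>m k \<ge> n + 1\<close>, so that the exceptional sets have measure at most \<open>1 / (n + 1)\<close>.\<close>
  define k where "k = max N (Suc n)"
  have mk: "Suc n \<le> m k" "1 \<le> m k" using strict_mono_imp_increasing[OF m, of k] by (auto simp: k_def)
  define \<A> where "\<A> = ray ` {..N} \<union> (\<lambda>j. {..real j / Suc n} \<inter> {0..1}) ` {..Suc n}"
  have \<A>: "finite \<A>" "\<A> \<subseteq> sets \<U>"
    using ray_sets by (auto simp: \<A>_def sets_unit_iff)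
  obtain T X X' where T: "T \<in> mp_automorphisms \<U>"
    and mix: "\<And>A B. A \<in> \<A> \<Longrightarrow> B \<in> \<A> \<Longrightarrow>
       correlation A B (m k) T = (1 - l) * measure \<U> (A \<inter> B) + l * (measure \<U> A * measure \<U> B)"
    and X: "X \<in> sets \<U>" "measure \<U> X = 1 / m k" "AE x in \<U>. x \<notin> X \<longrightarrow> (\<forall>A\<in>\<A>. T x \<in> A \<longleftrightarrow> T0 x \<in> A)"
    and X': "X' \<in> sets \<U>" "measure \<U> X' = 1 / m k" "AE x in \<U>. x \<notin> X' \<longrightarrow> (\<forall>A\<in>\<A>. inv01 T x \<in> A \<longleftrightarrow> inv01 T0 x \<in> A)"
    by (rule partial_mixing_approximation[OF T0 \<A> mk(2) l]) (rule that)
  have "ray a \<in> \<A>" if "a \<le> N" for a using that by (auto simp: \<A>_def)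
  then have "nearly_mixing l N (m k) T"
    using mix by (auto simp: nearly_mixing_def mixing_limit_def)
  moreover have close: "l1_dist F G \<le> 1 / Suc n + 1 / m k"
    if F: "F \<in> mp_automorphisms \<U>" "G \<in> mp_automorphisms \<U>" and Y: "Y \<in> sets \<U>" "measure \<U> Y = 1 / m k"
      and ae: "AE x in \<U>. x \<notin> Y \<longrightarrow> (\<forall>A\<in>\<A>. F x \<in> A \<longleftrightarrow> G x \<in> A)" for F G Y
  proof -
    have "AE x in \<U>. x \<notin> Y \<longrightarrow> \<bar>F x - G x\<bar> \<le> 1 / Suc n"
      using ae AE_space
    proof eventually_elim
      case (elim x)
      show ?case
      proof
        assume "x \<notin> Y"
        have FG: "F x \<in> {0..1}" "G x \<in> {0..1}"
          using mp_automorphismD(6)[OF F(1), of x] mp_automorphismD(6)[OF F(2), of x] elim by auto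
        show "\<bar>F x - G x\<bar> \<le> 1 / Suc n"
        proof (rule close_if_same_grid_rays[OF FG])
          fix j assume "j \<le> Suc n"
          then have mem: "{..real j / Suc n} \<inter> {0..1} \<in> \<A>" unfolding \<A>_def by blast
          have "\<forall>A\<in>\<A>. F x \<in> A \<longleftrightarrow> G x \<in> A" using elim(1) \<open>x \<notin> Y\<close> by simp
          from bspec[OF this mem]
          have "F x \<in> {..real j / Suc n} \<inter> {0..1} \<longleftrightarrow> G x \<in> {..real j / Suc n} \<inter> {0..1}" .
          with FG show "F x \<le> real j / Suc n \<longleftrightarrow> G x \<le> real j / Suc n" by auto
        qed simp
      qed
    qed
    from l1_dist_le[OF mp_automorphismD(1)[OF F(1)] mp_automorphismD(1)[OF F(2)] Y(1) _ this] Y(2)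
    show ?thesis by simp
  qed
  have "1 / real (m k) \<le> 1 / Suc n" using mk by (simp add: frac_le)
  with close[OF T T0 X] close[OF mp_automorphism_inv(1)[OF T] mp_automorphism_inv(1)[OF T0] X'] n
  have "aut_dist T T0 < e" unfolding aut_dist_def by linarith
  moreover have "N \<le> k" by (simp add: k_def)
  ultimately show ?thesis using T by blast
qed

section \<open>Reduction to countably many open conditions\<close>

lemma sets_borel_rational_rays: "sets (borel :: real measure) = sigma_sets UNIV (range (\<lambda>i. {..rational i}))"
proof
  have "range (atMost :: real \<Rightarrow> real set) \<subseteq> sigma_sets UNIV (range (\<lambda>i. {..rational i}))"
  proof
    fix X :: "real set" assume "X \<in> range atMost"
    then obtain t where X: "X = {..t}" by auto
    have "{..t} = (\<Inter>i. if t < rational i then {..rational i} else UNIV)"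
    proof (intro set_eqI iffI)
      fix x assume x: "x \<in> (\<Inter>i. if t < rational i then {..rational i} else UNIV)"
      show "x \<in> {..t}"
      proof (rule ccontr)
        assume "x \<notin> {..t}"
        then obtain r where "r \<in> \<rat>" "t < r" "r < x" using Rats_dense_in_real[of t x] by auto
        then obtain i where "rational i = r" using bij_rational by (metis bij_betw_iff_bijections)
        with INT_D[OF x UNIV_I, of i] \<open>t < r\<close> \<open>r < x\<close> show False by simp
      qed
    qed (auto split: if_splits)
    also have "\<dots> \<in> sigma_sets UNIV (range (\<lambda>i. {..rational i}))"
      by (rule sigma_sets_Inter) (auto intro: sigma_sets_top)
    finally show "X \<in> sigma_sets UNIV (range (\<lambda>i. {..rational i}))" by (simp add: X)
  qed
  then show "sets (borel :: real measure) \<subseteq> sigma_sets UNIV (range (\<lambda>i. {..rational i}))"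
    by (simp add: borel_eq_atMost sigma_sets_mono)
  show "sigma_sets UNIV (range (\<lambda>i. {..rational i})) \<subseteq> sets (borel :: real measure)"
    using sets.sigma_sets_subset[of "range (\<lambda>i. {..rational i})" "borel :: real measure"] by force
qed

text \<open>Induction over the Borel sets. For countable disjoint unions, the domination by the Lebesgue
measure permits the exchange of limit and sum.\<close>

lemma dominated_additive_convergence:
  fixes c :: "nat \<Rightarrow> real set \<Rightarrow> real" and c' :: "real set \<Rightarrow> real"
  assumes add: "\<And>k B. (\<And>i. B i \<in> sets \<U>) \<Longrightarrow> disjoint_family B \<Longrightarrow> (\<lambda>i. c k (B i)) sums c k (\<Union>i. B i)"
    and add': "\<And>B. (\<And>i. B i \<in> sets \<U>) \<Longrightarrow> disjoint_family B \<Longrightarrow> (\<lambda>i. c' (B i)) sums c' (\<Union>i. B i)"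
    and compl: "\<And>k B. B \<in> sets \<U> \<Longrightarrow> c k ({0..1} - B) = c k {0..1} - c k B"
    and compl': "\<And>B. B \<in> sets \<U> \<Longrightarrow> c' ({0..1} - B) = c' {0..1} - c' B"
    and dom: "\<And>k B. B \<in> sets \<U> \<Longrightarrow> \<bar>c k B\<bar> \<le> measure \<U> B"
    and top: "(\<lambda>k. c k {0..1}) \<longlonglongrightarrow> c' {0..1}"
    and base: "\<And>i. (\<lambda>k. c k (ray i)) \<longlonglongrightarrow> c' (ray i)"
    and B: "B \<in> sets \<U>"
  shows "(\<lambda>k. c k B) \<longlonglongrightarrow> c' B"
proof -
  have clip: "X \<inter> {0..1} \<in> sets \<U>" if "X \<in> sigma_sets UNIV (range (\<lambda>i. {..rational i}))" for X
    using that unfolding sets_borel_rational_rays[symmetric] by (auto simp: sets_unit_iff)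
  have "Int_stable (range (\<lambda>i. {..rational i}))"
    unfolding Int_stable_def
  proof (intro ballI)
    fix X Y assume "X \<in> range (\<lambda>i. {..rational i})" "Y \<in> range (\<lambda>i. {..rational i})"
    then obtain i j where "X = {..rational i}" "Y = {..rational j}" by auto
    then have "X \<inter> Y = {..rational i} \<or> X \<inter> Y = {..rational j}" by auto
    then show "X \<inter> Y \<in> range (\<lambda>i. {..rational i})" by auto
  qed
  moreover have "range (\<lambda>i. {..rational i}) \<subseteq> Pow UNIV" by simp
  moreover have "B \<in> sigma_sets UNIV (range (\<lambda>i. {..rational i}))"
    using B unfolding sets_borel_rational_rays[symmetric] sets_unit_iff by simp
  ultimately have "(\<lambda>k. c k (B \<inter> {0..1})) \<longlonglongrightarrow> c' (B \<inter> {0..1})"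
  proof (induction rule: sigma_sets_induct_disjoint)
    case (basic X)
    then show ?case using base by (auto simp: ray_def)
  next
    case empty
    have U: "{0..1} \<in> sets \<U>" by (simp add: sets_unit_iff)
    show ?case using compl[OF U] compl'[OF U] by simp
  next
    case (compl X)
    have "(UNIV - X) \<inter> {0..1} = {0..1} - X \<inter> {0..1}" by auto
    then show ?case
      using tendsto_diff[OF top compl(2)] assms(3)[OF clip[OF compl(1)]] assms(4)[OF clip[OF compl(1)]]
      by simp
  next
    case (union X)
    define Y where "Y i = X i \<inter> {0..1}" for i
    have Y: "Y i \<in> sets \<U>" for i using clip union(2) by (auto simp: Y_def)
    have dY: "disjoint_family Y" using union(1) by (auto simp: Y_def disjoint_family_on_def)
    have UY: "(\<Union>i. X i) \<inter> {0..1} = (\<Union>i. Y i)" by (auto simp: Y_def)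
    have "summable (\<lambda>i. measure \<U> (Y i))"
      using unit.finite_measure_UNION[of Y] Y dY by (auto intro: sums_summable)
    moreover have "\<forall>\<^sub>F (i, k) in at_top \<times>\<^sub>F sequentially. norm (c k (Y i)) \<le> measure \<U> (Y i)"
      by (rule always_eventually) (auto simp: dom Y)
    ultimately have "(\<lambda>k. \<Sum>i. c k (Y i)) \<longlonglongrightarrow> (\<Sum>i. c' (Y i))"
      using tannerys_theorem[of "\<lambda>i k. c k (Y i)" "\<lambda>i. c' (Y i)" sequentially "\<lambda>i. measure \<U> (Y i)"]
        union(3) by (simp add: Y_def)
    then show ?case
      unfolding UY using sums_unique[OF add[OF Y dY]] sums_unique[OF add'[OF Y dY]] by simp
  qed
  moreover have "B \<inter> {0..1} = B" using B by (auto simp: sets_unit_iff)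
  ultimately show ?thesis by simp
qed

lemma mixing_limit_additive:
  assumes A: "A \<in> sets \<U>"
  shows "(\<And>i. B i \<in> sets \<U>) \<Longrightarrow> disjoint_family B \<Longrightarrow> (\<lambda>i. mixing_limit l A (B i)) sums mixing_limit l A (\<Union>i. B i)"
    "B' \<in> sets \<U> \<Longrightarrow> mixing_limit l A ({0..1} - B') = mixing_limit l A {0..1} - mixing_limit l A B'"
proof -
  assume B: "\<And>i. B i \<in> sets \<U>" "disjoint_family B"
  have "(\<lambda>i. measure \<U> (A \<inter> B i)) sums measure \<U> (\<Union>i. A \<inter> B i)"
    using A B by (intro unit.finite_measure_UNION) (auto simp: disjoint_family_on_def)
  moreover have "(\<lambda>i. measure \<U> (B i)) sums measure \<U> (\<Union>i. B i)"
    using B by (intro unit.finite_measure_UNION) auto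
  ultimately show "(\<lambda>i. mixing_limit l A (B i)) sums mixing_limit l A (\<Union>i. B i)"
    unfolding mixing_limit_def Int_UN_distrib by (intro sums_add sums_mult)
next
  assume B': "B' \<in> sets \<U>"
  have e1: "A \<inter> ({0..1} - B') = A - A \<inter> B'" and e2: "A \<inter> {0..1} = A" using A by (auto simp: sets_unit_iff)
  have e3: "measure \<U> (A - A \<inter> B') = measure \<U> A - measure \<U> (A \<inter> B')"
    using A B' by (intro unit.finite_measure_Diff) auto
  have e4: "measure \<U> ({0..1} - B') = measure \<U> {0..1} - measure \<U> B'"
    using unit.finite_measure_Diff[OF sets.top B'] B' by (simp add: sets_unit_iff)
  show "mixing_limit l A ({0..1} - B') = mixing_limit l A {0..1} - mixing_limit l A B'"
    unfolding mixing_limit_def e1 e2 e3 e4 by (simp add: algebra_simps)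
qed

lemma mixing_limit_commute: "mixing_limit l A B = mixing_limit l B A"
  by (simp add: mixing_limit_def Int_commute mult.commute)

lemma disjoint_family_vimage: "disjoint_family B \<Longrightarrow> disjoint_family (\<lambda>i. A \<inter> (f -` B i \<inter> S))"
  unfolding disjoint_family_on_def by blast

text \<open>The convergence is extended to all Borel sets in one argument at a time.\<close>

lemma correlation_limit_from_rays:
  assumes T: "T \<in> mp_automorphisms \<U>"
    and rays: "\<And>a b. (\<lambda>i. correlation (ray a) (ray b) (n i) T) \<longlonglongrightarrow> mixing_limit l (ray a) (ray b)"
    and A: "A \<in> sets \<U>" and B: "B \<in> sets \<U>"
  shows "(\<lambda>i. correlation A B (n i) T) \<longlonglongrightarrow> mixing_limit l A B"
proof -
  have U: "{0..1} \<in> sets \<U>" "measure \<U> {0..1} = 1"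
    using unit.prob_space by (auto simp: sets_unit_iff)
  note Tk = mp_automorphismD[OF mp_automorphism_funpow[OF T]]
  have pre: "(T ^^ k) -` B \<inter> space \<U> \<in> sets \<U>" "measure \<U> ((T ^^ k) -` B \<inter> space \<U>) = measure \<U> B"
    if "B \<in> sets \<U>" for k B
    using measurable_sets[OF Tk(1) that] measure_measure_preserving[OF Tk(1,3) that] by auto
  have limU: "mixing_limit l A {0..1} = measure \<U> A" if "A \<in> sets \<U>" for A
  proof -
    have "A \<inter> {0..1} = A" using that by (auto simp: sets_unit_iff)
    then show ?thesis using U by (simp add: mixing_limit_def algebra_simps)
  qed
  have preU: "(T ^^ k) -` {0..1} \<inter> space \<U> = {0..1}" for k using Tk(6) by auto
  have ray_B: "(\<lambda>i. correlation (ray a) B (n i) T) \<longlonglongrightarrow> mixing_limit l (ray a) B" if B: "B \<in> sets \<U>" for a B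
  proof (rule dominated_additive_convergence[OF _ mixing_limit_additive(1)[OF ray_sets] _ mixing_limit_additive(2)[OF ray_sets] _ _ rays B])
    fix k and B :: "nat \<Rightarrow> real set" assume B: "\<And>i. B i \<in> sets \<U>" "disjoint_family B"
    have "ray a \<inter> ((T ^^ n k) -` (\<Union>i. B i) \<inter> space \<U>) = (\<Union>i. ray a \<inter> ((T ^^ n k) -` B i \<inter> space \<U>))" by auto
    moreover have "(\<lambda>i. measure \<U> (ray a \<inter> ((T ^^ n k) -` B i \<inter> space \<U>)))
        sums measure \<U> (\<Union>i. ray a \<inter> ((T ^^ n k) -` B i \<inter> space \<U>))"
      using pre(1)[OF B(1)] ray_sets B(2)
      by (intro unit.finite_measure_UNION disjoint_family_vimage) auto
    ultimately show "(\<lambda>i. correlation (ray a) (B i) (n k) T) sums correlation (ray a) (\<Union>i. B i) (n k) T"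
      by simp
  next
    fix k B assume B: "B \<in> sets \<U>"
    have "ray a \<inter> ((T ^^ n k) -` ({0..1} - B) \<inter> space \<U>)
        = ray a \<inter> ((T ^^ n k) -` {0..1} \<inter> space \<U>) - ray a \<inter> ((T ^^ n k) -` B \<inter> space \<U>)" by auto
    moreover have "measure \<U> (ray a \<inter> ((T ^^ n k) -` {0..1} \<inter> space \<U>) - ray a \<inter> ((T ^^ n k) -` B \<inter> space \<U>))
        = correlation (ray a) {0..1} (n k) T - correlation (ray a) B (n k) T"
      using pre(1)[OF B, of "n k"] pre(1)[OF U(1), of "n k"] ray_sets preU
      by (intro unit.finite_measure_Diff) auto
    ultimately show "correlation (ray a) ({0..1} - B) (n k) T
        = correlation (ray a) {0..1} (n k) T - correlation (ray a) B (n k) T" by simp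
    have "correlation (ray a) B (n k) T \<le> measure \<U> ((T ^^ n k) -` B \<inter> space \<U>)"
      using pre(1)[OF B, of "n k"] by (intro unit.finite_measure_mono) auto
    then show "\<bar>correlation (ray a) B (n k) T\<bar> \<le> measure \<U> B" using pre(2)[OF B] by simp
  next
    have "ray a \<inter> {0..1} = ray a" by (auto simp: ray_def)
    then show "(\<lambda>i. correlation (ray a) {0..1} (n i) T) \<longlonglongrightarrow> mixing_limit l (ray a) {0..1}"
      unfolding preU limU[OF ray_sets] by simp
  qed
  define c' where "c' A = mixing_limit l B A" for A
  have "(\<lambda>i. correlation A B (n i) T) \<longlonglongrightarrow> c' A"
  proof (rule dominated_additive_convergence[where c'=c', OF _ _ _ _ _ _ _ A])
    show "(\<lambda>i. correlation (ray a) B (n i) T) \<longlonglongrightarrow> c' (ray a)" for a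
      using ray_B[OF B] by (simp add: c'_def mixing_limit_commute)
    show "(\<lambda>i. c' (X i)) sums c' (\<Union>i. X i)" if "\<And>i. X i \<in> sets \<U>" "disjoint_family X" for X
      unfolding c'_def by (rule mixing_limit_additive(1)[OF B that])
    show "c' ({0..1} - X) = c' {0..1} - c' X" if "X \<in> sets \<U>" for X
      unfolding c'_def by (rule mixing_limit_additive(2)[OF B that])
    fix k
    let ?P = "(T ^^ n k) -` B \<inter> space \<U>"
    have P: "?P \<in> sets \<U>" by (rule pre(1)[OF B])
    show "(\<lambda>i. measure \<U> (X i \<inter> ?P)) sums measure \<U> ((\<Union>i. X i) \<inter> ?P)"
      if X: "\<And>i. X i \<in> sets \<U>" "disjoint_family X" for X
    proof -
      have "(\<lambda>i. measure \<U> (X i \<inter> ?P)) sums measure \<U> (\<Union>i. X i \<inter> ?P)"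
        using X P by (intro unit.finite_measure_UNION) (auto simp: disjoint_family_on_def)
      then show ?thesis by simp
    qed
    fix X assume X: "X \<in> sets \<U>"
    have "({0..1} - X) \<inter> ?P = {0..1} \<inter> ?P - X \<inter> ?P" by auto
    moreover have "measure \<U> ({0..1} \<inter> ?P - X \<inter> ?P) = measure \<U> ({0..1} \<inter> ?P) - measure \<U> (X \<inter> ?P)"
      using X P U sets.sets_into_space[OF X] by (intro unit.finite_measure_Diff) auto
    ultimately show "measure \<U> (({0..1} - X) \<inter> ?P) = measure \<U> ({0..1} \<inter> ?P) - measure \<U> (X \<inter> ?P)" by simp
    show "\<bar>measure \<U> (X \<inter> ?P)\<bar> \<le> measure \<U> X" using X P by (auto intro: unit.finite_measure_mono)
  next
    have "{0..1} \<inter> ((T ^^ n k) -` B \<inter> space \<U>) = (T ^^ n k) -` B \<inter> space \<U>" for k by auto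
    then show "(\<lambda>k. measure \<U> ({0..1} \<inter> ((T ^^ n k) -` B \<inter> space \<U>))) \<longlonglongrightarrow> c' {0..1}"
      using pre(2)[OF B] limU[OF B] by (simp only: c'_def) simp
  qed
  then show ?thesis by (simp add: c'_def mixing_limit_commute)
qed

text \<open>For the converse direction, the times \<open>k\<close> are chosen increasing one after the other, which is
possible as the conditions become stronger with \<open>N\<close>.\<close>

lemma mixing_along_subseq_iff:
  assumes T: "T \<in> mp_automorphisms \<U>"
  shows "mixing_along_subseq \<U> m l T \<longleftrightarrow> (\<forall>N. \<exists>k\<ge>N. nearly_mixing l N (m k) T)"
proof
  assume "mixing_along_subseq \<U> m l T"
  then obtain k where k: "strict_mono k"
    "\<And>A B. A \<in> sets \<U> \<Longrightarrow> B \<in> sets \<U> \<Longrightarrow> (\<lambda>i. correlation A B (m (k i)) T) \<longlonglongrightarrow> mixing_limit l A B"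
    unfolding mixing_along_subseq_def mixing_limit_def by blast
  show "\<forall>N. \<exists>k\<ge>N. nearly_mixing l N (m k) T"
  proof
    fix N
    have "\<forall>\<^sub>F i in sequentially. \<forall>a\<in>{..N}. \<forall>b\<in>{..N}.
        \<bar>correlation (ray a) (ray b) (m (k i)) T - mixing_limit l (ray a) (ray b)\<bar> < 1 / Suc N"
      using tendstoD[OF k(2)[OF ray_sets ray_sets], of "1 / Suc N"]
      by (intro eventually_ball_finite finite_atMost ballI) (simp add: dist_real_def)
    then have "\<forall>\<^sub>F i in sequentially. nearly_mixing l N (m (k i)) T"
      by eventually_elim (auto simp: nearly_mixing_def)
    then obtain i0 where "\<forall>i\<ge>i0. nearly_mixing l N (m (k i)) T" by (auto simp: eventually_sequentially)
    then have "nearly_mixing l N (m (k (max i0 N))) T" by simp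
    moreover have "N \<le> k (max i0 N)" using strict_mono_imp_increasing[OF k(1), of "max i0 N"] by simp
    ultimately show "\<exists>k\<ge>N. nearly_mixing l N (m k) T" by blast
  qed
next
  assume near: "\<forall>N. \<exists>k\<ge>N. nearly_mixing l N (m k) T"
  have "\<exists>k. \<forall>N. nearly_mixing l N (m (k N)) T \<and> k N < k (Suc N)"
  proof (rule dependent_nat_choice)
    show "\<exists>k. nearly_mixing l 0 (m k) T" using near by blast
    fix k N assume "nearly_mixing l N (m k) T"
    obtain k' where "k' \<ge> max (Suc N) (Suc k)" "nearly_mixing l (max (Suc N) (Suc k)) (m k') T"
      using near by blast
    then show "\<exists>k'. nearly_mixing l (Suc N) (m k') T \<and> k < k'"
      by (intro exI[of _ k']) (auto intro: nearly_mixing_antimono)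
  qed
  then obtain k where k: "\<And>N. nearly_mixing l N (m (k N)) T" "\<And>N. k N < k (Suc N)" by blast
  have "(\<lambda>i. correlation (ray a) (ray b) (m (k i)) T) \<longlonglongrightarrow> mixing_limit l (ray a) (ray b)" for a b
  proof (rule LIMSEQ_I)
    fix e :: real assume "0 < e"
    then obtain n where n: "1 / real (Suc n) < e" using nat_approx_posE by blast
    show "\<exists>N0. \<forall>i\<ge>N0. norm (correlation (ray a) (ray b) (m (k i)) T - mixing_limit l (ray a) (ray b)) < e"
    proof (intro exI[of _ "max n (max a b)"] allI impI)
      fix i assume i: "max n (max a b) \<le> i"
      then have "1 / real (Suc i) \<le> 1 / Suc n" by (simp add: frac_le)
      moreover have "\<bar>correlation (ray a) (ray b) (m (k i)) T - mixing_limit l (ray a) (ray b)\<bar> < 1 / Suc i"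
        using k(1)[of i] i by (auto simp: nearly_mixing_def)
      ultimately show "norm (correlation (ray a) (ray b) (m (k i)) T - mixing_limit l (ray a) (ray b)) < e"
        using n by simp
    qed
  qed
  note lim = correlation_limit_from_rays[OF T this]
  moreover have "strict_mono k" using k(2) by (simp add: strict_mono_Suc_iff)
  ultimately show "mixing_along_subseq \<U> m l T"
    unfolding mixing_along_subseq_def mixing_limit_def by blast
qed

lemma nearly_mixing_cong_class:
  assumes "S \<in> mp_automorphisms \<U>" "T \<in> mp_automorphisms \<U>" "aut_class \<U> S = aut_class \<U> T"
  shows "nearly_mixing l N n S \<longleftrightarrow> nearly_mixing l N n T"
  unfolding nearly_mixing_def correlation_cong_class[OF assms(1,2) ray_sets ray_sets assms(3)] ..

lemma openin_nearly_mixing: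
  "openin (weak_topology \<U>) (aut_class \<U> ` {T \<in> mp_automorphisms \<U>. \<exists>k\<ge>N. nearly_mixing l N (m k) T})"
    (is "openin _ ?W")
proof (subst openin_subopen, intro ballI)
  fix x assume "x \<in> ?W"
  then obtain T k where T: "T \<in> mp_automorphisms \<U>" "x = aut_class \<U> T" and k: "N \<le> k" "nearly_mixing l N (m k) T"
    by blast
  define r where "r a b = 1 / Suc N - \<bar>correlation (ray a) (ray b) (m k) T - mixing_limit l (ray a) (ray b)\<bar>" for a b
  define good where "good p V \<longleftrightarrow> openin (weak_topology \<U>) V \<and> x \<in> V \<and>
      (\<forall>S\<in>mp_automorphisms \<U>. aut_class \<U> S \<in> V \<longrightarrow>
        \<bar>correlation (ray (fst p)) (ray (snd p)) (m k) S - correlation (ray (fst p)) (ray (snd p)) (m k) T\<bar>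
          < r (fst p) (snd p))" for p V
  have "\<forall>p\<in>{..N} \<times> {..N}. \<exists>V. good p V"
  proof
    fix p assume "p \<in> {..N} \<times> {..N}"
    then have "0 < r (fst p) (snd p)" using k(2) by (auto simp: r_def nearly_mixing_def)
    then obtain V where "openin (weak_topology \<U>) V" "aut_class \<U> T \<in> V"
      "\<And>S. S \<in> mp_automorphisms \<U> \<Longrightarrow> aut_class \<U> S \<in> V \<Longrightarrow>
        \<bar>correlation (ray (fst p)) (ray (snd p)) (m k) S - correlation (ray (fst p)) (ray (snd p)) (m k) T\<bar>
          < r (fst p) (snd p)"
      by (rule correlation_weakly_continuous[OF T(1) ray_sets ray_sets, where n="m k"]) (rule that)
    then have "good p V" unfolding good_def T(2) by (intro conjI ballI impI)
    then show "\<exists>V. good p V" ..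
  qed
  from bchoice[OF this] obtain V where "\<forall>p\<in>{..N} \<times> {..N}. good p (V p)" ..
  then have V: "good p (V p)" if "p \<in> {..N} \<times> {..N}" for p using that by (rule bspec)
  define O' where "O' = (\<Inter>p\<in>{..N} \<times> {..N}. V p)"
  have O': "openin (weak_topology \<U>) O'"
    unfolding O'_def using V unfolding good_def by (intro openin_INT2) auto
  have "O' \<subseteq> ?W"
  proof
    fix y assume y: "y \<in> O'"
    then have "y \<in> topspace (weak_topology \<U>)" using openin_subset[OF O'] by blast
    then obtain S where S: "S \<in> mp_automorphisms \<U>" "y = aut_class \<U> S" by (auto simp: Aut_eq)
    have "nearly_mixing l N (m k) S"
      unfolding nearly_mixing_def
    proof (intro allI impI)
      fix a b assume "a \<le> N" "b \<le> N"
      then have p: "(a, b) \<in> {..N} \<times> {..N}" by simp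
      then have "aut_class \<U> S \<in> V (a, b)" using y S(2) unfolding O'_def by blast
      with V[OF p] S(1) have "\<bar>correlation (ray a) (ray b) (m k) S - correlation (ray a) (ray b) (m k) T\<bar> < r a b"
        unfolding good_def fst_conv snd_conv by blast
      then show "\<bar>correlation (ray a) (ray b) (m k) S - mixing_limit l (ray a) (ray b)\<bar> < 1 / Suc N"
        unfolding r_def by linarith
    qed
    with S k(1) show "y \<in> ?W" by blast
  qed
  moreover have "x \<in> O'" using V by (auto simp: O'_def good_def)
  ultimately show "\<exists>V. openin (weak_topology \<U>) V \<and> x \<in> V \<and> V \<subseteq> ?W" using O' by blast
qed

theorem corollary1p4:
  fixes m :: "nat \<Rightarrow> nat" and l :: real
  assumes "strict_mono m" and "\<And>k. 1 \<le> m k"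
    and "0 \<le> l" and "l \<le> 1"
  shows "gdelta_in (weak_topology unit_lebesgue)
      (aut_class unit_lebesgue `
        {T \<in> mp_automorphisms unit_lebesgue. mixing_along_subseq unit_lebesgue m l T})
    \<and> weak_topology unit_lebesgue closure_of
      (aut_class unit_lebesgue `
        {T \<in> mp_automorphisms unit_lebesgue. mixing_along_subseq unit_lebesgue m l T})
      = Aut unit_lebesgue"
proof -
  define G where "G = aut_class \<U> ` {T \<in> mp_automorphisms \<U>. mixing_along_subseq \<U> m l T}"
  define W where "W N = aut_class \<U> ` {T \<in> mp_automorphisms \<U>. \<exists>k\<ge>N. nearly_mixing l N (m k) T}" for N
  have W_iff: "aut_class \<U> T \<in> W N \<longleftrightarrow> (\<exists>k\<ge>N. nearly_mixing l N (m k) T)" if T: "T \<in> mp_automorphisms \<U>" for T N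
  proof
    assume "aut_class \<U> T \<in> W N"
    then obtain S where "S \<in> mp_automorphisms \<U>" "\<exists>k\<ge>N. nearly_mixing l N (m k) S" "aut_class \<U> T = aut_class \<U> S"
      by (auto simp: W_def)
    then show "\<exists>k\<ge>N. nearly_mixing l N (m k) T" using nearly_mixing_cong_class[OF T] by blast
  qed (use T in \<open>auto simp: W_def\<close>)
  have openW: "openin (weak_topology \<U>) (W N)" for N
    unfolding W_def by (rule openin_nearly_mixing)
  have G_eq: "G = (\<Inter>N. W N)"
  proof (intro equalityI subsetI)
    fix x assume "x \<in> G"
    then obtain T where T: "T \<in> mp_automorphisms \<U>" "x = aut_class \<U> T" "mixing_along_subseq \<U> m l T"
      by (auto simp: G_def)
    then show "x \<in> (\<Inter>N. W N)" using mixing_along_subseq_iff[OF T(1)] W_iff[OF T(1)] by auto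
  next
    fix x assume x: "x \<in> (\<Inter>N. W N)"
    then have "x \<in> W 0" by blast
    then obtain T where T: "T \<in> mp_automorphisms \<U>" "x = aut_class \<U> T" by (auto simp: W_def)
    with x have "mixing_along_subseq \<U> m l T" using mixing_along_subseq_iff[OF T(1)] W_iff[OF T(1)] by auto
    with T show "x \<in> G" by (auto simp: G_def)
  qed
  have "gdelta_in (weak_topology \<U>) G"
    unfolding G_eq using openW by (intro gdelta_in_Inter) (auto intro: open_imp_gdelta_in)
  moreover have "weak_topology \<U> closure_of G = topspace (weak_topology \<U>)"
    unfolding dense_intersects_open
  proof (intro allI impI, elim conjE)
    fix V assume V: "openin (weak_topology \<U>) V" "V \<noteq> {}"
    then obtain x where "x \<in> V" "x \<in> topspace (weak_topology \<U>)" using openin_subset by blast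
    then obtain T where T: "T \<in> mp_automorphisms \<U>" "aut_class \<U> T \<in> V" by (auto simp: Aut_eq)
    have "\<exists>S\<in>mp_automorphisms \<U>. aut_class \<U> S \<in> V \<and> (\<forall>n. aut_class \<U> S \<in> W n)"
    proof (rule Baire_weak_topology[OF openW _ V(1) T])
      fix n T and e :: real assume T: "T \<in> mp_automorphisms \<U>" "0 < e"
      show "\<exists>S\<in>mp_automorphisms \<U>. aut_class \<U> S \<in> W n \<and> aut_dist S T < e"
        using nearly_mixing_dense[OF T assms(1,3,4), of n] W_iff by blast
    qed
    then show "G \<inter> V \<noteq> {}" unfolding G_eq by blast
  qed
  ultimately show ?thesis unfolding G_def by simp
qed

end
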